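(* Let $\boldsymbol{d}=(d_1,\ldots,d_n)$ be a graphical degree sequence, and let $\boldsymbol{\delta}=(\delta_1,\ldots,\delta_n)$ be such that $\boldsymbol{d}/2-\boldsymbol{\delta}$ and $\boldsymbol{d}/2+\boldsymbol{\delta}$ are sequences of nonnegative integers. Consider a uniformly random undirected simple graph with degree sequence $\boldsymbol{d}$. Suppose that $d_{\max}^4=o(D)$ as $D\to\infty$, and that $\sum_{i=1}^n\delta_i=0$. Then the expected number of orientations with in-degrees $\boldsymbol{d}/2-\boldsymbol{\delta}$ and out-degrees $\boldsymbol{d}/2+\boldsymbol{\delta}$ is $$\frac{2^{D/2}}{\binom{D}{D/2}}\prod_{i=1}^n\binom{d_i}{d_i/2+\delta_i}\,\exp\left(-\frac34+\frac{4\varDelta_2}{D}-\frac{4\varDelta_2^2}{D^2}+\frac{2V^2}{D^2}+O\left(\frac{d_{\max}^4}{D}\right)\right).$$ In particular, if the entries of $\boldsymbol{d}$ are even, the expected number of Eulerian orientations is $$\frac{2^{D/2}}{\binom{D}{D/2}}\prod_{i=1}^n\binom{d_i}{d_i/2}\,\exp\left(-\frac34+O\left(\frac{d_{\max}^4}{D}\right)\right).$$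
   Context: A sequence is graphical if it is the degree sequence of some simple undirected graph on labelled vertices $1,\ldots,n$. An orientation of a graph assigns a direction to each edge; it is Eulerian if every vertex has in-degree equal to out-degree. Notation: $d_{\max}=\max_i d_i$, $D=\sum_{i=1}^n d_i$, $\varDelta_2=\sum_{i=1}^n\delta_i^2$, $V=\sum_{i=1}^n\delta_id_i$. (The $\delta_i$ may be half-integers and may be negative.) Asymptotic convention: one considers an infinite family of instances $(n,\boldsymbol{d},\boldsymbol{\delta})$ along which $D\to\infty$; $o(\cdot)$ refers to this limit, and $O(g)$ denotes a quantity (of either sign) whose absolute value is at most a constant times $g$ for all sufficiently large $D$, uniformly over the family. *)

theory Defs
  imports "HOL-Probability.Probability" "HOL-Library.Ramsey" "HOL-Library.Landau_Symbols"
begin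

definition vertex_degree :: "nat set set \<Rightarrow> nat \<Rightarrow> nat" where
  "vertex_degree E v = card {e \<in> E. v \<in> e}"

text \<open>A simple graph on the vertices \<open>1, \<dots>, n\<close> is represented by its edge set, a set of
  two-element subsets of \<open>{1..n}\<close>. Degree sequences are functions of which only the values
  on \<open>{1..n}\<close> are used.\<close>

definition graphs_with_degrees :: "nat \<Rightarrow> (nat \<Rightarrow> nat) \<Rightarrow> nat set set set" where
  "graphs_with_degrees n d =
     {E. E \<subseteq> nsets {1..n} 2 \<and> (\<forall>v\<in>{1..n}. vertex_degree E v = d v)}"

definition graphical :: "nat \<Rightarrow> (nat \<Rightarrow> nat) \<Rightarrow> bool" where
  "graphical n d \<longleftrightarrow> graphs_with_degrees n d \<noteq> {}"

text \<open>An orientation is given by its set of arcs, where \<open>(u, v)\<close> is directed from \<open>u\<close> to \<open>v\<close>: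
  every arc lies over an edge, and every edge carries exactly one of its two directions.\<close>

definition orientation :: "nat set set \<Rightarrow> (nat \<times> nat) set \<Rightarrow> bool" where
  "orientation E A \<longleftrightarrow> bij_betw (\<lambda>(u, v). {u, v}) A E"

definition in_degree :: "(nat \<times> nat) set \<Rightarrow> nat \<Rightarrow> nat" where
  "in_degree A v = card {u. (u, v) \<in> A}"

definition out_degree :: "(nat \<times> nat) set \<Rightarrow> nat \<Rightarrow> nat" where
  "out_degree A v = card {w. (v, w) \<in> A}"

definition orientations_with_degrees ::
  "nat \<Rightarrow> (nat \<Rightarrow> real) \<Rightarrow> (nat \<Rightarrow> real) \<Rightarrow> nat set set \<Rightarrow> (nat \<times> nat) set set" where
  "orientations_with_degrees n ins outs E =
     {A. orientation E A \<and>
         (\<forall>v\<in>{1..n}. real (in_degree A v) = ins v \<and> real (out_degree A v) = outs v)}"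

definition eulerian_orientations :: "nat \<Rightarrow> nat set set \<Rightarrow> (nat \<times> nat) set set" where
  "eulerian_orientations n E =
     {A. orientation E A \<and> (\<forall>v\<in>{1..n}. in_degree A v = out_degree A v)}"

definition random_graph :: "nat \<Rightarrow> (nat \<Rightarrow> nat) \<Rightarrow> nat set set pmf" where
  "random_graph n d = pmf_of_set (graphs_with_degrees n d)"

definition expected_orientations :: "nat \<Rightarrow> (nat \<Rightarrow> nat) \<Rightarrow> (nat \<Rightarrow> real) \<Rightarrow> real" where
  "expected_orientations n d \<delta> =
     measure_pmf.expectation (random_graph n d)
       (\<lambda>E. real (card (orientations_with_degrees n
          (\<lambda>v. real (d v) / 2 - \<delta> v) (\<lambda>v. real (d v) / 2 + \<delta> v) E)))"

definition expected_eulerian_orientations :: "nat \<Rightarrow> (nat \<Rightarrow> nat) \<Rightarrow> real" where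
  "expected_eulerian_orientations n d =
     measure_pmf.expectation (random_graph n d) (\<lambda>E. real (card (eulerian_orientations n E)))"

text \<open>Unspecified for \<open>n = 0\<close>, which is irrelevant in the limit of large degree sum.\<close>

definition d_max :: "nat \<Rightarrow> (nat \<Rightarrow> nat) \<Rightarrow> nat" where
  "d_max n d = Max (d ` {1..n})"

text \<open>For a graphical sequence the degree sum is even, so halving it with \<open>div\<close> is exact.\<close>

definition degree_sum :: "nat \<Rightarrow> (nat \<Rightarrow> nat) \<Rightarrow> nat" where
  "degree_sum n d = (\<Sum>v=1..n. d v)"

definition Delta2 :: "nat \<Rightarrow> (nat \<Rightarrow> real) \<Rightarrow> real" where
  "Delta2 n \<delta> = (\<Sum>v=1..n. (\<delta> v)\<^sup>2)"

definition V_sum :: "nat \<Rightarrow> (nat \<Rightarrow> nat) \<Rightarrow> (nat \<Rightarrow> real) \<Rightarrow> real" where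
  "V_sum n d \<delta> = (\<Sum>v=1..n. \<delta> v * real (d v))"

end

(* Attach d_v points to each vertex v. A graph with degrees d corresponds to the product of the d_v!
   perfect matchings of the points that project to it, and a graph together with an orientation
   corresponds in the same way to perfect matchings between out-points and in-points. Hence the
   expectation is a ratio of two probabilities that a uniformly random perfect matching, in a
   complete or a complete bipartite graph, has no loop and no two parallel edges; the exact
   factors in front come from the numbers of all perfect matchings.

   Both probabilities are exp(-Lambda + O(d_max^4/D)), where Lambda is the expected number of loops
   and double edges. Forbid these configurations T one at a time: the probability of avoiding all of
   them is the product of 1 - P(T | those forbidden so far do not occur). Each such conditional
   probability is P(T) (1 + O(d_max^2/D)), and Lambda = O(d_max^2). The upper bound is the lopsided
   local lemma argument: configurations that do not conflict with T are positively correlated with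
   T, as a switching p p', q q' -> p q, p' q' shows. For the lower bound, the switching fails to
   preserve avoidance only if p' q' or p q completes a forbidden configuration, and by the upper
   bound this has conditional probability O(d_max^2/D). *)

theory Submission
  imports Defs
begin

section \<open>Perfect matchings and switchings\<close>

text \<open>Write r for the maximum degree and N for D/2. Lambda may be of order r^2, so
  exp(-Lambda) may tend to 0, and an estimate with additive error would say nothing. Every
  comparison below is therefore between two counts of matchings avoiding the same set, up to a
  factor 1 + O(r^2/N). These factors enter the exponent weighted by the probabilities of the
  configurations, whose sum is Lambda; this gives r^2/N times r^2. Both models live in one locale,
  since switchings differ only in how many orderings of a pair they admit. The oriented graph must
  be simple as well, so antiparallel arcs are forbidden too. For this reason loops and double edges
  are defined through cells that hold the in-points and the out-points of a vertex together. The sum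
  S of the squared degrees is not controlled by the formula and has to cancel. For zero \<delta> and
  s = S/D the leading parts of the two Lambdas are s^2/4 - 1/4 (graphs) and s^2/4 + 1/2 (oriented
  graphs), which explains -3/4; the other terms of the exponent come from \<delta>.\<close>

locale matching_model =
  fixes P :: "'p set" and undirected :: bool and col :: "'p \<Rightarrow> bool"
  assumes finite_points: "finite P"
begin

definition allowed :: "'p \<Rightarrow> 'p \<Rightarrow> bool" where
  "allowed x y \<longleftrightarrow> x \<noteq> y \<and> (undirected \<or> col x \<noteq> col y)"

definition edges :: "'p set set" where
  "edges = {{x, y} | x y. x \<in> P \<and> y \<in> P \<and> allowed x y}"

definition matchings :: "'p set set set" where
  "matchings = {M. M \<subseteq> edges \<and> disjoint M \<and> \<Union>M = P}"

text \<open>How many of the two orderings of a pair can be switched against a fixed pair: both in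
  the complete graph, only the one that respects colours in the complete bipartite graph.\<close>

definition mult :: nat where
  "mult = (if undirected then 2 else 1)"

abbreviation half :: nat where
  "half \<equiv> card P div 2"

definition switch :: "'p set set \<Rightarrow> 'p \<Rightarrow> 'p \<Rightarrow> 'p \<Rightarrow> 'p \<Rightarrow> 'p set set" where
  "switch M a b c d = (M - {{a, b}, {c, d}}) \<union> {{a, c}, {b, d}}"

definition avoids :: "'p set set set \<Rightarrow> 'p set set \<Rightarrow> bool" where
  "avoids S M \<longleftrightarrow> (\<forall>T\<in>S. \<not> T \<subseteq> M)"

definition avoiders :: "'p set set set \<Rightarrow> 'p set set \<Rightarrow> 'p set set set" where
  "avoiders S B = {M \<in> matchings. B \<subseteq> M \<and> avoids S M}"

text \<open>Absence of conflict in the sense of the lopsided local lemma: for pairs, no member of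
  \<open>T\<close> shares exactly one point with \<open>e\<close>.\<close>

definition compatible :: "'p set set \<Rightarrow> 'p set \<Rightarrow> bool" where
  "compatible T e \<longleftrightarrow> (\<forall>f\<in>T. f = e \<or> f \<inter> e = {})"

lemma allowed_sym: "allowed x y \<longleftrightarrow> allowed y x"
  unfolding allowed_def by auto

lemma allowed_neq: "allowed x y \<Longrightarrow> x \<noteq> y"
  unfolding allowed_def by auto

lemma doubleton_in_edges:
  "{x, y} \<in> edges \<longleftrightarrow> x \<in> P \<and> y \<in> P \<and> allowed x y"
  unfolding edges_def using allowed_sym by (auto simp: doubleton_eq_iff)

lemma edge_cases:
  assumes "e \<in> edges"
  obtains x y where "e = {x, y}" "x \<in> P" "y \<in> P" "allowed x y"
  using assms unfolding edges_def by auto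

lemma finite_edges: "finite edges"
proof -
  have "edges \<subseteq> Pow P" unfolding edges_def by auto
  then show ?thesis using finite_points finite_subset by blast
qed

lemma card_edge: "e \<in> edges \<Longrightarrow> card e = 2"
  by (elim edge_cases) (auto dest: allowed_neq)

lemma finite_matchings: "finite matchings"
proof -
  have "matchings \<subseteq> Pow edges" unfolding matchings_def by auto
  then show ?thesis using finite_edges finite_subset by blast
qed

lemma finite_avoiders [simp]: "finite (avoiders S B)"
  unfolding avoiders_def using finite_matchings by auto

lemma matching_edges: "M \<in> matchings \<Longrightarrow> e \<in> M \<Longrightarrow> e \<in> edges"
  unfolding matchings_def by auto

lemma matching_finite: "M \<in> matchings \<Longrightarrow> finite M"
  unfolding matchings_def using finite_edges finite_subset by auto

lemma matching_unique:
  "M \<in> matchings \<Longrightarrow> e \<in> M \<Longrightarrow> f \<in> M \<Longrightarrow> x \<in> e \<Longrightarrow> x \<in> f \<Longrightarrow> e = f"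
  unfolding matchings_def disjoint_def by auto

lemma card_matching:
  assumes "M \<in> matchings"
  shows "card P = 2 * card M"
proof -
  have "card (\<Union>M) = (\<Sum>e\<in>M. card e)"
    using assms card_edge finite_points
    by (intro card_Union_disjoint)
       (auto simp: matchings_def disjoint_def pairwise_def disjnt_def
             intro: card_ge_0_finite dest!: subsetD)
  also have "\<dots> = (\<Sum>e\<in>M. 2)"
    using assms by (intro sum.cong) (auto simp: card_edge matching_edges)
  finally show ?thesis using assms by (simp add: matchings_def)
qed

lemma matching_partner:
  assumes "M \<in> matchings" "p \<in> P"
  obtains x where "{p, x} \<in> M" "x \<noteq> p"
proof -
  from assms obtain e where e: "e \<in> M" "p \<in> e" unfolding matchings_def by auto
  then obtain x y where "e = {x, y}" "allowed x y"
    using assms matching_edges edge_cases by metis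
  with e that show ?thesis by (metis allowed_neq insertE insert_commute singletonD)
qed

lemma switch_matching:
  assumes M: "M \<in> matchings" and ab: "{a, b} \<in> M" and cd: "{c, d} \<in> M"
    and ne: "{a, b} \<noteq> {c, d}" and ac: "allowed a c" and bd: "allowed b d"
  shows "switch M a b c d \<in> matchings"
proof -
  have P: "a \<in> P" "b \<in> P" "c \<in> P" "d \<in> P" "allowed a b" "allowed c d"
    using matching_edges[OF M ab] matching_edges[OF M cd] by (auto simp: doubleton_in_edges)
  have sub: "switch M a b c d \<subseteq> edges"
    using M ac bd P by (auto simp: switch_def matching_edges doubleton_in_edges)
  have other: "f \<inter> {a, b, c, d} = {}" if "f \<in> M" "f \<noteq> {a, b}" "f \<noteq> {c, d}" for f
    using matching_unique[OF M that(1) ab] matching_unique[OF M that(1) cd] that by auto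
  have dist: "{a, b} \<inter> {c, d} = {}"
    using matching_unique[OF M ab cd] ne by auto
  have dj: "disjoint (switch M a b c d)"
  proof (unfold disjoint_def, intro ballI impI)
    fix e f assume e: "e \<in> switch M a b c d" and f: "f \<in> switch M a b c d" and "e \<noteq> f"
    consider "e \<in> M - {{a, b}, {c, d}}" "f \<in> M - {{a, b}, {c, d}}"
      | "e \<in> M - {{a, b}, {c, d}}" "f \<in> {{a, c}, {b, d}}"
      | "f \<in> M - {{a, b}, {c, d}}" "e \<in> {{a, c}, {b, d}}"
      | "e \<in> {{a, c}, {b, d}}" "f \<in> {{a, c}, {b, d}}"
      using e[unfolded switch_def Un_iff] f[unfolded switch_def Un_iff] by argo
    then show "e \<inter> f = {}"
    proof cases
      case 1 then show ?thesis using matching_unique[OF M] \<open>e \<noteq> f\<close> by auto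
    next
      case 2 then show ?thesis using other[of e] by auto
    next
      case 3 then show ?thesis using other[of f] by auto
    next
      case 4 then show ?thesis using \<open>e \<noteq> f\<close> dist P(5,6) allowed_neq by auto
    qed
  qed
  have "\<Union>(switch M a b c d) = P"
  proof -
    have "\<Union>(switch M a b c d) = \<Union>(M - {{a, b}, {c, d}}) \<union> ({a, b} \<union> {c, d})"
      unfolding switch_def by auto
    also have "\<dots> = \<Union>M" using ab cd by blast
    finally show ?thesis using M by (simp add: matchings_def)
  qed
  with sub dj show ?thesis by (simp add: matchings_def)
qed

lemma switch_switch:
  assumes M: "M \<in> matchings" and ab: "{a, b} \<in> M" and cd: "{c, d} \<in> M"
    and ne: "{a, b} \<noteq> {c, d}"
  shows "switch (switch M a b c d) a c b d = M" "{a, c} \<notin> M" "{b, d} \<notin> M"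
proof -
  have dist: "{a, b} \<inter> {c, d} = {}"
    using matching_unique[OF M ab cd] ne by auto
  show 1: "{a, c} \<notin> M" "{b, d} \<notin> M"
    using matching_unique[OF M ab, of "{a,c}"] matching_unique[OF M ab, of "{b,d}"] dist
    by (auto simp: doubleton_eq_iff)
  show "switch (switch M a b c d) a c b d = M"
    using ab cd 1 unfolding switch_def by auto
qed

text \<open>A switching replaces the pairs \<open>{p, q}\<close> and \<open>{x, y}\<close> by \<open>{p, x}\<close> and \<open>{q, y}\<close>. Reading it
  backwards, every matching without \<open>{p, q}\<close> arises exactly once.\<close>

definition switchings :: "'p set set \<Rightarrow> 'p \<Rightarrow> 'p \<Rightarrow> ('p set set \<times> 'p \<times> 'p) set" where
  "switchings B p q =
     {(M, x, y). M \<in> matchings \<and> insert {p, q} B \<subseteq> M \<and> {x, y} \<in> M - insert {p, q} B \<and>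
                 allowed p x \<and> allowed q y}"

text \<open>In a matching without \<open>{p, q}\<close> the partners of \<open>p\<close> and
  \<open>q\<close> are the only candidates for \<open>x\<close> and \<open>y\<close>, so the
  switching can be undone in exactly one way. The pairs of \<open>B\<close> survive in both
  directions: they avoid \<open>p\<close> and \<open>q\<close>, and \<open>{x, y}\<close> lies
  outside \<open>B\<close>.\<close>

lemma switch_bij:
  assumes pq: "{p, q} \<in> edges" and disj: "{p, q} \<inter> \<Union>B = {}"
  shows "bij_betw (\<lambda>(M, x, y). switch M p q x y) (switchings B p q)
           {M \<in> matchings. B \<subseteq> M \<and> {p, q} \<notin> M}"
proof (rule bij_betw_imageI)
  have pq': "p \<in> P" "q \<in> P" "allowed p q" using pq by (auto simp: doubleton_in_edges)
  show "inj_on (\<lambda>(M, x, y). switch M p q x y) (switchings B p q)"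
  proof (rule inj_onI, clarsimp)
    fix M x y M' x' y'
    assume a: "(M, x, y) \<in> switchings B p q" and a': "(M', x', y') \<in> switchings B p q"
      and eq: "switch M p q x y = switch M' p q x' y'"
    from a have s: "M \<in> matchings" "{p, q} \<in> M" "{x, y} \<in> M" "{p, q} \<noteq> {x, y}"
        "allowed p x" "allowed q y" by (auto simp: switchings_def)
    from a' have s': "M' \<in> matchings" "{p, q} \<in> M'" "{x', y'} \<in> M'" "{p, q} \<noteq> {x', y'}"
        "allowed p x'" "allowed q y'" by (auto simp: switchings_def)
    let ?N = "switch M p q x y"
    have N: "?N \<in> matchings" using switch_matching s by auto
    have "{p, x} \<in> ?N" "{q, y} \<in> ?N" by (simp_all add: switch_def)
    moreover have "{p, x'} \<in> ?N" "{q, y'} \<in> ?N" unfolding eq by (simp_all add: switch_def)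
    ultimately have "{p, x} = {p, x'}" "{q, y} = {q, y'}"
      using matching_unique[OF N, of "{p, x}" "{p, x'}" p]
        matching_unique[OF N, of "{q, y}" "{q, y'}" q] by simp_all
    then have xy: "x = x'" "y = y'" by (auto simp: doubleton_eq_iff)
    have "M = switch ?N p x q y" using switch_switch(1)[OF s(1-4)] by simp
    also have "\<dots> = M'" using switch_switch(1)[OF s'(1-4)] eq xy by simp
    finally show "M = M' \<and> x = x' \<and> y = y'" using xy by auto
  qed
  show "(\<lambda>(M, x, y). switch M p q x y) ` switchings B p q =
          {M \<in> matchings. B \<subseteq> M \<and> {p, q} \<notin> M}" (is "?L = ?R")
  proof (intro equalityI subsetI)
    fix N assume "N \<in> ?L"
    then obtain M x y where a: "(M, x, y) \<in> switchings B p q" and N: "N = switch M p q x y" by auto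
    from a have s: "M \<in> matchings" "{p, q} \<in> M" "{x, y} \<in> M" "{p, q} \<noteq> {x, y}"
        "allowed p x" "allowed q y" "B \<subseteq> M" "{x, y} \<notin> B" by (auto simp: switchings_def)
    have "{p, q} \<notin> B" using disj by auto
    have dist: "{p, q} \<inter> {x, y} = {}"
      using matching_unique[OF s(1,2,3)] s(4) by auto
    then have "{p, q} \<notin> N" using N pq' allowed_neq[OF pq'(3)] by (auto simp: switch_def doubleton_eq_iff)
    moreover have "B \<subseteq> N" using s(7,8) N \<open>{p, q} \<notin> B\<close> by (auto simp: switch_def)
    ultimately show "N \<in> ?R" using switch_matching s N by auto
  next
    fix N assume "N \<in> ?R"
    then have N: "N \<in> matchings" "B \<subseteq> N" "{p, q} \<notin> N" by auto
    obtain x where x: "{p, x} \<in> N" using matching_partner[OF N(1) pq'(1)] by auto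
    obtain y where y: "{q, y} \<in> N" using matching_partner[OF N(1) pq'(2)] by auto
    have ne: "{p, x} \<noteq> {q, y}" using x N(3) allowed_neq[OF pq'(3)] by (auto simp: doubleton_eq_iff)
    then have dist: "{p, x} \<inter> {q, y} = {}" using matching_unique[OF N(1) x y] by auto
    have al: "allowed p x" "allowed q y"
      using matching_edges[OF N(1) x] matching_edges[OF N(1) y] by (auto simp: doubleton_in_edges)
    \<comment> \<open>In the bipartite model colours alternate along \<open>x\<close>,
      \<open>p\<close>, \<open>q\<close>, \<open>y\<close>, so \<open>x\<close> and \<open>y\<close>
      differ in colour; \<open>dist\<close> gives \<open>x \<noteq> y\<close> in either
      model.\<close>
    have xy: "allowed x y" using al pq'(3) dist unfolding allowed_def by auto
    have M: "switch N p x q y \<in> matchings" using switch_matching[OF N(1) x y ne pq'(3) xy] .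
    have "{p, x} \<notin> B" "{q, y} \<notin> B" using disj by auto
    then have "B \<subseteq> switch N p x q y" using N(2) by (auto simp: switch_def)
    moreover have "{x, y} \<notin> B" using switch_switch(3)[OF N(1) x y ne] N(2) by auto
    moreover have "{x, y} \<noteq> {p, q}" using dist allowed_neq[OF al(1)] by (auto simp: doubleton_eq_iff)
    ultimately have "(switch N p x q y, x, y) \<in> switchings B p q"
      using M al unfolding switchings_def by (auto simp: switch_def)
    then show "N \<in> ?L" using switch_switch(1)[OF N(1) x y ne] by force
  qed
qed

text \<open>In the bipartite model \<open>p\<close> and \<open>q\<close> have different colours, and
  so have the ends of \<open>f\<close>; exactly one ordering of \<open>f\<close> puts the colour of
  \<open>q\<close> first.\<close>

lemma card_orientations_of_edge:
  assumes "M \<in> matchings" "{p, q} \<in> M" "f \<in> M" "f \<noteq> {p, q}"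
  shows "card {(x, y). {x, y} = f \<and> allowed p x \<and> allowed q y} = mult"
proof -
  obtain a b where f: "f = {a, b}" and ab: "allowed a b"
    using assms matching_edges edge_cases by metis
  have pq: "allowed p q" using matching_edges[OF assms(1,2)] by (auto simp: doubleton_in_edges)
  have dist: "{p, q} \<inter> {a, b} = {}"
    using matching_unique[OF assms(1,2,3)] assms(4) f by auto
  have "a \<noteq> b" using ab allowed_neq by auto
  show ?thesis
  proof (cases undirected)
    case True
    then have "{(x, y). {x, y} = f \<and> allowed p x \<and> allowed q y} = {(a, b), (b, a)}"
      using f dist unfolding allowed_def by (auto simp: doubleton_eq_iff)
    then show ?thesis using True \<open>a \<noteq> b\<close> unfolding mult_def by simp
  next
    case False
    then have "{(x, y). {x, y} = f \<and> allowed p x \<and> allowed q y} =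
       (if col p \<noteq> col a then {(a, b)} else {(b, a)})"
      using f dist ab pq unfolding allowed_def by (auto simp: doubleton_eq_iff)
    then show ?thesis using False unfolding mult_def by simp
  qed
qed

lemma card_switchings_fibre:
  assumes "M \<in> matchings" "insert {p, q} B \<subseteq> M" "{p, q} \<notin> B"
  shows "card {(x, y). {x, y} \<in> M - insert {p, q} B \<and> allowed p x \<and> allowed q y} =
           mult * (half - 1 - card B)"
proof -
  have fM: "finite M" using matching_finite assms by auto
  have fB: "finite B" using fM assms(2) finite_subset by auto
  let ?F = "\<lambda>f. {(x, y). {x, y} = f \<and> allowed p x \<and> allowed q y}"
  have "{(x, y). {x, y} \<in> M - insert {p, q} B \<and> allowed p x \<and> allowed q y} =
        (\<Union>f\<in>M - insert {p, q} B. ?F f)" by auto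
  also have "card \<dots> = (\<Sum>f\<in>M - insert {p, q} B. card (?F f))"
  proof (rule card_UN_disjoint)
    show "\<forall>f\<in>M - insert {p, q} B. finite (?F f)"
      using card_orientations_of_edge[OF assms(1), of p q] assms(2)
      by (intro ballI card_ge_0_finite) (auto simp: mult_def)
  qed (use fM in auto)
  also have "\<dots> = (\<Sum>f\<in>M - insert {p, q} B. mult)"
    using card_orientations_of_edge[OF assms(1), of p q] assms(2) by (intro sum.cong) auto
  also have "\<dots> = card (M - insert {p, q} B) * mult" by simp
  also have "card (M - insert {p, q} B) = card M - card (insert {p, q} B)"
    using assms fB by (intro card_Diff_subset) auto
  also have "card (insert {p, q} B) = Suc (card B)" using assms fB by auto
  finally show ?thesis using card_matching[OF assms(1)] by simp
qed

text \<open>The number of switchings does not depend on the matching they start from: it has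
  \<open>half\<close> pairs, of which \<open>{p, q}\<close> and those of \<open>B\<close> are
  excluded, with \<open>mult\<close> orderings each. So any property \<open>Q\<close> of the initial
  matching can be carried along.\<close>

lemma card_switchings:
  assumes "{p, q} \<notin> B"
  shows "card {z \<in> switchings B p q. Q (fst z)} =
     mult * (half - 1 - card B) * card {M \<in> matchings. insert {p, q} B \<subseteq> M \<and> Q M}"
proof -
  let ?A = "{M \<in> matchings. insert {p, q} B \<subseteq> M \<and> Q M}"
  let ?F = "\<lambda>M. {(x, y). {x, y} \<in> M - insert {p, q} B \<and> allowed p x \<and> allowed q y}"
  have fin: "finite ?A" using finite_matchings by auto
  have "finite (?F M)" if "M \<in> ?A" for M
  proof (rule finite_subset)
    show "?F M \<subseteq> P \<times> P" using that matching_edges doubleton_in_edges by auto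
  qed (use finite_points in auto)
  moreover have "{z \<in> switchings B p q. Q (fst z)} = Sigma ?A ?F"
    unfolding switchings_def by auto
  ultimately have "card {z \<in> switchings B p q. Q (fst z)} = (\<Sum>M\<in>?A. card (?F M))"
    using fin by (simp add: card_SigmaI)
  also have "\<dots> = (\<Sum>M\<in>?A. mult * (half - 1 - card B))"
    using assms card_switchings_fibre by (intro sum.cong) auto
  finally show ?thesis by simp
qed

lemma finite_switchings: "finite (switchings B p q)"
proof (rule finite_subset)
  show "switchings B p q \<subseteq> matchings \<times> P \<times> P"
    unfolding switchings_def using matching_edges doubleton_in_edges by auto
qed (use finite_points finite_matchings in auto)

text \<open>Avoiders are split by whether they contain \<open>{p, q}\<close>; those that do not are
  counted through their unique preimages under switching.\<close>

lemma card_avoiders_split: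
  assumes pq: "{p, q} \<in> edges" and disj: "{p, q} \<inter> \<Union>B = {}"
  shows "card (avoiders S B) = card (avoiders S (insert {p, q} B)) +
     card {z \<in> switchings B p q. case z of (M, x, y) \<Rightarrow> avoids S (switch M p q x y)}"
proof -
  let ?h = "\<lambda>(M, x, y). switch M p q x y"
  have "avoiders S B = avoiders S (insert {p, q} B) \<union> (avoiders S B - {M. {p, q} \<in> M})"
    unfolding avoiders_def by auto
  then have "card (avoiders S B) =
      card (avoiders S (insert {p, q} B)) + card (avoiders S B - {M. {p, q} \<in> M})"
    by (subst card_Un_disjoint[symmetric]) (auto simp: avoiders_def finite_matchings)
  also have "avoiders S B - {M. {p, q} \<in> M} = ?h ` {z \<in> switchings B p q. avoids S (?h z)}"
  proof -
    have "avoiders S B - {M. {p, q} \<in> M} = {M \<in> ?h ` switchings B p q. avoids S M}"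
      unfolding bij_betw_imp_surj_on[OF switch_bij[OF assms]] avoiders_def by auto
    then show ?thesis by (simp only: Compr_image_eq)
  qed
  also have "card \<dots> = card {z \<in> switchings B p q. avoids S (?h z)}"
    using switch_bij[OF assms] unfolding bij_betw_def
    by (intro card_image) (auto intro: inj_on_subset)
  finally show ?thesis by (simp add: case_prod_beta)
qed

text \<open>Both new pairs meet \<open>{p, q}\<close> in a single point, so a configuration
  compatible with \<open>{p, q}\<close> contains neither. A switching cannot create it.\<close>

lemma compatible_switch:
  assumes "compatible T {p, q}" "T \<subseteq> switch M p q x y" "{p, q} \<in> M" "{p, q} \<noteq> {x, y}"
    "M \<in> matchings" "{x, y} \<in> M"
  shows "T \<subseteq> M"
proof
  fix f assume f: "f \<in> T"
  have "f \<noteq> {p, x}" "f \<noteq> {q, y}"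
  proof -
    have "{p, q} \<inter> {x, y} = {}" using assms matching_unique by blast
    moreover have "f = {p, q} \<or> f \<inter> {p, q} = {}"
      using assms(1) f unfolding compatible_def by auto
    ultimately show "f \<noteq> {p, x}" "f \<noteq> {q, y}" by (auto simp: doubleton_eq_iff)
  qed
  with assms(2) f show "f \<in> M" unfolding switch_def by auto
qed

text \<open>Positive correlation: every switching of an avoider is again an avoider, so avoiding
  compatible configurations can only make \<open>{p, q}\<close> less likely. The summand 1 accounts
  for the matching before it is switched.\<close>

lemma avoiders_insert_le:
  assumes pq: "{p, q} \<in> edges" and disj: "{p, q} \<inter> \<Union>B = {}"
    and comp: "\<And>T. T \<in> S \<Longrightarrow> compatible T {p, q}"
  shows "(mult * (half - 1 - card B) + 1) * card (avoiders S (insert {p, q} B)) \<le>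
           card (avoiders S B)"
proof -
  have nB: "{p, q} \<notin> B" using disj by auto
  have "{z \<in> switchings B p q. avoids S (fst z)} \<subseteq>
      {z \<in> switchings B p q. case z of (M, x, y) \<Rightarrow> avoids S (switch M p q x y)}"
  proof
    fix z assume z: "z \<in> {z \<in> switchings B p q. avoids S (fst z)}"
    obtain M x y where Mxy: "z = (M, x, y)" by (cases z)
    have *: "M \<in> matchings" "{p, q} \<in> M" "{x, y} \<in> M" "{p, q} \<noteq> {x, y}" "avoids S M"
      using z Mxy by (auto simp: switchings_def)
    have "avoids S (switch M p q x y)"
      using compatible_switch[OF comp _ *(2,4,1,3)] *(5) unfolding avoids_def by meson
    then show "z \<in> {z \<in> switchings B p q. case z of (M, x, y) \<Rightarrow> avoids S (switch M p q x y)}"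
      using z Mxy by simp
  qed
  then have "card {z \<in> switchings B p q. avoids S (fst z)} \<le>
      card {z \<in> switchings B p q. case z of (M, x, y) \<Rightarrow> avoids S (switch M p q x y)}"
    using finite_switchings by (intro card_mono) auto
  then show ?thesis
    using card_avoiders_split[OF pq disj, of S] card_switchings[OF nB, of "avoids S"]
    unfolding avoiders_def[of S "insert {p, q} B"] by simp
qed

text \<open>The reverse comparison, at the price of the switchings that destroy a forbidden
  configuration. \<open>card_bad_switchings\<close> shows that these are few.\<close>

lemma avoiders_le_insert:
  assumes pq: "{p, q} \<in> edges" and disj: "{p, q} \<inter> \<Union>B = {}"
  shows "card (avoiders S B) \<le>
     (mult * (half - 1 - card B) + 1) * card (avoiders S (insert {p, q} B)) +
     card {z \<in> switchings B p q.
       case z of (M, x, y) \<Rightarrow> avoids S (switch M p q x y) \<and> \<not> avoids S M}"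
proof -
  have nB: "{p, q} \<notin> B" using disj by auto
  let ?X = "{z \<in> switchings B p q.
       case z of (M, x, y) \<Rightarrow> avoids S (switch M p q x y) \<and> \<not> avoids S M}"
  have "{z \<in> switchings B p q. case z of (M, x, y) \<Rightarrow> avoids S (switch M p q x y)} \<subseteq>
      {z \<in> switchings B p q. avoids S (fst z)} \<union> ?X" by auto
  then have "card {z \<in> switchings B p q. case z of (M, x, y) \<Rightarrow> avoids S (switch M p q x y)} \<le>
      card ({z \<in> switchings B p q. avoids S (fst z)} \<union> ?X)"
    using finite_switchings by (intro card_mono) auto
  also have "\<dots> \<le> card {z \<in> switchings B p q. avoids S (fst z)} + card ?X"
    by (rule card_Un_le)
  finally show ?thesis
    using card_avoiders_split[OF pq disj, of S] card_switchings[OF nB, of "avoids S"]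
    unfolding avoiders_def[of S "insert {p, q} B"] by simp
qed

text \<open>With nothing forbidden, both comparisons hold without error.\<close>

lemma card_matchings_insert:
  assumes pq: "{p, q} \<in> edges" and disj: "{p, q} \<inter> \<Union>B = {}"
  shows "card (avoiders {} B) =
     (mult * (half - 1 - card B) + 1) * card (avoiders {} (insert {p, q} B))"
  using avoiders_insert_le[OF assms, of "{}"] avoiders_le_insert[OF assms, of "{}"]
  by (simp add: avoids_def)

end

section \<open>Avoiding loops and double edges\<close>

text \<open>A cell holds the points of one vertex, so \<open>r\<close> bounds the degrees and
  \<open>N\<close> is the number of pairs in a perfect matching. The factor 1000 makes
  \<open>rho\<close> at most 1/1000, which leaves room for all linear error bounds below.\<close>

locale celled_matching_model = matching_model P undirected col
  for P :: "'p set" and undirected :: bool and col :: "'p \<Rightarrow> bool" +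
  fixes cell :: "'p \<Rightarrow> 'v" and N r :: nat
  assumes card_points: "card P = 2 * N"
    and cell_le: "\<And>v. card {y \<in> P. cell y = v} \<le> r"
    and r_pos: "r \<ge> 1"
    and N_large: "N \<ge> 1000 * r\<^sup>2"
begin

definition loops :: "'p set set set" where
  "loops = {{{x, y}} | x y. {x, y} \<in> edges \<and> cell x = cell y}"

text \<open>Repeated loops are left out, so that no forbidden configuration contains another one.\<close>

definition doubles :: "'p set set set" where
  "doubles = {{{x, y}, {x', y'}} | x y x' y'. {x, y} \<in> edges \<and> {x', y'} \<in> edges \<and>
     x \<noteq> x' \<and> y \<noteq> y' \<and> cell x = cell x' \<and> cell y = cell y' \<and> cell x \<noteq> cell y}"

definition bad :: "'p set set set" where
  "bad = loops \<union> doubles"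

definition partial_matching :: "'p set set \<Rightarrow> bool" where
  "partial_matching C \<longleftrightarrow> C \<subseteq> edges \<and> disjoint C"

text \<open>The probability that a uniformly random perfect matching contains \<open>k\<close> given
  disjoint pairs: the factors are 1/(2N - 1 - 2j) in the complete graph and 1/(N - j) in the
  bipartite one. See \<open>g_empty_eq\<close>.\<close>

definition pr :: "nat \<Rightarrow> real" where
  "pr k = (\<Prod>j<k. 1 / real (mult * (N - 1 - j) + 1))"

abbreviation g :: "'p set set set \<Rightarrow> 'p set set \<Rightarrow> real" where
  "g S B \<equiv> real (card (avoiders S B))"

text \<open>The neighbourhood of \<open>C\<close> in the lopsided dependency graph.\<close>

definition conflicting :: "'p set set set \<Rightarrow> 'p set set \<Rightarrow> 'p set set set" where
  "conflicting S C = {T \<in> S. \<exists>e\<in>C. \<not> compatible T e}"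

abbreviation rho :: real where
  "rho \<equiv> (real r)\<^sup>2 / real N"

lemma half_eq: "half = N"
  by (simp add: card_points)

lemma r_le_square: "real r \<le> (real r)\<^sup>2"
  using r_pos by (simp add: power2_eq_square)

lemma N_large': "real N \<ge> 1000 * (real r)\<^sup>2"
  using N_large by (metis of_nat_le_iff of_nat_mult of_nat_numeral of_nat_power)

lemma N_ge: "N \<ge> 1000"
proof -
  have "1 \<le> r\<^sup>2" using r_pos by simp
  then show ?thesis using N_large by linarith
qed

lemma rho_small: "rho \<le> 1 / 1000"
  using N_large' N_ge by (simp add: field_simps)

lemma rho_nonneg: "rho \<ge> 0" by simp

lemma mult_pos: "mult \<ge> 1" by (simp add: mult_def)

lemma pr_0 [simp]: "pr 0 = 1" by (simp add: pr_def)

lemma pr_Suc: "pr (Suc k) = pr k / real (mult * (N - 1 - k) + 1)"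
  by (simp add: pr_def)

lemma pr_pos: "pr k > 0"
  unfolding pr_def by (intro prod_pos) (simp add: add_pos_nonneg)

text \<open>For few pairs every further factor of \<open>pr\<close> is at most 2/N. Four pairs
  suffice: the largest partial matchings needed consist of one prescribed pair and a pattern of
  three.\<close>

lemma pr_add_le: "b + k \<le> 4 \<Longrightarrow> pr (b + k) \<le> pr b * (2 / real N) ^ k"
proof (induction k)
  case (Suc k)
  have "N - 1 - (b + k) \<le> mult * (N - 1 - (b + k))" using mult_pos by simp
  then have "real (N - 1 - (b + k)) \<le> real (mult * (N - 1 - (b + k)))" by (rule of_nat_mono)
  moreover have "real N / 2 \<le> real (N - 1 - (b + k)) + 1"
    using N_ge Suc.prems by linarith
  ultimately have "real N / 2 \<le> real (mult * (N - 1 - (b + k)) + 1)" by simp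
  then have "1 / real (mult * (N - 1 - (b + k)) + 1) \<le> 2 / real N"
    using N_ge by (auto simp: field_simps simp del: of_nat_add of_nat_mult)
  then have "pr (b + k) * (1 / real (mult * (N - 1 - (b + k)) + 1)) \<le>
      pr b * (2 / real N) ^ k * (2 / real N)"
    using Suc pr_pos[of "b + k"] by (intro mult_mono) auto
  then show ?case by (simp add: pr_Suc mult_ac)
qed simp

lemma pr_le: "k \<le> 4 \<Longrightarrow> pr k \<le> (2 / real N) ^ k"
  using pr_add_le[of 0 k] by simp

lemma finite_cell: "finite {y \<in> P. cell y = v}"
  using finite_points by simp

lemma loop_cases:
  assumes "T \<in> loops"
  obtains x y where "T = {{x, y}}" "{x, y} \<in> edges" "cell x = cell y"
  using assms unfolding loops_def by blast

lemma double_cases: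
  assumes "T \<in> doubles"
  obtains x y x' y' where "T = {{x, y}, {x', y'}}" "{x, y} \<in> edges" "{x', y'} \<in> edges"
    "x \<noteq> x'" "y \<noteq> y'" "cell x = cell x'" "cell y = cell y'" "cell x \<noteq> cell y"
  using assms unfolding doubles_def by blast

lemma card_loop: "T \<in> loops \<Longrightarrow> card T = 1"
  by (elim loop_cases) simp

lemma card_double: "T \<in> doubles \<Longrightarrow> card T = 2"
proof (elim double_cases)
  fix x y x' y'
  assume "T = {{x, y}, {x', y'}}" "x \<noteq> x'" "cell y = cell y'" "cell x \<noteq> cell y"
  then show ?thesis by (auto simp: doubleton_eq_iff card_insert_if)
qed

lemma bad_partial_matching: "T \<in> bad \<Longrightarrow> partial_matching T"
  unfolding bad_def partial_matching_def
  by (elim UnE loop_cases double_cases) (auto simp: disjoint_def)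

lemma bad_card: "T \<in> bad \<Longrightarrow> card T \<in> {1, 2}"
  unfolding bad_def using card_loop card_double by auto

lemma bad_finite: "T \<in> bad \<Longrightarrow> finite T"
  using bad_card[of T] by (auto intro: card_ge_0_finite)

text \<open>The pairs of a double edge join different cells and so are not loops. Hence prescribing
  the pairs of one forbidden configuration does not force another one, which \<open>g_lower\<close>
  relies on.\<close>

lemma bad_antichain:
  assumes "T \<in> bad" "T' \<in> bad" "T' \<subseteq> T"
  shows "T' = T"
proof (rule card_seteq)
  show "card T \<le> card T'"
  proof (cases "T' \<in> loops \<and> T \<in> doubles")
    case True
    then obtain a b where ab: "T' = {{a, b}}" "cell a = cell b" by (auto elim: loop_cases)
    from True obtain x y x' y' where "T = {{x, y}, {x', y'}}" "cell x = cell x'"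
      "cell y = cell y'" "cell x \<noteq> cell y" by (auto elim: double_cases)
    with ab assms(3) show ?thesis by (auto simp: doubleton_eq_iff)
  next
    case False
    then show ?thesis using assms card_loop card_double unfolding bad_def by force
  qed
qed (use assms bad_finite in auto)

lemma finite_bad: "finite bad"
proof (rule finite_subset)
  show "bad \<subseteq> Pow edges" using bad_partial_matching unfolding partial_matching_def by auto
qed (simp add: finite_edges)

section \<open>Numbers of forbidden configurations, in total and through a point\<close>

lemma card_loops_touching: "card {T \<in> loops. x \<in> \<Union>T} \<le> r"
proof -
  have "{T \<in> loops. x \<in> \<Union>T} \<subseteq> (\<lambda>y. {{x, y}}) ` {y \<in> P. cell y = cell x}"
  proof
    fix T assume "T \<in> {T \<in> loops. x \<in> \<Union>T}"
    then obtain a b where T: "T = {{a, b}}" "{a, b} \<in> edges" "cell a = cell b" and x: "x \<in> {a, b}"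
      by (auto elim: loop_cases)
    from x show "T \<in> (\<lambda>y. {{x, y}}) ` {y \<in> P. cell y = cell x}"
      using T doubleton_in_edges by (auto simp: insert_commute image_iff)
  qed
  then have "card {T \<in> loops. x \<in> \<Union>T} \<le> card ((\<lambda>y. {{x, y}}) ` {y \<in> P. cell y = cell x})"
    using finite_cell by (intro card_mono) auto
  also have "\<dots> \<le> card {y \<in> P. cell y = cell x}" using finite_cell by (rule card_image_le)
  finally show ?thesis using cell_le le_trans by blast
qed

lemma card_pairs_le:
  assumes "A \<subseteq> P"
  shows "card (SIGMA y:A. {z \<in> P. cell z = cell y}) \<le> card A * r"
proof -
  have "finite A" using assms finite_points finite_subset by auto
  then have "card (SIGMA y:A. {z \<in> P. cell z = cell y}) =
      (\<Sum>y\<in>A. card {z \<in> P. cell z = cell y})"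
    using finite_cell by (intro card_SigmaI) auto
  also have "\<dots> \<le> (\<Sum>y\<in>A. r)" by (intro sum_mono cell_le)
  finally show ?thesis by simp
qed

lemma finite_pairs:
  "A \<subseteq> P \<Longrightarrow> finite (SIGMA y:A. {z \<in> P. cell z = cell y})"
  using finite_points finite_subset[of A P] by (intro finite_SigmaI) auto

text \<open>By the symmetries of a double edge, the given point may be taken for its first entry
  \<open>x\<close>. Then there are at most \<open>r\<close> choices for the cell mate of
  \<open>x\<close>, \<open>2 * N\<close> for \<open>y\<close>, and \<open>r\<close> for the cell
  mate of \<open>y\<close>.\<close>

lemma card_doubles_touching: "card {T \<in> doubles. x \<in> \<Union>T} \<le> r * (2 * N * r)"
proof -
  let ?D = "{x' \<in> P. cell x' = cell x} \<times> (SIGMA y:P. {y' \<in> P. cell y' = cell y})"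
  let ?f = "\<lambda>(x', y, y'). {{x, y}, {x', y'}}"
  have fin: "finite ?D" using finite_pairs[of P] finite_cell by auto
  have "{T \<in> doubles. x \<in> \<Union>T} \<subseteq> ?f ` ?D"
  proof
    fix T assume "T \<in> {T \<in> doubles. x \<in> \<Union>T}"
    then obtain a b a' b' where T: "T = {{a, b}, {a', b'}}" "{a, b} \<in> edges" "{a', b'} \<in> edges"
      "cell a = cell a'" "cell b = cell b'" and x: "x \<in> {a, b} \<union> {a', b'}"
      by (auto elim!: double_cases)
    have P: "a \<in> P" "b \<in> P" "a' \<in> P" "b' \<in> P" using T doubleton_in_edges by auto
    from x consider "x = a" | "x = b" | "x = a'" | "x = b'" by auto
    then obtain x' y y' where "T = {{x, y}, {x', y'}}" "x' \<in> P" "cell x' = cell x" "y \<in> P" "y' \<in> P"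
      "cell y' = cell y"
    proof cases
      case 1 then show ?thesis using T P that[of b a' b'] by auto
    next
      case 2 then show ?thesis using T P that[of a b' a'] by (auto simp: insert_commute)
    next
      case 3 then show ?thesis using T P that[of b' a b] by (auto simp: insert_commute)
    next
      case 4 then show ?thesis using T P that[of a' b a] by (auto simp: insert_commute)
    qed
    then show "T \<in> ?f ` ?D" by (auto intro!: image_eqI[of _ _ "(x', y, y')"])
  qed
  then have "card {T \<in> doubles. x \<in> \<Union>T} \<le> card (?f ` ?D)"
    using fin by (intro card_mono) auto
  also have "\<dots> \<le> card ?D" using fin by (rule card_image_le)
  also have "\<dots> \<le> r * (2 * N * r)"
    unfolding card_cartesian_product
    using cell_le card_pairs_le[of P] card_points by (intro mult_le_mono) auto
  finally show ?thesis .
qed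

lemma card_loops_le: "card loops \<le> 2 * N * r"
proof -
  let ?D = "SIGMA y:P. {z \<in> P. cell z = cell y}"
  have "loops \<subseteq> (\<lambda>(x, y). {{x, y}}) ` ?D"
  proof
    fix T assume "T \<in> loops"
    then obtain a b where "T = {{a, b}}" "{a, b} \<in> edges" "cell a = cell b" by (rule loop_cases)
    then show "T \<in> (\<lambda>(x, y). {{x, y}}) ` ?D"
      using doubleton_in_edges by (auto intro!: image_eqI[of _ _ "(a, b)"])
  qed
  then have "card loops \<le> card ((\<lambda>(x, y). {{x, y}}) ` ?D)"
    using finite_pairs[of P] by (intro card_mono) auto
  also have "\<dots> \<le> card ?D" using finite_pairs[of P] by (intro card_image_le) auto
  finally show ?thesis using card_pairs_le[of P] card_points by auto
qed

lemma card_doubles_le: "card doubles \<le> (2 * N * r) * (2 * N * r)"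
proof -
  let ?E = "SIGMA y:P. {z \<in> P. cell z = cell y}"
  have fin: "finite (?E \<times> ?E)" using finite_pairs[of P] by auto
  have "doubles \<subseteq> (\<lambda>((x, x'), (y, y')). {{x, y}, {x', y'}}) ` (?E \<times> ?E)"
  proof
    fix T assume "T \<in> doubles"
    then obtain a b a' b' where "T = {{a, b}, {a', b'}}" "{a, b} \<in> edges" "{a', b'} \<in> edges"
      "cell a = cell a'" "cell b = cell b'" by (rule double_cases)
    then show "T \<in> (\<lambda>((x, x'), (y, y')). {{x, y}, {x', y'}}) ` (?E \<times> ?E)"
      using doubleton_in_edges by (auto intro!: image_eqI[of _ _ "((a, a'), (b, b'))"])
  qed
  then have "card doubles \<le> card ((\<lambda>((x, x'), (y, y')). {{x, y}, {x', y'}}) ` (?E \<times> ?E))"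
    using fin by (intro card_mono) auto
  also have "\<dots> \<le> card (?E \<times> ?E)" using fin by (rule card_image_le)
  also have "\<dots> \<le> (2 * N * r) * (2 * N * r)"
    unfolding card_cartesian_product
    using card_pairs_le[of P] card_points by (intro mult_le_mono) auto
  finally show ?thesis .
qed

section \<open>Upper bounds on conditional probabilities: the lopsided local lemma\<close>

lemma g_antimono_avoid: "S' \<subseteq> S \<Longrightarrow> g S B \<le> g S' B"
  by (intro of_nat_mono card_mono) (auto simp: avoiders_def avoids_def finite_matchings)

lemma g_not_partial_matching: "\<not> partial_matching C \<Longrightarrow> g S C = 0"
proof -
  assume *: "\<not> partial_matching C"
  have "partial_matching C" if "M \<in> matchings" "C \<subseteq> M" for M
    using that unfolding matchings_def partial_matching_def
    by (simp add: disjoint_def subset_iff)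
  then have "avoiders S C = {}" using * unfolding avoiders_def by blast
  then show ?thesis by simp
qed

text \<open>A matching that contains \<open>C\<close> cannot contain a configuration in conflict
  with \<open>C\<close>, so these are avoided automatically.\<close>

lemma avoiders_drop_conflicting:
  "avoiders (S - conflicting S C) C = avoiders S C"
proof -
  have "compatible T e" if "M \<in> matchings" "T \<subseteq> M" "e \<in> M" for M T e
    using matching_unique[OF that(1)] that(2,3) unfolding compatible_def by blast
  then show ?thesis unfolding avoiders_def conflicting_def avoids_def by blast
qed

lemma partial_matching_insert:
  "partial_matching (insert e C) \<Longrightarrow> e \<notin> C \<Longrightarrow> partial_matching C \<and> e \<in> edges \<and> e \<inter> \<Union>C = {}"
proof (intro conjI)
  assume a: "partial_matching (insert e C)" and ne: "e \<notin> C"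
  show "partial_matching C" "e \<in> edges"
    using a unfolding partial_matching_def by (simp_all add: disjoint_def)
  have "e \<inter> f = {}" if "f \<in> C" for f
  proof -
    have "e \<noteq> f" using ne that by auto
    then show ?thesis using a that unfolding partial_matching_def disjoint_def by simp
  qed
  then show "e \<inter> \<Union>C = {}" by blast
qed

text \<open>Inserts the pairs of \<open>C\<close> one by one; each step is
  \<open>avoiders_insert_le\<close> and contributes one factor of \<open>pr\<close>.\<close>

lemma g_compatible_le:
  assumes "finite C" "partial_matching C" "\<And>T e. T \<in> S \<Longrightarrow> e \<in> C \<Longrightarrow> compatible T e"
  shows "g S C \<le> pr (card C) * g S {}"
  using assms
proof (induction C rule: finite_induct)
  case (insert e C)
  note * = partial_matching_insert[OF insert.prems(1) insert.hyps(2)]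
  from * have "e \<in> edges" by simp
  then obtain p q where e: "e = {p, q}" by (rule edge_cases)
  have "(mult * (N - 1 - card C) + 1) * card (avoiders S (insert e C)) \<le> card (avoiders S C)"
    unfolding e half_eq[symmetric]
    using * e insert.prems(2) by (intro avoiders_insert_le) auto
  then have "real (mult * (N - 1 - card C) + 1) * g S (insert e C) \<le> g S C"
    by (metis of_nat_le_iff of_nat_mult)
  also have "\<dots> \<le> pr (card C) * g S {}" using insert * by auto
  finally show ?case using insert.hyps
    by (simp add: pr_Suc field_simps del: of_nat_add of_nat_mult)
qed simp

lemma g_empty_eq:
  assumes "finite C" "partial_matching C"
  shows "g {} C = pr (card C) * g {} {}"
  using assms
proof (induction C rule: finite_induct)
  case (insert e C)
  note * = partial_matching_insert[OF insert.prems(1) insert.hyps(2)]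
  from * have "e \<in> edges" by simp
  then obtain p q where e: "e = {p, q}" by (rule edge_cases)
  have "card (avoiders {} C) = (mult * (N - 1 - card C) + 1) * card (avoiders {} (insert e C))"
    unfolding e half_eq[symmetric]
    using * e by (intro card_matchings_insert) auto
  then have "g {} C = real (mult * (N - 1 - card C) + 1) * g {} (insert e C)"
    by (metis of_nat_mult)
  moreover have "g {} C = pr (card C) * g {} {}" using insert * by auto
  ultimately show ?case using insert.hyps
    by (simp add: pr_Suc field_simps del: of_nat_add of_nat_mult)
qed simp

text \<open>Apply \<open>g_empty_eq\<close> to a perfect matching: it is the only one that contains
  itself, so the total number is the reciprocal of \<open>pr N\<close>.\<close>

lemma card_matchings:
  assumes "matchings \<noteq> {}"
  shows "card matchings = (\<Prod>j<N. mult * j + 1)"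
proof -
  obtain M where M: "M \<in> matchings" using assms by auto
  have "partial_matching M" using M unfolding matchings_def partial_matching_def by auto
  then have "g {} M = pr (card M) * g {} {}"
    using g_empty_eq matching_finite M by blast
  moreover have "card M = N" using card_matching[OF M] card_points by simp
  moreover have "avoiders {} M = {M}"
  proof -
    have "M' = M" if "M' \<in> matchings" "M \<subseteq> M'" for M'
      using that card_matching[OF M] card_matching[OF that(1)] matching_finite
      by (metis card_subset_eq mult_cancel1 zero_neq_numeral)
    then show ?thesis using M unfolding avoiders_def avoids_def by auto
  qed
  moreover have "avoiders {} {} = matchings" unfolding avoiders_def avoids_def by auto
  ultimately have "1 = pr N * real (card matchings)" by simp
  then have "real (card matchings) = 1 / pr N" using pr_pos[of N] by (simp add: field_simps)
  also have "\<dots> = (\<Prod>j<N. real (mult * (N - 1 - j) + 1))"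
    by (simp add: pr_def prod_dividef)
  also have "\<dots> = real (\<Prod>j<N. mult * (N - 1 - j) + 1)" by simp
  also have "(\<Prod>j<N. mult * (N - 1 - j) + 1) = (\<Prod>j<N. mult * j + 1)"
    using prod.nat_diff_reindex[of "\<lambda>j. mult * j + 1" N] by simp
  finally show ?thesis by (simp only: of_nat_eq_iff)
qed

text \<open>A configuration in conflict with \<open>C\<close> passes through one of its at most
  \<open>2 * card C\<close> points. At each point, loops contribute at most \<open>r * (2/N)\<close>
  and double edges \<open>2 * N * r^2 * (2/N)^2\<close>; in total this is 4 + 16 times
  \<open>card C * rho\<close>.\<close>

lemma sum_conflicting_le:
  assumes S: "S \<subseteq> bad" and C: "partial_matching C" "finite C"
  shows "(\<Sum>T\<in>conflicting S C. pr (card T)) \<le> 20 * real (card C) * rho"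
proof -
  let ?U = "\<Union>C"
  have finU: "finite ?U" and cardU: "card ?U \<le> 2 * card C"
  proof -
    have sub: "C \<subseteq> edges" using C unfolding partial_matching_def by auto
    then have *: "finite e \<and> card e = 2" if "e \<in> C" for e
      using card_edge[of e] that by (metis card.infinite subsetD zero_neq_numeral)
    show "finite ?U" using C(2) * by auto
    have "card ?U \<le> (\<Sum>e\<in>C. card e)" by (rule card_Union_le_sum_card)
    also have "\<dots> = 2 * card C" using * by simp
    finally show "card ?U \<le> 2 * card C" .
  qed
  have touch: "\<exists>x\<in>?U. x \<in> \<Union>T" if "T \<in> conflicting S C" for T
    using that unfolding conflicting_def compatible_def by blast
  let ?L = "\<Union>x\<in>?U. {T \<in> loops. x \<in> \<Union>T}" and ?W = "\<Union>x\<in>?U. {T \<in> doubles. x \<in> \<Union>T}"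
  have finb: "finite loops" "finite doubles" using finite_bad unfolding bad_def by auto
  have finL: "finite ?L" using finb finU by (intro finite_UN_I) simp_all
  have finW: "finite ?W" using finb finU by (intro finite_UN_I) simp_all
  have "(\<Sum>T\<in>conflicting S C. pr (card T)) \<le> (\<Sum>T\<in>?L \<union> ?W. pr (card T))"
  proof (rule sum_mono2)
    show "conflicting S C \<subseteq> ?L \<union> ?W"
    proof
      fix T assume T: "T \<in> conflicting S C"
      then have "T \<in> loops \<union> doubles" using S unfolding conflicting_def bad_def by auto
      then show "T \<in> ?L \<union> ?W" using touch[OF T] by blast
    qed
  qed (use finL finW pr_pos less_imp_le in auto)
  also have "\<dots> \<le> (\<Sum>T\<in>?L. pr (card T)) + (\<Sum>T\<in>?W. pr (card T))"
    using finL finW pr_pos by (subst sum_Un) (auto intro!: sum_nonneg simp: less_imp_le pr_pos)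
  also have "(\<Sum>T\<in>?L. pr (card T)) = real (card ?L) * pr 1"
    using card_loop by simp
  also have "(\<Sum>T\<in>?W. pr (card T)) = real (card ?W) * pr 2"
    using card_double by simp
  also have "real (card ?L) * pr 1 \<le> (2 * real (card C) * real r) * (2 / real N)"
  proof (rule mult_mono)
    have "card ?L \<le> (\<Sum>x\<in>?U. card {T \<in> loops. x \<in> \<Union>T})" by (rule card_UN_le[OF finU])
    also have "\<dots> \<le> (\<Sum>x\<in>?U. r)" by (intro sum_mono card_loops_touching)
    also have "\<dots> \<le> 2 * card C * r" using cardU by simp
    finally have "real (card ?L) \<le> real (2 * card C * r)" by (rule of_nat_mono)
    then show "real (card ?L) \<le> 2 * real (card C) * real r" by simp
    show "pr 1 \<le> 2 / real N" using pr_le[of 1] by simp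
  qed (use pr_pos[of 1] in auto)
  also have "real (card ?W) * pr 2 \<le>
      (2 * real (card C) * (real r * (2 * real N * real r))) * (2 / real N)\<^sup>2"
  proof (rule mult_mono)
    have "card ?W \<le> (\<Sum>x\<in>?U. card {T \<in> doubles. x \<in> \<Union>T})" by (rule card_UN_le[OF finU])
    also have "\<dots> \<le> (\<Sum>x\<in>?U. r * (2 * N * r))" by (intro sum_mono card_doubles_touching)
    also have "\<dots> \<le> 2 * card C * (r * (2 * N * r))" using cardU by simp
    finally have "real (card ?W) \<le> real (2 * card C * (r * (2 * N * r)))" by (rule of_nat_mono)
    then show "real (card ?W) \<le> 2 * real (card C) * (real r * (2 * real N * real r))" by simp
    show "pr 2 \<le> (2 / real N)\<^sup>2" using pr_le[of 2] by simp
  qed (use pr_pos[of 2] in auto)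
  also have "(2 * real (card C) * (real r * (2 * real N * real r))) * (2 / real N)\<^sup>2 =
      16 * real (card C) * rho"
    using N_ge by (simp add: field_simps power2_eq_square)
  also have "(2 * real (card C) * real r) * (2 / real N) \<le> 4 * real (card C) * rho"
    using r_le_square by (simp add: divide_right_mono mult_left_mono)
  finally show ?thesis by simp
qed

text \<open>The local lemma step. Discarding the configurations in conflict with \<open>C\<close>
  does not change the count with \<open>C\<close> prescribed and makes
  \<open>g_compatible_le\<close> applicable. It remains to compare the counts for the reduced and
  the full set without \<open>C\<close>; the loss is at most 2 * 20 times
  \<open>card C * rho\<close>, by \<open>IH\<close> and \<open>sum_conflicting_le\<close>.\<close>

lemma g_sharp_step:
  assumes S: "S \<subseteq> bad" and C: "partial_matching C" "finite C" "card C \<le> 4"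
    and IH: "\<And>T. T \<in> conflicting S C \<Longrightarrow>
       g (S - conflicting S C) T \<le> 2 * pr (card T) * g (S - conflicting S C) {}"
  shows "g S C * (1 - 40 * real (card C) * rho) \<le> pr (card C) * g S {}"
proof -
  let ?X = "conflicting S C"
  let ?S = "S - ?X"
  have finS: "finite S" using S finite_bad finite_subset by auto
  have finX: "finite ?X" using finS unfolding conflicting_def by auto
  have "g S C \<le> g ?S C" by (simp add: avoiders_drop_conflicting)
  also have "g ?S C \<le> pr (card C) * g ?S {}"
    using C by (intro g_compatible_le) (auto simp: conflicting_def)
  finally have 1: "g S C \<le> pr (card C) * g ?S {}" .
  \<comment> \<open>A matching that avoids only the reduced set either avoids \<open>S\<close> or
    contains a discarded configuration.\<close>
  have "avoiders ?S {} \<subseteq> avoiders S {} \<union> (\<Union>T\<in>?X. avoiders ?S T)"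
    unfolding avoiders_def avoids_def by blast
  then have "card (avoiders ?S {}) \<le> card (avoiders S {} \<union> (\<Union>T\<in>?X. avoiders ?S T))"
    using finX by (intro card_mono) auto
  also have "\<dots> \<le> card (avoiders S {}) + card (\<Union>T\<in>?X. avoiders ?S T)" by (rule card_Un_le)
  also have "\<dots> \<le> card (avoiders S {}) + (\<Sum>T\<in>?X. card (avoiders ?S T))"
    using card_UN_le[OF finX] by auto
  finally have "real (card (avoiders ?S {})) \<le>
      real (card (avoiders S {}) + (\<Sum>T\<in>?X. card (avoiders ?S T)))" by (rule of_nat_mono)
  then have "g ?S {} \<le> g S {} + (\<Sum>T\<in>?X. g ?S T)" by simp
  also have "(\<Sum>T\<in>?X. g ?S T) \<le> (\<Sum>T\<in>?X. 2 * pr (card T) * g ?S {})"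
    by (intro sum_mono IH)
  also have "\<dots> = 2 * g ?S {} * (\<Sum>T\<in>?X. pr (card T))"
    by (simp add: sum_distrib_left sum_distrib_right mult_ac)
  also have "\<dots> \<le> 2 * g ?S {} * (20 * real (card C) * rho)"
    using sum_conflicting_le[OF S C(1,2)] by (intro mult_left_mono) auto
  finally have 2: "g ?S {} * (1 - 40 * real (card C) * rho) \<le> g S {}"
    by (simp add: algebra_simps)
  have "40 * real (card C) * rho \<le> 40 * 4 * (1 / 1000)"
    using C(3) rho_small by (intro mult_mono) auto
  then have 3: "1 - 40 * real (card C) * rho \<ge> 0" by simp
  have "g S C * (1 - 40 * real (card C) * rho) \<le>
      pr (card C) * g ?S {} * (1 - 40 * real (card C) * rho)"
    using 1 3 by (rule mult_right_mono)
  also have "\<dots> \<le> pr (card C) * g S {}"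
    using mult_left_mono[OF 2, of "pr (card C)"] pr_pos[of "card C"] by (simp add: mult.assoc)
  finally show ?thesis .
qed

text \<open>Induction on the size of \<open>S\<close>: if there is any \<open>T\<close> in conflict
  with \<open>C\<close>, the reduced set is smaller. The step loses a factor of at least 1 -
  160/1000, which exceeds 1/2, so the constant 2 reproduces itself.\<close>

lemma g_le_twice:
  assumes "S \<subseteq> bad" "partial_matching C" "finite C" "card C \<le> 4"
  shows "g S C \<le> 2 * pr (card C) * g S {}"
  using assms
proof (induction "card S" arbitrary: S C rule: less_induct)
  case less
  have finS: "finite S" using less.prems finite_bad finite_subset by auto
  have IH: "g (S - conflicting S C) T \<le> 2 * pr (card T) * g (S - conflicting S C) {}"
    if "T \<in> conflicting S C" for T
  proof (rule less.hyps)
    have "T \<in> S" using that unfolding conflicting_def by auto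
    then have T: "T \<in> bad" using less.prems by auto
    show "card (S - conflicting S C) < card S"
      using that \<open>T \<in> S\<close> finS by (intro psubset_card_mono) auto
    show "partial_matching T" "finite T" using T bad_partial_matching bad_finite by auto
    show "card T \<le> 4" using bad_card[OF T] by auto
  qed (use less.prems in auto)
  have "g S C * (1 - 40 * real (card C) * rho) \<le> pr (card C) * g S {}"
    using g_sharp_step[OF less.prems IH] .
  moreover have "40 * real (card C) * rho \<le> 40 * 4 * (1 / 1000)"
    using less.prems rho_small by (intro mult_mono) auto
  then have "g S C * (1 / 2) \<le> g S C * (1 - 40 * real (card C) * rho)"
    by (intro mult_left_mono) auto
  ultimately have "g S C * (1 / 2) \<le> pr (card C) * g S {}" by linarith
  then show ?case by simp
qed

text \<open>One more local lemma step, now fed with \<open>g_le_twice\<close>, replaces the constant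
  2 by 1 + O(\<open>rho\<close>). As \<open>T\<close> has at most two pairs, the loss is 80
  \<open>rho\<close>.\<close>

lemma g_sharp:
  assumes "S \<subseteq> bad" "T \<in> bad"
  shows "g S T \<le> (1 + 160 * rho) * pr (card T) * g S {}"
proof -
  have T: "partial_matching T" "finite T" "card T \<le> 2"
    using assms bad_partial_matching bad_finite bad_card[of T] by auto
  have "g S T * (1 - 40 * real (card T) * rho) \<le> pr (card T) * g S {}"
  proof (rule g_sharp_step)
    fix T' assume "T' \<in> conflicting S T"
    then have T': "T' \<in> bad" using assms unfolding conflicting_def by auto
    show "g (S - conflicting S T) T' \<le> 2 * pr (card T') * g (S - conflicting S T) {}"
      using assms T' bad_partial_matching bad_finite bad_card[OF T'] by (intro g_le_twice) auto
  qed (use T assms in auto)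
  moreover have "40 * real (card T) * rho \<le> 40 * 2 * rho"
    using T(3) by (intro mult_right_mono mult_left_mono) auto
  then have "g S T * (1 - 80 * rho) \<le> g S T * (1 - 40 * real (card T) * rho)"
    by (intro mult_left_mono) auto
  ultimately have *: "g S T * (1 - 80 * rho) \<le> pr (card T) * g S {}" by linarith
  \<comment> \<open>Passes from division by \<open>1 - 80 * rho\<close> to a linear factor; the
    quadratic term is absorbed because \<open>rho\<close> is at most 1/1000.\<close>
  have "1 \<le> (1 - 80 * rho) * (1 + 160 * rho)"
  proof -
    have "160 * 80 * x * x \<le> 80 * x \<and> 1 \<le> (1 - 80 * x) * (1 + 160 * x)"
      if "0 \<le> x" "x \<le> 1 / 1000" for x :: real
    proof -
      have "x * x \<le> x * (1 / 1000)" using that by (intro mult_left_mono) auto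
      then show ?thesis using that by (simp add: algebra_simps)
    qed
    from this[OF rho_nonneg rho_small] show ?thesis by blast
  qed
  then have "g S T * 1 \<le> g S T * ((1 - 80 * rho) * (1 + 160 * rho))"
    by (intro mult_left_mono) auto
  also have "\<dots> = (g S T * (1 - 80 * rho)) * (1 + 160 * rho)" by (simp only: mult.assoc)
  also have "\<dots> \<le> (pr (card T) * g S {}) * (1 + 160 * rho)"
    using * rho_nonneg by (intro mult_right_mono) linarith+
  finally show ?thesis by (simp add: mult_ac)
qed

end

section \<open>Lower bounds on conditional probabilities: switchings that destroy a forbidden
  configuration\<close>

context celled_matching_model
begin

text \<open>Union bound over the patterns of \<open>k\<close> pairs parametrised by
  \<open>D\<close>. \<open>g_le_twice\<close> bounds each term; patterns that do not form a partial
  matching with \<open>B\<close> contribute nothing.\<close>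

lemma card_UN_avoiders_le:
  assumes S: "S \<subseteq> bad" and B: "finite B" and k: "card B + k \<le> 4"
    and D: "finite D" "card D \<le> m"
  shows "real (card (\<Union>C\<in>{C \<in> f ` D. finite C \<and> card C = k \<and> C \<inter> B = {}}. avoiders S (B \<union> C)))
    \<le> real m * (2 * pr (card B) * (2 / real N) ^ k * g S {})" (is "real (card (\<Union>C\<in>?\<C>. _)) \<le> _ * ?b")
proof -
  have fin: "finite ?\<C>" using D by auto
  have "card ?\<C> \<le> card (f ` D)" using D by (intro card_mono) auto
  also have "\<dots> \<le> m" using D card_image_le le_trans by blast
  finally have cm: "card ?\<C> \<le> m" .
  have "real (card (\<Union>C\<in>?\<C>. avoiders S (B \<union> C))) \<le> real (\<Sum>C\<in>?\<C>. card (avoiders S (B \<union> C)))"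
    by (intro of_nat_mono card_UN_le fin)
  also have "\<dots> = (\<Sum>C\<in>?\<C>. g S (B \<union> C))" by simp
  also have "\<dots> \<le> (\<Sum>C\<in>?\<C>. ?b)"
  proof (rule sum_mono)
    fix C assume C: "C \<in> ?\<C>"
    show "g S (B \<union> C) \<le> ?b"
    proof (cases "partial_matching (B \<union> C)")
      case True
      have cBC: "card (B \<union> C) = card B + k"
        using C B by (subst card_Un_disjoint) auto
      have "g S (B \<union> C) \<le> 2 * pr (card (B \<union> C)) * g S {}"
        using True C B k cBC by (intro g_le_twice S) auto
      also have "\<dots> \<le> 2 * (pr (card B) * (2 / real N) ^ k) * g S {}"
        unfolding cBC using pr_add_le[OF k] by (intro mult_right_mono mult_left_mono) auto
      finally show ?thesis by (simp add: mult.assoc)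
    next
      case False
      then show ?thesis using g_not_partial_matching pr_pos[of "card B"] by simp
    qed
  qed
  also have "\<dots> = real (card ?\<C>) * ?b" by simp
  also have "\<dots> \<le> real m * ?b" using cm pr_pos[of "card B"] by (intro mult_right_mono) auto
  finally show ?thesis .
qed

lemma double_other_edge:
  assumes "T \<in> doubles" "{x, y} \<in> T"
  obtains s t where "T = {{x, y}, {s, t}}" "{s, t} \<in> edges" "{s, t} \<noteq> {x, y}"
    "cell s = cell x" "cell t = cell y"
proof -
  from assms(1) obtain a b a' b' where T: "T = {{a, b}, {a', b'}}" "{a, b} \<in> edges"
    "{a', b'} \<in> edges" "a \<noteq> a'" "b \<noteq> b'" "cell a = cell a'" "cell b = cell b'" "cell a \<noteq> cell b"
    by (rule double_cases)
  have ne: "{a, b} \<noteq> {a', b'}" using T by (auto simp: doubleton_eq_iff)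
  from assms(2) T(1) consider "x = a" "y = b" | "x = b" "y = a" | "x = a'" "y = b'" | "x = b'" "y = a'"
    by (auto simp: doubleton_eq_iff)
  then show ?thesis
  proof cases
    case 1 then show ?thesis using T ne by (intro that[of a' b']) auto
  next
    case 2 then show ?thesis using T ne by (intro that[of b' a']) (auto simp: insert_commute)
  next
    case 3 then show ?thesis using T ne by (intro that[of a b]) auto
  next
    case 4 then show ?thesis using T ne by (intro that[of b a]) (auto simp: insert_commute)
  qed
qed

text \<open>When undoing a switching creates a forbidden configuration, this configuration uses the new
  pair \<open>{x, y}\<close> or the prescribed pair \<open>{p, q}\<close>, and the matching before the switching contains
  one of three rare patterns.\<close>

lemma switching_creates_bad:
  assumes S: "S \<subseteq> bad" and pq: "{p, q} \<in> edges" and disj: "{p, q} \<inter> \<Union>B = {}"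
    and nS: "\<forall>T\<in>S. \<not> T \<subseteq> insert {p, q} B"
    and z: "(M, x, y) \<in> switchings B p q"
    and av: "avoids S (switch M p q x y)" and nav: "\<not> avoids S M"
  defines "L \<equiv> switch M p q x y"
  shows "(\<exists>s t. s \<in> P \<and> t \<in> P \<and> cell s = cell p \<and> cell t = cell q \<and> {{s, t}} \<inter> B = {} \<and>
            L \<in> avoiders S (B \<union> {{s, t}})) \<or>
         (x \<in> P \<and> y \<in> P \<and> {{p, x}, {q, y}} \<inter> B = {} \<and> card {{p, x}, {q, y}} = 2 \<and>
           L \<in> avoiders S (B \<union> {{p, x}, {q, y}}) \<and>
           (cell x = cell y \<or> (\<exists>s t. {s, t} \<in> insert {p, q} B \<and> cell x = cell s \<and> cell y = cell t))) \<or>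
         (\<exists>s t. x \<in> P \<and> y \<in> P \<and> s \<in> P \<and> t \<in> P \<and> cell s = cell x \<and> cell t = cell y \<and>
           {{p, x}, {q, y}, {s, t}} \<inter> B = {} \<and> card {{p, x}, {q, y}, {s, t}} = 3 \<and>
           L \<in> avoiders S (B \<union> {{p, x}, {q, y}, {s, t}}))"
proof -
  from z have M: "M \<in> matchings" "{p, q} \<in> M" "B \<subseteq> M" "{x, y} \<in> M" "{x, y} \<noteq> {p, q}"
    "{x, y} \<notin> B" "allowed p x" "allowed q y" by (auto simp: switchings_def)
  have pqxy: "{p, q} \<noteq> {x, y}" using M(5) by auto
  have xyP: "x \<in> P" "y \<in> P" using matching_edges[OF M(1,4)] by (auto simp: doubleton_in_edges)
  have dist: "{p, q} \<inter> {x, y} = {}" using matching_unique[OF M(1,2,4)] pqxy by auto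
  have LM: "L \<in> matchings" unfolding L_def using switch_matching[OF M(1,2,4) pqxy M(7,8)] .
  have nM: "{p, x} \<notin> M" "{q, y} \<notin> M" using switch_switch(2,3)[OF M(1,2,4) pqxy] .
  have BL: "B \<subseteq> L" using M(3,6) disj unfolding L_def switch_def by blast
  have inL: "{p, x} \<in> L" "{q, y} \<in> L" unfolding L_def switch_def by auto
  have nB: "{p, x} \<notin> B" "{q, y} \<notin> B" using disj by auto
  have ne: "{p, x} \<noteq> {q, y}" using dist allowed_neq[of p q] pq
    by (auto simp: doubleton_eq_iff doubleton_in_edges)
  have avL: "L \<in> avoiders S (B \<union> C)" if "C \<subseteq> L" for C
    using that LM BL av unfolding avoiders_def L_def by auto
  have keep: "f \<in> L" if "f \<in> M" "f \<noteq> {p, q}" "f \<noteq> {x, y}" for f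
    using that unfolding L_def switch_def by auto
  from nav obtain T where T: "T \<in> S" "T \<subseteq> M" unfolding avoids_def by auto
  have TL: "\<not> T \<subseteq> L" using av T unfolding avoids_def L_def by auto
  have TB: "\<not> T \<subseteq> insert {p, q} B" using nS T by auto
  show ?thesis
  proof (cases "T \<in> loops")
    case True
    then obtain a b where ab: "T = {{a, b}}" "cell a = cell b" by (rule loop_cases)
    \<comment> \<open>\<open>T\<close> lies in \<open>M\<close> but not in \<open>L\<close>, and
      \<open>keep\<close> says that only \<open>{p, q}\<close> and \<open>{x, y}\<close> get lost; a
      loop \<open>{p, q}\<close> is excluded by \<open>TB\<close>.\<close>
    have "{a, b} = {x, y}" using ab T(2) TL TB keep by blast
    then have "cell x = cell y" using ab(2) by (auto simp: doubleton_eq_iff)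
    then show ?thesis using xyP nB ne avL[of "{{p, x}, {q, y}}"] inL by auto
  next
    case False
    then have Td: "T \<in> doubles" using T(1) S unfolding bad_def by auto
    show ?thesis
    proof (cases "{x, y} \<in> T")
      case True
      then obtain s t where st: "T = {{x, y}, {s, t}}" "{s, t} \<in> edges" "{s, t} \<noteq> {x, y}"
        "cell s = cell x" "cell t = cell y" using double_other_edge[OF Td] by blast
      have stP: "s \<in> P" "t \<in> P" using st(2) by (auto simp: doubleton_in_edges)
      have stM: "{s, t} \<in> M" using T(2) st(1) by auto
      show ?thesis
      proof (cases "{s, t} \<in> insert {p, q} B")
        case True
        \<comment> \<open>The second pair of \<open>T\<close> is prescribed, so it gives no small
          probability; instead \<open>x\<close> and \<open>y\<close> are confined to the two cells
          of a prescribed pair.\<close>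
        then have par: "cell x = cell y \<or>
            (\<exists>s t. {s, t} \<in> insert {p, q} B \<and> cell x = cell s \<and> cell y = cell t)"
          by (intro disjI2 exI[of _ s] exI[of _ t] conjI) (simp_all only: st(4,5))
        have "{{p, x}, {q, y}} \<inter> B = {}" using nB by blast
        moreover have "L \<in> avoiders S (B \<union> {{p, x}, {q, y}})" using inL by (intro avL) blast
        moreover have "card {{p, x}, {q, y}} = 2" using ne by simp
        ultimately show ?thesis by (intro disjI2[OF disjI1] conjI xyP par)
      next
        case False
        then have stL: "{s, t} \<in> L" using keep stM st(3) by auto
        have three: "card {a, b, c} = 3" if "a \<noteq> b" "a \<noteq> c" "b \<noteq> c" for a b c :: "'p set"
          using that by simp
        have "{p, x} \<noteq> {s, t}" "{q, y} \<noteq> {s, t}" using nM stM by metis+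
        then have "card {{p, x}, {q, y}, {s, t}} = 3" using ne by (intro three)
        moreover have "L \<in> avoiders S (B \<union> {{p, x}, {q, y}, {s, t}})"
          using inL stL by (intro avL) auto
        moreover have "{{p, x}, {q, y}, {s, t}} \<inter> B = {}" using False nB by auto
        ultimately show ?thesis using xyP stP st(4,5) by blast
      qed
    next
      case F: False
      \<comment> \<open>\<open>T\<close> must contain a lost pair, and this is not
        \<open>{x, y}\<close>. Its other pair cannot belong to \<open>B\<close>, since then
        \<open>T\<close> would be prescribed entirely.\<close>
      have "{p, q} \<in> T" using F T(2) TL keep by blast
      then obtain s t where st: "T = {{p, q}, {s, t}}" "{s, t} \<in> edges" "{s, t} \<noteq> {p, q}"
        "cell s = cell p" "cell t = cell q" using double_other_edge[OF Td] by blast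
      have stP: "s \<in> P" "t \<in> P" using st(2) by (auto simp: doubleton_in_edges)
      have "{s, t} \<in> L" using keep[of "{s, t}"] T(2) st(1,3) F by auto
      moreover have "{s, t} \<notin> B" using TB st(1) by auto
      ultimately have "{{s, t}} \<inter> B = {}" "L \<in> avoiders S (B \<union> {{s, t}})"
        using avL[of "{{s, t}}"] by auto
      then show ?thesis using stP st(4,5) by blast
    qed
  qed
qed

text \<open>Each of at most two pairs can be read in two directions, with at most \<open>r^2\<close>
  choices of points in the two cells.\<close>

lemma card_parallel_pairs_le:
  assumes "finite E" "card E \<le> 2" "\<And>e. e \<in> E \<Longrightarrow> card e = 2"
  shows "card {(x, y). x \<in> P \<and> y \<in> P \<and> (\<exists>s t. {s, t} \<in> E \<and> cell x = cell s \<and> cell y = cell t)}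
           \<le> 4 * r\<^sup>2" (is "card ?A \<le> _")
proof -
  let ?c = "\<lambda>s. {x \<in> P. cell x = cell s}"
  let ?F = "\<lambda>e. \<Union>s\<in>e. \<Union>t\<in>e - {s}. ?c s \<times> ?c t"
  have one: "finite (?F e) \<and> card (?F e) \<le> 2 * r\<^sup>2" if e: "e \<in> E" for e
  proof -
    obtain a b where ab: "e = {a, b}" "a \<noteq> b" using assms(3)[OF e] by (auto simp: card_2_iff)
    have eq: "?F e = ?c a \<times> ?c b \<union> ?c b \<times> ?c a" using ab by auto
    have "card (?F e) \<le> card (?c a \<times> ?c b) + card (?c b \<times> ?c a)" unfolding eq by (rule card_Un_le)
    also have "\<dots> \<le> r * r + r * r" unfolding card_cartesian_product
      using cell_le by (intro add_mono mult_le_mono) auto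
    finally show ?thesis using eq finite_cell by (simp add: power2_eq_square)
  qed
  have "?A \<subseteq> (\<Union>e\<in>E. ?F e)"
  proof
    fix z assume "z \<in> ?A"
    then obtain x y s t where z: "z = (x, y)" "x \<in> P" "y \<in> P" "{s, t} \<in> E" "cell x = cell s"
      "cell y = cell t" by auto
    have "s \<noteq> t" using assms(3)[OF z(4)] by auto
    then have "z \<in> ?F {s, t}" using z by blast
    then show "z \<in> (\<Union>e\<in>E. ?F e)" using z(4) by blast
  qed
  then have "card ?A \<le> card (\<Union>e\<in>E. ?F e)" using one assms(1) by (intro card_mono) auto
  also have "\<dots> \<le> (\<Sum>e\<in>E. card (?F e))" using card_UN_le[OF assms(1)] .
  also have "\<dots> \<le> (\<Sum>e\<in>E. 2 * r\<^sup>2)" using one by (intro sum_mono) auto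
  also have "\<dots> \<le> 4 * r\<^sup>2" using assms(2) by simp
  finally show ?thesis .
qed

text \<open>The three patterns of \<open>switching_creates_bad\<close> have one, two and three new
  pairs and at most \<open>r^2\<close>, \<open>2 * N * r + 4 * r^2\<close> and
  \<open>(2 * N * r)^2\<close> instances. With probability at most 2/N per pair, each contributes
  O(\<open>rho\<close>). The bound on \<open>card B\<close> suffices because a forbidden
  configuration has at most two pairs.\<close>

lemma card_bad_switchings:
  assumes S: "S \<subseteq> bad" and pq: "{p, q} \<in> edges" and disj: "{p, q} \<inter> \<Union>B = {}"
    and B: "partial_matching B" "finite B" "card B \<le> 1"
    and nS: "\<And>T. T \<in> S \<Longrightarrow> \<not> T \<subseteq> insert {p, q} B"
  shows "real (card {z \<in> switchings B p q.
       case z of (M, x, y) \<Rightarrow> avoids S (switch M p q x y) \<and> \<not> avoids S M})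
    \<le> 116 * rho * pr (card B) * g S {}" (is "real (card ?X) \<le> _")
proof -
  let ?h = "\<lambda>(M, x, y). switch M p q x y"
  let ?c = "\<lambda>v. {x \<in> P. cell x = cell v}"
  let ?U = "{(x, y). x \<in> P \<and> y \<in> P \<and>
     (\<exists>s t. {s, t} \<in> insert {p, q} B \<and> cell x = cell s \<and> cell y = cell t)}"
  let ?D1 = "?c p \<times> ?c q" and ?D2 = "(SIGMA x:P. ?c x) \<union> ?U"
    and ?D3 = "(SIGMA x:P. ?c x) \<times> (SIGMA x:P. ?c x)"
  let ?f1 = "\<lambda>(s, t). {{s, t}}" and ?f2 = "\<lambda>(x, y). {{p, x}, {q, y}}"
    and ?f3 = "\<lambda>((x, s), (y, t)). {{p, x}, {q, y}, {s, t}}"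
  let ?C1 = "{C \<in> ?f1 ` ?D1. finite C \<and> card C = 1 \<and> C \<inter> B = {}}"
  let ?C2 = "{C \<in> ?f2 ` ?D2. finite C \<and> card C = 2 \<and> C \<inter> B = {}}"
  let ?C3 = "{C \<in> ?f3 ` ?D3. finite C \<and> card C = 3 \<and> C \<inter> B = {}}"
  let ?A = "\<lambda>\<C>. \<Union>C\<in>\<C>. avoiders S (B \<union> C)"
  have nS': "\<forall>T\<in>S. \<not> T \<subseteq> insert {p, q} B" using nS by blast
  have finU: "finite ?U" by (rule finite_subset[of _ "P \<times> P"]) (use finite_points in auto)
  have finD: "finite ?D1" "finite ?D2" "finite ?D3"
    using finU finite_pairs[of P] finite_cell by auto
  \<comment> \<open>The matching after the switching determines the switching, so it is enough to
    count the resulting matchings.\<close>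
  have "inj_on ?h ?X"
    using switch_bij[OF pq disj] unfolding bij_betw_def by (auto intro: inj_on_subset)
  then have "card ?X = card (?h ` ?X)" by (simp add: card_image)
  also have "\<dots> \<le> card (?A ?C1 \<union> ?A ?C2 \<union> ?A ?C3)"
  proof (rule card_mono)
    show "?h ` ?X \<subseteq> ?A ?C1 \<union> ?A ?C2 \<union> ?A ?C3"
    proof
      fix L assume "L \<in> ?h ` ?X"
      then obtain M x y where z: "(M, x, y) \<in> switchings B p q" "avoids S (switch M p q x y)"
        "\<not> avoids S M" and L: "L = switch M p q x y" by auto
      have in1: "L \<in> ?A ?C1" if "s \<in> P" "t \<in> P" "cell s = cell p" "cell t = cell q"
        "{{s, t}} \<inter> B = {}" "L \<in> avoiders S (B \<union> {{s, t}})" for s t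
        using that by (intro UN_I[of "{{s, t}}"] CollectI conjI image_eqI[of _ _ "(s, t)"]) auto
      have in2: "L \<in> ?A ?C2" if "x \<in> P" "y \<in> P" "{{p, x}, {q, y}} \<inter> B = {}"
        "card {{p, x}, {q, y}} = 2" "L \<in> avoiders S (B \<union> {{p, x}, {q, y}})"
        "cell x = cell y \<or> (\<exists>s t. {s, t} \<in> insert {p, q} B \<and> cell x = cell s \<and> cell y = cell t)"
      proof (rule UN_I[where a = "{{p, x}, {q, y}}" and B = "\<lambda>C. avoiders S (B \<union> C)", OF _ that(5)],
            intro CollectI conjI)
        have "(x, y) \<in> ?D2"
        proof (cases "cell x = cell y")
          case True
          then show ?thesis using that(1,2) by (intro UnI1) simp
        next
          case False
          then show ?thesis using that(1,2,6) by (intro UnI2) blast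
        qed
        then show "{{p, x}, {q, y}} \<in> ?f2 ` ?D2" by (intro image_eqI[of _ _ "(x, y)"]) simp_all
      qed (use that in simp_all)
      have in3: "L \<in> ?A ?C3" if "x \<in> P" "y \<in> P" "s \<in> P" "t \<in> P" "cell s = cell x"
        "cell t = cell y" "{{p, x}, {q, y}, {s, t}} \<inter> B = {}"
        "card {{p, x}, {q, y}, {s, t}} = 3"
        "L \<in> avoiders S (B \<union> {{p, x}, {q, y}, {s, t}})" for s t
      proof (rule UN_I[where a = "{{p, x}, {q, y}, {s, t}}" and B = "\<lambda>C. avoiders S (B \<union> C)",
              OF _ that(9)], intro CollectI conjI)
        show "{{p, x}, {q, y}, {s, t}} \<in> ?f3 ` ?D3"
          using that(1-6) by (intro image_eqI[of _ _ "((x, s), (y, t))"]) simp_all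
      qed (use that in simp_all)
      from switching_creates_bad[OF S pq disj nS' z]
      show "L \<in> ?A ?C1 \<union> ?A ?C2 \<union> ?A ?C3"
        unfolding L[symmetric]
      proof (elim disjE exE conjE, goal_cases)
        case (1 s t)
        then show ?case by (intro UnI1 in1)
      next
        case 2
        then show ?case by (intro UnI1 UnI2[OF in2] disjI1)
      next
        case (3 s t)
        then show ?case by (intro UnI1 UnI2[OF in2] disjI2 exI conjI)
      next
        case (4 s t)
        then show ?case by (intro UnI2 in3)
      qed
    qed
    show "finite (?A ?C1 \<union> ?A ?C2 \<union> ?A ?C3)"
      using finD by (intro finite_UnI finite_UN_I) auto
  qed
  also have "\<dots> \<le> card (?A ?C1) + card (?A ?C2) + card (?A ?C3)"
    by (meson add_mono card_Un_le le_refl le_trans)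
  finally have "real (card ?X) \<le> real (card (?A ?C1)) + real (card (?A ?C2)) + real (card (?A ?C3))"
    by (simp only: of_nat_add[symmetric] of_nat_le_iff)
  also have "real (card (?A ?C1)) \<le>
      real (r * r) * (2 * pr (card B) * (2 / real N) ^ 1 * g S {})"
    by (rule card_UN_avoiders_le[OF S B(2) _ finD(1)])
      (use B cell_le in \<open>auto simp: card_cartesian_product intro!: mult_le_mono\<close>)
  also have "real (card (?A ?C2)) \<le>
      real (2 * N * r + 4 * r\<^sup>2) * (2 * pr (card B) * (2 / real N) ^ 2 * g S {})"
  proof (rule card_UN_avoiders_le[OF S B(2) _ finD(2)])
    have "card ?U \<le> 4 * r\<^sup>2"
    proof (rule card_parallel_pairs_le)
      show "card e = 2" if "e \<in> insert {p, q} B" for e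
        using that pq B(1) card_edge unfolding partial_matching_def by auto
    qed (use B in \<open>auto simp: card_insert_if\<close>)
    then show "card ?D2 \<le> 2 * N * r + 4 * r\<^sup>2"
      using card_pairs_le[of P] card_points card_Un_le[of "SIGMA x:P. ?c x" ?U] by simp
  qed (use B in auto)
  also have "real (card (?A ?C3)) \<le>
      real ((2 * N * r) * (2 * N * r)) * (2 * pr (card B) * (2 / real N) ^ 3 * g S {})"
    by (rule card_UN_avoiders_le[OF S B(2) _ finD(3)])
      (use B card_pairs_le[of P] card_points in
        \<open>auto simp only: card_cartesian_product intro!: mult_le_mono\<close>)
  finally have "real (card ?X) \<le>
      (real (r * r) * (2 / real N) ^ 1 + real (2 * N * r + 4 * r\<^sup>2) * (2 / real N) ^ 2 +
       real ((2 * N * r) * (2 * N * r)) * (2 / real N) ^ 3) * (2 * pr (card B) * g S {})"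
    by (simp add: algebra_simps)
  also have "\<dots> \<le> (58 * rho) * (2 * pr (card B) * g S {})"
  proof (rule mult_right_mono)
    \<comment> \<open>The contributions are 2 + (8 + 16) + 32 = 58; the factor 2 of
      \<open>g_le_twice\<close> turns this into 116.\<close>
    have N0: "real N \<ge> 1" using N_ge by simp
    have "real (r * r) * (2 / real N) ^ 1 = 2 * rho" by (simp add: power2_eq_square)
    moreover have "real (2 * N * r + 4 * r\<^sup>2) * (2 / real N) ^ 2 =
        8 * (real r / real N) + 16 * (rho * (1 / real N))"
      using N0 by (simp add: field_simps power2_eq_square)
    moreover have "real ((2 * N * r) * (2 * N * r)) * (2 / real N) ^ 3 = 32 * rho"
      using N0 by (simp add: field_simps power2_eq_square power3_eq_cube)
    moreover have "real r / real N \<le> rho" using r_le_square by (intro divide_right_mono) auto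
    moreover have "rho * (1 / real N) \<le> rho * 1"
      using N0 by (intro mult_left_mono) auto
    ultimately show "real (r * r) * (2 / real N) ^ 1 +
       real (2 * N * r + 4 * r\<^sup>2) * (2 / real N) ^ 2 +
       real ((2 * N * r) * (2 * N * r)) * (2 / real N) ^ 3 \<le> 58 * rho" by linarith
  qed (use pr_pos[of "card B"] in simp)
  finally show ?thesis by (simp add: mult_ac)
qed

lemma g_insert_ge:
  assumes S: "S \<subseteq> bad" and e: "e \<in> edges" and disj: "e \<inter> \<Union>B = {}"
    and B: "partial_matching B" "finite B" "card B \<le> 1"
    and nS: "\<And>T. T \<in> S \<Longrightarrow> \<not> T \<subseteq> insert e B"
  shows "pr (Suc (card B)) / pr (card B) * (g S B - 116 * rho * pr (card B) * g S {})
           \<le> g S (insert e B)"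
proof -
  obtain p q where pq: "e = {p, q}" using e by (rule edge_cases)
  note * = e[unfolded pq] disj[unfolded pq]
  let ?k = "real (mult * (N - 1 - card B) + 1)"
  have k: "?k > 0" by (simp add: add_pos_nonneg)
  let ?X = "{z \<in> switchings B p q.
       case z of (M, x, y) \<Rightarrow> avoids S (switch M p q x y) \<and> \<not> avoids S M}"
  have "real (card (avoiders S B)) \<le> real ((mult * (N - 1 - card B) + 1) * card (avoiders S (insert e B)) + card ?X)"
    using avoiders_le_insert[OF *, of S] unfolding half_eq pq by (rule of_nat_mono)
  then have "g S B \<le> ?k * g S (insert e B) + real (card ?X)"
    by (simp only: of_nat_add of_nat_mult)
  moreover have "real (card ?X) \<le> 116 * rho * pr (card B) * g S {}"
    using card_bad_switchings[OF S * B] nS unfolding pq by blast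
  ultimately have "g S B - 116 * rho * pr (card B) * g S {} \<le> ?k * g S (insert e B)" by linarith
  moreover have "pr (Suc (card B)) / pr (card B) = 1 / ?k"
    using pr_pos[of "card B"] by (simp add: pr_Suc)
  ultimately show ?thesis using k by (simp only:) (simp add: divide_simps mult.commute)
qed

text \<open>The at most two pairs of \<open>T\<close> are inserted one after the other by
  \<open>g_insert_ge\<close>; each costs 116 \<open>rho\<close>.\<close>

lemma g_lower:
  assumes S: "S \<subseteq> bad" and T: "T \<in> bad" "T \<notin> S"
  shows "(1 - 232 * rho) * pr (card T) * g S {} \<le> g S T"
proof -
  define S2 where "S2 = S - conflicting S T"
  have S2: "S2 \<subseteq> bad" "S2 \<subseteq> S" using S unfolding S2_def by auto
  \<comment> \<open>By the antichain property such a \<open>T'\<close> would be \<open>T\<close>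
    itself, which is not in \<open>S\<close>.\<close>
  have nS: "\<not> T' \<subseteq> insert e B" if "T' \<in> S2" "insert e B \<subseteq> T" for T' e B
    using bad_antichain[OF T(1), of T'] that S2 T(2) by blast
  have eq: "g S T = g S2 T" unfolding S2_def by (simp add: avoiders_drop_conflicting)
  have le: "g S {} \<le> g S2 {}" using S2 by (intro g_antimono_avoid)
  have rs: "232 * rho \<le> 1" using rho_small by simp
  have pm: "partial_matching T" using bad_partial_matching T by auto
  have first: "pr 1 * (g S2 {} - 116 * rho * g S2 {}) \<le> g S2 {e}" if "e \<in> T" for e
  proof -
    have "e \<in> edges" using pm that unfolding partial_matching_def by auto
    moreover have "partial_matching {}" by (simp add: partial_matching_def disjoint_def)
    ultimately show ?thesis using g_insert_ge[OF S2(1), of e "{}"] nS[of _ e "{}"] that by auto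
  qed
  have "(1 - 232 * rho) * pr (card T) * g S2 {} \<le> g S2 T"
  proof (cases "T \<in> loops")
    case True
    then obtain x y where xy: "T = {{x, y}}" by (rule loop_cases)
    have "pr 1 * (g S2 {} * (1 - 232 * rho)) \<le> pr 1 * (g S2 {} * (1 - 116 * rho))"
      using pr_pos[of 1] rho_nonneg by (intro mult_left_mono) linarith+
    also have "\<dots> \<le> g S2 T" using first[of "{x, y}"] xy by (simp add: algebra_simps)
    finally show ?thesis using xy by (simp add: mult_ac)
  next
    case False
    then have Td: "T \<in> doubles" using T unfolding bad_def by auto
    from card_double[OF this] obtain e f where T: "T = {e, f}" "e \<noteq> f" by (auto simp: card_2_iff)
    have *: "partial_matching {e}" "f \<in> edges" "f \<inter> \<Union>{e} = {}"
      using partial_matching_insert[of f "{e}"] pm T by (auto simp: insert_commute)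
    have "pr 2 / pr 1 * (g S2 {e} - 116 * rho * pr 1 * g S2 {}) \<le> g S2 (insert f {e})"
      using g_insert_ge[OF S2(1) *(2,3,1)] nS[of _ f "{e}"] T by (simp add: numeral_2_eq_2)
    moreover have "pr 2 / pr 1 * (pr 1 * (g S2 {} * (1 - 232 * rho))) \<le>
        pr 2 / pr 1 * (g S2 {e} - 116 * rho * pr 1 * g S2 {})"
      using first[of e] T pr_pos[of 1] pr_pos[of 2]
      by (intro mult_left_mono) (simp_all add: algebra_simps)
    moreover have "pr 2 / pr 1 * (pr 1 * (g S2 {} * (1 - 232 * rho))) = pr 2 * (g S2 {} * (1 - 232 * rho))"
      using pr_pos[of 1] by simp
    moreover have "insert f {e} = T" "card T = 2" using T by auto
    ultimately show ?thesis by (simp add: mult_ac)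
  qed
  moreover have "(1 - 232 * rho) * pr (card T) * g S {} \<le> (1 - 232 * rho) * pr (card T) * g S2 {}"
    using le rs pr_pos[of "card T"] by (intro mult_left_mono) auto
  ultimately show ?thesis using eq by linarith
qed

section \<open>The product over all forbidden configurations\<close>

lemma g_insert_forbidden:
  "T \<notin> S \<Longrightarrow> g (insert T S) {} = g S {} - g S T"
proof -
  have "avoiders S {} = avoiders (insert T S) {} \<union> avoiders S T"
    unfolding avoiders_def avoids_def by auto
  moreover have "avoiders (insert T S) {} \<inter> avoiders S T = {}"
    unfolding avoiders_def avoids_def by auto
  ultimately have "card (avoiders S {}) = card (avoiders (insert T S) {}) + card (avoiders S T)"
    by (simp add: card_Un_disjoint)
  then show ?thesis by simp
qed

text \<open>Forbidding one more \<open>T\<close> multiplies the count by 1 - p, where p is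
  \<open>pr (card T)\<close> up to a factor 1 + O(\<open>rho\<close>) by \<open>g_sharp\<close> and
  \<open>g_lower\<close>. The exponential bounds follow from 1 - y \<le> exp(-y), and from ln(1 - y)
  \<ge> -y - 2 y^2 for 0 \<le> y \<le> 1/2.\<close>

lemma g_product_bounds:
  assumes "finite S" "S \<subseteq> bad"
  shows "exp (- (1 + 200 * rho) * (\<Sum>T\<in>S. pr (card T))) * g {} {} \<le> g S {} \<and>
         g S {} \<le> exp (- (1 - 232 * rho) * (\<Sum>T\<in>S. pr (card T))) * g {} {}"
  using assms
proof (induction S rule: finite_induct)
  case (insert T S)
  have T: "T \<in> bad" and S: "S \<subseteq> bad" using insert.prems by auto
  let ?p = "pr (card T)" and ?L = "\<Sum>T\<in>S. pr (card T)"
  let ?y = "(1 + 160 * rho) * ?p"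
  have eq: "g (insert T S) {} = g S {} - g S T" using insert.hyps g_insert_forbidden by auto
  have split: "- c * (\<Sum>T\<in>insert T S. pr (card T)) = - (c * ?p) + - c * ?L" for c :: real
    using insert.hyps by (simp add: algebra_simps)
  have p0: "?p > 0" by (rule pr_pos)
  have pN: "?p \<le> 2 / real N"
  proof -
    have "(2 / real N)\<^sup>2 \<le> 2 / real N"
      using N_ge by (simp add: power2_eq_square field_simps)
    then show ?thesis using bad_card[OF T] pr_le[of "card T"] by auto
  qed
  have invN: "1 / real N \<le> rho" using r_pos N_ge by (intro divide_right_mono) auto
  have "?y \<le> 2 * ?p" using rho_small p0 by (intro mult_right_mono) auto
  also have "\<dots> \<le> 4 / real N" using pN by simp
  finally have y4: "?y \<le> 4 / real N" .
  have "4 / real N \<le> 1 / 2" using N_ge by (simp add: field_simps)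
  then have y2: "?y \<le> 1 / 2" using y4 by linarith
  have y0: "0 \<le> ?y" using p0 rho_nonneg by simp
  \<comment> \<open>A single probability is at most 4/N, hence at most 4 \<open>rho\<close>, so the
    quadratic term of the logarithm is also a relative error O(\<open>rho\<close>).\<close>
  have "?y * ?y \<le> ?y * (4 * rho)" using y4 invN y0 by (intro mult_left_mono) auto
  moreover have "y + 2 * y\<^sup>2 \<le> y + 8 * x * y" if "y * y \<le> y * (4 * x)" for x y :: real
    using that by (simp add: power2_eq_square algebra_simps)
  ultimately have "?y + 2 * ?y\<^sup>2 \<le> ?y + 8 * rho * ?y" by blast
  also have "\<dots> = (1 + 8 * rho) * (1 + 160 * rho) * ?p"
    by (simp only: distrib_right mult_1_left mult.assoc)
  also have "\<dots> \<le> (1 + 200 * rho) * ?p"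
  proof (rule mult_right_mono)
    have "(1 + 8 * x) * (1 + 160 * x) \<le> 1 + 200 * x" if "0 \<le> x" "x \<le> 1 / 1000" for x :: real
    proof -
      have "x * x \<le> x * (1 / 1000)" using that by (intro mult_left_mono) auto
      then show ?thesis using that by (simp add: algebra_simps)
    qed
    from this[OF rho_nonneg rho_small] show "(1 + 8 * rho) * (1 + 160 * rho) \<le> 1 + 200 * rho" .
  qed (use p0 in simp)
  finally have "- ((1 + 200 * rho) * ?p) \<le> - ?y - 2 * ?y\<^sup>2" by simp
  also have "\<dots> \<le> ln (1 - ?y)" using ln_one_minus_pos_lower_bound[OF y0 y2] .
  finally have low: "exp (- ((1 + 200 * rho) * ?p)) \<le> 1 - ?y"
    using y2 by (subst (asm) ln_ge_iff) linarith+
  have "exp (- (1 + 200 * rho) * (\<Sum>T\<in>insert T S. pr (card T))) * g {} {} =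
     exp (- ((1 + 200 * rho) * ?p)) * (exp (- (1 + 200 * rho) * ?L) * g {} {})"
    unfolding split exp_add by (simp only: mult.assoc)
  also have "\<dots> \<le> (1 - ?y) * g S {}"
    using low insert.IH S y2 by (intro mult_mono) auto
  also have "\<dots> \<le> g (insert T S) {}" using g_sharp[OF S T] eq by (simp add: algebra_simps)
  finally have 1: "exp (- (1 + 200 * rho) * (\<Sum>T\<in>insert T S. pr (card T))) * g {} {} \<le>
     g (insert T S) {}" .
  have "g (insert T S) {} \<le> (1 - (1 - 232 * rho) * ?p) * g S {}"
    using g_lower[OF S T insert.hyps(2)] eq by (simp add: algebra_simps)
  also have "\<dots> \<le> exp (- ((1 - 232 * rho) * ?p)) * (exp (- (1 - 232 * rho) * ?L) * g {} {})"
    using insert.IH S exp_ge_add_one_self[of "- ((1 - 232 * rho) * ?p)"]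
    by (intro mult_mono) auto
  also have "\<dots> = exp (- (1 - 232 * rho) * (\<Sum>T\<in>insert T S. pr (card T))) * g {} {}"
    unfolding split exp_add by (simp only: mult.assoc)
  finally show ?case using 1 by blast
qed simp

definition Lambda :: real where
  "Lambda = real (card loops) * pr 1 + real (card doubles) * pr 2"

lemma sum_bad: "(\<Sum>T\<in>bad. pr (card T)) = Lambda"
proof -
  have "loops \<inter> doubles = {}" using card_loop card_double by fastforce
  then have "(\<Sum>T\<in>bad. pr (card T)) = (\<Sum>T\<in>loops. pr (card T)) + (\<Sum>T\<in>doubles. pr (card T))"
    using finite_bad unfolding bad_def by (intro sum.union_disjoint) auto
  then show ?thesis using card_loop card_double by (simp add: Lambda_def)
qed

lemma Lambda_bounds: "0 \<le> Lambda" "Lambda \<le> 20 * (real r)\<^sup>2"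
proof -
  have N0: "real N > 0" using N_ge by simp
  show "0 \<le> Lambda" unfolding Lambda_def using pr_pos[of 1] pr_pos[of 2] by simp
  have "real (card loops) * pr 1 \<le> real (2 * N * r) * (2 / real N) ^ 1"
    using card_loops_le pr_le[of 1] pr_pos[of 1] by (intro mult_mono of_nat_mono) auto
  moreover have "real (2 * N * r) * (2 / real N) ^ 1 = 4 * real r" using N0 by simp
  moreover have "real (card doubles) * pr 2 \<le> real ((2 * N * r) * (2 * N * r)) * (2 / real N) ^ 2"
    using card_doubles_le pr_le[of 2] pr_pos[of 2] by (intro mult_mono of_nat_mono) auto
  moreover have "real ((2 * N * r) * (2 * N * r)) * (2 / real N) ^ 2 = 16 * (real r)\<^sup>2"
    using N0 by (simp add: power2_eq_square)
  ultimately show "Lambda \<le> 20 * (real r)\<^sup>2"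
    unfolding Lambda_def using r_le_square by linarith
qed

text \<open>The relative error 232 \<open>rho\<close> in the exponent, multiplied by
  \<open>Lambda\<close>, which is at most \<open>20 * r^2\<close>, gives 4640.\<close>

theorem simple_matchings_estimate:
  assumes "matchings \<noteq> {}"
  shows "\<exists>\<epsilon>. \<bar>\<epsilon>\<bar> \<le> 4640 * real r ^ 4 / real N \<and>
    real (card (avoiders bad {})) = real (card matchings) * exp (- Lambda + \<epsilon>)"
proof -
  have eq: "avoiders {} {} = matchings" unfolding avoiders_def avoids_def by auto
  have m0: "real (card matchings) > 0" using assms finite_matchings by (simp add: card_gt_0_iff)
  let ?R = "g bad {} / real (card matchings)"
  have b: "exp (- (1 + 200 * rho) * Lambda) \<le> ?R" "?R \<le> exp (- (1 - 232 * rho) * Lambda)"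
    using g_product_bounds[OF finite_bad subset_refl] m0 unfolding sum_bad eq
    by (simp_all add: field_simps)
  have R0: "?R > 0" using b(1) exp_gt_zero less_le_trans by blast
  have l1: "- (1 + 200 * rho) * Lambda \<le> ln ?R" using b(1) R0 by (simp only: ln_ge_iff)
  have "ln ?R \<le> ln (exp (- (1 - 232 * rho) * Lambda))"
    using b(2) R0 by (subst ln_le_cancel_iff) simp_all
  then have l2: "ln ?R \<le> - (1 - 232 * rho) * Lambda" by simp
  have rl: "rho * Lambda \<le> 20 * (rho * (real r)\<^sup>2)"
    using mult_left_mono[OF Lambda_bounds(2) rho_nonneg] by (simp only: mult.left_commute)
  have rl0: "0 \<le> rho * Lambda" using Lambda_bounds(1) by simp
  have "\<bar>ln ?R + Lambda\<bar> \<le> 232 * (rho * Lambda)"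
  proof -
    have "- (1 + 200 * x) * y = - y - 200 * (x * y)" "- (1 - 232 * x) * y = - y + 232 * (x * y)"
      for x y :: real by (simp_all add: left_diff_distrib)
    note this[of rho Lambda]
    moreover have "\<bar>l + y\<bar> \<le> 232 * z"
      if "- y - 200 * z \<le> l" "l \<le> - y + 232 * z" "0 \<le> z" for l y z :: real
      using that by linarith
    ultimately show ?thesis using l1 l2 rl0 by presburger
  qed
  also have "\<dots> \<le> 4640 * (rho * (real r)\<^sup>2)" using rl by linarith
  also have "rho * (real r)\<^sup>2 = real r ^ 4 / real N" by (simp add: power4_eq_xxxx power2_eq_square)
  finally have "\<bar>ln ?R + Lambda\<bar> \<le> 4640 * real r ^ 4 / real N" by simp
  moreover have "g bad {} = real (card matchings) * exp (- Lambda + (ln ?R + Lambda))"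
    using R0 m0 by simp
  ultimately show ?thesis by blast
qed

end

section \<open>Matchings that project to a given graph\<close>

text \<open>\<open>\<sigma>\<close> sends a point to its site: a vertex for graphs, a vertex
  together with a direction for digraphs. Bijectivity says that every edge of \<open>G\<close>
  carries exactly one pair.\<close>

definition configurations :: "'p set \<Rightarrow> ('p \<Rightarrow> 's) \<Rightarrow> 's set set \<Rightarrow> 'p set set set" where
  "configurations P \<sigma> G =
     {M. (\<forall>e\<in>M. card e = 2) \<and> disjoint M \<and> \<Union>M = P \<and> bij_betw ((`) \<sigma>) M G}"

text \<open>\<open>\<sigma>\<close> is injective on each pair because edges have two elements. So
  every point over \<open>s\<close> belongs to a different pair, and these pairs correspond to the
  edges at \<open>s\<close>.\<close>

lemma configurations_degree:
  assumes M: "M \<in> configurations P \<sigma> G" and P: "finite P" and G: "\<And>g. g \<in> G \<Longrightarrow> card g = 2"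
  shows "card {x \<in> P. \<sigma> x = s} = card {g \<in> G. s \<in> g}"
proof -
  from M have e2: "\<And>e. e \<in> M \<Longrightarrow> card e = 2" and dj: "disjoint M" and UM: "\<Union>M = P"
    and bij: "bij_betw ((`) \<sigma>) M G" unfolding configurations_def by auto
  have finM: "finite M" using UM P finite_UnionD by auto
  have one: "card {x \<in> e. \<sigma> x = s} = (if s \<in> \<sigma> ` e then 1 else 0)" if "e \<in> M" for e
  proof -
    have "\<sigma> ` e \<in> G" using bij that unfolding bij_betw_def by auto
    then have "card (\<sigma> ` e) = card e" using G e2[OF that] by auto
    moreover have fe: "finite e" using e2[OF that] by (simp add: card_ge_0_finite)
    ultimately have inj: "inj_on \<sigma> e" by (simp add: eq_card_imp_inj_on)
    show ?thesis
    proof (cases "s \<in> \<sigma> ` e")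
      case True
      then obtain a where "a \<in> e" "\<sigma> a = s" by auto
      then have "{x \<in> e. \<sigma> x = s} = {a}" using inj by (auto dest: inj_onD)
      then show ?thesis using True by simp
    next
      case False
      then have "{x \<in> e. \<sigma> x = s} = {}" by auto
      then show ?thesis using False by (simp only: card.empty if_False)
    qed
  qed
  have "{x \<in> P. \<sigma> x = s} = (\<Union>e\<in>M. {x \<in> e. \<sigma> x = s})" using UM by auto
  then have "card {x \<in> P. \<sigma> x = s} = card (\<Union>e\<in>M. {x \<in> e. \<sigma> x = s})" by simp
  also have "\<dots> = (\<Sum>e\<in>M. card {x \<in> e. \<sigma> x = s})"
  proof (rule card_UN_disjoint)
    show "\<forall>e\<in>M. finite {x \<in> e. \<sigma> x = s}" using UM P by (auto intro: finite_subset)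
    show "\<forall>e\<in>M. \<forall>f\<in>M. e \<noteq> f \<longrightarrow> {x \<in> e. \<sigma> x = s} \<inter> {x \<in> f. \<sigma> x = s} = {}"
      using dj unfolding disjoint_def by blast
  qed (rule finM)
  also have "\<dots> = (\<Sum>e\<in>M. if s \<in> \<sigma> ` e then 1 else 0)" using one by (intro sum.cong) auto
  also have "\<dots> = card {e \<in> M. s \<in> \<sigma> ` e}"
    using finM by (simp add: sum.If_cases Int_def)
  also have "\<dots> = card ((`) \<sigma> ` {e \<in> M. s \<in> \<sigma> ` e})"
    using bij unfolding bij_betw_def by (intro card_image[symmetric]) (auto intro: inj_on_subset)
  also have "(`) \<sigma> ` {e \<in> M. s \<in> \<sigma> ` e} = {g \<in> G. s \<in> g}"
  proof -
    have "{g \<in> (`) \<sigma> ` M. s \<in> g} = (`) \<sigma> ` {e \<in> M. s \<in> \<sigma> ` e}" by (rule Compr_image_eq)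
    then show ?thesis using bij unfolding bij_betw_def by simp
  qed
  finally show ?thesis .
qed

lemma disjoint_insert_Diff:
  assumes "disjoint (insert e M)" "e \<notin> M"
  shows "\<Union>M = \<Union>(insert e M) - e"
proof -
  have "e \<inter> f = {}" if "f \<in> M" for f
  proof -
    have "e \<noteq> f" using assms(2) that by auto
    then show ?thesis using assms(1) that unfolding disjoint_def by simp
  qed
  then show ?thesis by blast
qed

text \<open>The pair over the new edge picks one point over \<open>s\<close> and one over
  \<open>t\<close>; deleting both leaves a configuration for \<open>G\<close> on the remaining
  points. As \<open>s \<noteq> t\<close>, the pair determines which of its points is which.\<close>

lemma configurations_insert:
  assumes st: "s \<noteq> t" "{s, t} \<notin> G"
  shows "bij_betw (\<lambda>((x, y), M). insert {x, y} M)
     (Sigma ({x \<in> P. \<sigma> x = s} \<times> {y \<in> P. \<sigma> y = t}) (\<lambda>(x, y). configurations (P - {x, y}) \<sigma> G))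
     (configurations P \<sigma> (insert {s, t} G))"
    (is "bij_betw ?h ?A ?B")
proof (rule bij_betw_imageI)
  have inA: "x \<in> P \<and> y \<in> P \<and> \<sigma> x = s \<and> \<sigma> y = t \<and> M \<in> configurations (P - {x, y}) \<sigma> G \<and>
      {x, y} \<notin> M \<and> (\<forall>e\<in>M. \<sigma> ` e \<noteq> {s, t})"
    if "((x, y), M) \<in> ?A" for x y M
  proof -
    from that have M: "x \<in> P" "y \<in> P" "\<sigma> x = s" "\<sigma> y = t" "M \<in> configurations (P - {x, y}) \<sigma> G"
      by auto
    have "(`) \<sigma> ` M = G" using M(5) unfolding configurations_def bij_betw_def by simp
    then have "\<sigma> ` e \<in> G" if "e \<in> M" for e using that by blast
    then have "\<forall>e\<in>M. \<sigma> ` e \<noteq> {s, t}" using st(2) by metis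
    moreover have "{x, y} \<notin> M" using M(5) unfolding configurations_def by blast
    ultimately show ?thesis using M by blast
  qed
  show "inj_on ?h ?A"
  proof (rule inj_onI)
    fix z z' assume a: "z \<in> ?A" "z' \<in> ?A" and eq: "?h z = ?h z'"
    obtain x y M where z: "z = ((x, y), M)" by (metis surj_pair)
    obtain x' y' M' where z': "z' = ((x', y'), M')" by (metis surj_pair)
    note b = inA[OF a(1)[unfolded z]] and b' = inA[OF a(2)[unfolded z']]
    have e: "insert {x, y} M = insert {x', y'} M'" using eq z z' by simp
    have "\<sigma> ` {x, y} = {s, t}" using b by auto
    then have "{x, y} \<notin> M'" using b' by blast
    then have xy: "{x, y} = {x', y'}" using e by blast
    moreover have "x \<noteq> y'" using b b' st(1) by auto
    ultimately have "x = x'" "y = y'" by (auto simp: doubleton_eq_iff)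
    moreover have "M = M'" using e xy b b' by (metis insert_ident)
    ultimately show "z = z'" using z z' by simp
  qed
  show "?h ` ?A = ?B"
  proof (intro equalityI subsetI)
    fix L assume "L \<in> ?h ` ?A"
    then obtain x y M where z: "((x, y), M) \<in> ?A" and L: "L = insert {x, y} M" by auto
    note b = inA[OF z]
    have "x \<noteq> y" using b st(1) by auto
    have M: "\<forall>e\<in>M. card e = 2" "disjoint M" "\<Union>M = P - {x, y}" "bij_betw ((`) \<sigma>) M G"
      using b unfolding configurations_def by auto
    have dj: "disjoint L"
    proof -
      have "{x, y} \<inter> f = {}" if "f \<in> M" for f using M(3) that by blast
      then show ?thesis using M(2) unfolding L disjoint_def by (simp add: Int_commute)
    qed
    have im: "\<sigma> ` {x, y} = {s, t}" using b by auto
    have "bij_betw ((`) \<sigma>) L (insert {s, t} G)"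
      using M(4) b st(2) im unfolding L bij_betw_def by auto
    moreover have "\<Union>L = P" using M(3) b unfolding L by auto
    moreover have "\<forall>e\<in>L. card e = 2" using M(1) \<open>x \<noteq> y\<close> unfolding L by auto
    ultimately show "L \<in> ?B" using dj unfolding configurations_def by blast
  next
    fix L assume "L \<in> ?B"
    then have L: "\<forall>e\<in>L. card e = 2" "disjoint L" "\<Union>L = P" "bij_betw ((`) \<sigma>) L (insert {s, t} G)"
      unfolding configurations_def by auto
    then obtain e where e: "e \<in> L" "\<sigma> ` e = {s, t}"
      unfolding bij_betw_def by (metis imageE insertI1)
    obtain a b where ab: "e = {a, b}" "a \<noteq> b" using L(1) e(1) by (metis card_2_iff)
    then have "{\<sigma> a, \<sigma> b} = {s, t}" using e(2) by auto
    then obtain x y where xy: "e = {x, y}" "\<sigma> x = s" "\<sigma> y = t"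
      using ab(1) by (auto simp: doubleton_eq_iff insert_commute)
    let ?M = "L - {{x, y}}"
    have L': "L = insert {x, y} ?M" using e(1) xy(1) by auto
    have "disjoint ?M" using L(2) unfolding disjoint_def by simp
    moreover have "\<Union>?M = P - {x, y}"
      using disjoint_insert_Diff[of "{x, y}" ?M] L(2,3) L' by simp
    moreover have "bij_betw ((`) \<sigma>) ?M G"
    proof -
      have "bij_betw ((`) \<sigma>) (L - {e}) (insert {s, t} G - {\<sigma> ` e})"
        using L(4) e(1) inj_on_image_set_diff[of "(`) \<sigma>" L L "{e}"]
        unfolding bij_betw_def by (auto intro: inj_on_subset)
      then show ?thesis using xy(1) e(2) st(2) by simp
    qed
    ultimately have "?M \<in> configurations (P - {x, y}) \<sigma> G"
      using L(1) unfolding configurations_def by blast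
    moreover have "x \<in> P" "y \<in> P" using L(3) e(1) xy(1) by auto
    ultimately have "((x, y), ?M) \<in> ?A" using xy by simp
    then show "L \<in> ?h ` ?A" using L' by (intro image_eqI[of _ _ "((x, y), ?M)"]) auto
  qed
qed

lemma configurations_finite:
  assumes "finite P" shows "finite (configurations P \<sigma> G)"
  by (rule finite_subset[of _ "Pow (Pow P)"]) (use assms in \<open>auto simp: configurations_def\<close>)

text \<open>Induction on the edges: with k points over an end of the removed edge, the choice of a
  point gives the factor k, and the rest contributes (k - 1)! at this site. The point set shrinks
  along, hence the generalisation over \<open>P\<close>.\<close>

lemma card_configurations:
  assumes "finite G" "finite P" "finite S" "\<sigma> ` P \<subseteq> S" "\<And>g. g \<in> G \<Longrightarrow> card g = 2"
    "\<And>s. card {x \<in> P. \<sigma> x = s} = card {g \<in> G. s \<in> g}"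
  shows "card (configurations P \<sigma> G) = (\<Prod>s\<in>S. fact (card {x \<in> P. \<sigma> x = s}))"
  using assms
proof (induction G arbitrary: P rule: finite_induct)
  case empty
  have "P = {}"
  proof (rule ccontr)
    assume "P \<noteq> {}"
    then obtain x where "x \<in> P" by auto
    then have "x \<in> {y \<in> P. \<sigma> y = \<sigma> x}" by simp
    moreover have "{y \<in> P. \<sigma> y = \<sigma> x} = {}" using empty(5)[of "\<sigma> x"] empty(1) by simp
    ultimately show False by simp
  qed
  moreover from this have "configurations P \<sigma> {} = {{}}"
    unfolding configurations_def by (auto simp: bij_betw_def disjoint_def)
  ultimately show ?case by simp
next
  case (insert g G)
  obtain s t where st: "g = {s, t}" "s \<noteq> t" using insert.prems(4)[of g] by (auto simp: card_2_iff)
  let ?F = "\<lambda>P s. {x \<in> P. \<sigma> x = s}"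
  have deg: "card {h \<in> insert g G. v \<in> h} = card {h \<in> G. v \<in> h} + (if v \<in> g then 1 else 0)" for v
  proof (cases "v \<in> g")
    case True
    then have "{h \<in> insert g G. v \<in> h} = insert g {h \<in> G. v \<in> h}" by auto
    then show ?thesis using True insert.hyps by simp
  next
    case False
    then have "{h \<in> insert g G. v \<in> h} = {h \<in> G. v \<in> h}" by auto
    then show ?thesis using False by simp
  qed
  have pos: "card (?F P s) > 0" "card (?F P t) > 0"
    using insert.prems(5)[of s] insert.prems(5)[of t] deg[of s] deg[of t] st(1) by auto
  have stS: "s \<in> S" "t \<in> S"
  proof -
    have "?F P s \<noteq> {}" "?F P t \<noteq> {}" using pos by (metis card.empty less_irrefl)+
    then show "s \<in> S" "t \<in> S" using insert.prems(3) by auto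
  qed
  let ?K = "\<Prod>v\<in>S - {s, t}. fact (card (?F P v)) :: nat"
  have rec: "card (configurations (P - {x, y}) \<sigma> G) =
      fact (card (?F P s) - 1) * fact (card (?F P t) - 1) * ?K"
    if x: "x \<in> ?F P s" and y: "y \<in> ?F P t" for x y
  proof -
    have "?F (P - {x, y}) s = ?F P s - {x}" "?F (P - {x, y}) t = ?F P t - {y}"
      using x y st(2) by auto
    then have Fs: "card (?F (P - {x, y}) s) = card (?F P s) - 1"
      and Ft: "card (?F (P - {x, y}) t) = card (?F P t) - 1"
      using x y by (simp_all add: card_Diff_singleton)
    have Fo: "?F (P - {x, y}) v = ?F P v" if "v \<notin> {s, t}" for v
      using x y that by auto
    have "card (configurations (P - {x, y}) \<sigma> G) = (\<Prod>v\<in>S. fact (card (?F (P - {x, y}) v)))"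
    proof (rule insert.IH)
      show "card (?F (P - {x, y}) v) = card {h \<in> G. v \<in> h}" for v
        using insert.prems(5)[of v] deg[of v] Fs Ft Fo[of v] st(1) by (cases "v \<in> {s, t}") auto
    qed (use insert.prems in auto)
    also have "\<dots> = (\<Prod>v\<in>{s, t}. fact (card (?F (P - {x, y}) v))) *
        (\<Prod>v\<in>S - {s, t}. fact (card (?F (P - {x, y}) v)))"
      using prod.subset_diff[of "{s, t}" S "\<lambda>v. fact (card (?F (P - {x, y}) v)) :: nat"] stS insert.prems(2)
      by (simp add: mult.commute)
    also have "(\<Prod>v\<in>S - {s, t}. fact (card (?F (P - {x, y}) v))) = ?K"
      using Fo by (intro prod.cong) auto
    finally show ?thesis using st(2) Fs Ft by (simp add: mult.assoc)
  qed
  let ?A = "?F P s \<times> ?F P t"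
  have "card (configurations P \<sigma> (insert g G)) =
      card (Sigma ?A (\<lambda>(x, y). configurations (P - {x, y}) \<sigma> G))"
    using bij_betw_same_card[OF configurations_insert[of s t G P \<sigma>]] st insert.hyps(2) by simp
  also have "\<dots> = (\<Sum>z\<in>?A. card (case z of (x, y) \<Rightarrow> configurations (P - {x, y}) \<sigma> G))"
    using insert.prems(1)
    by (intro card_SigmaI) (auto split: prod.split intro!: configurations_finite)
  also have "\<dots> = (\<Sum>z\<in>?A. fact (card (?F P s) - 1) * fact (card (?F P t) - 1) * ?K)"
    using rec by (intro sum.cong) auto
  also have "\<dots> = (card (?F P s) * fact (card (?F P s) - 1)) *
      (card (?F P t) * fact (card (?F P t) - 1)) * ?K"
    by (simp add: card_cartesian_product)
  also have "\<dots> = fact (card (?F P s)) * fact (card (?F P t)) * ?K"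
    using pos by (simp add: fact_reduce)
  also have "\<dots> = (\<Prod>v\<in>S. fact (card (?F P v)))"
    using prod.subset_diff[of "{s, t}" S "\<lambda>v. fact (card (?F P v)) :: nat"] stS insert.prems(2) st(2)
    by (simp add: mult_ac)
  finally show ?case .
qed

context celled_matching_model
begin

lemma avoiders_bad_cells:
  assumes M: "M \<in> avoiders bad {}" and xy: "{x, y} \<in> M"
  shows "cell x \<noteq> cell y"
proof
  assume "cell x = cell y"
  have "M \<in> matchings" using M unfolding avoiders_def by auto
  then have "{x, y} \<in> edges" using xy matching_edges by auto
  then have "{{x, y}} \<in> loops" using \<open>cell x = cell y\<close> unfolding loops_def by auto
  then show False using M xy unfolding avoiders_def avoids_def bad_def by auto
qed

lemma avoiders_bad_inj:
  assumes M: "M \<in> avoiders bad {}" and e: "{x, y} \<in> M" and f: "{x', y'} \<in> M"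
    and c: "cell x = cell x'" "cell y = cell y'"
  shows "{x, y} = {x', y'}"
proof (rule ccontr)
  assume ne: "{x, y} \<noteq> {x', y'}"
  have MM: "M \<in> matchings" using M unfolding avoiders_def by auto
  then have "{x, y} \<inter> {x', y'} = {}" using matching_unique[OF MM e f] ne by auto
  then have "x \<noteq> x'" "y \<noteq> y'" by auto
  moreover have "{x, y} \<in> edges" "{x', y'} \<in> edges"
    using matching_edges[OF MM e] matching_edges[OF MM f] by auto
  ultimately have "{{x, y}, {x', y'}} \<in> doubles"
    using c avoiders_bad_cells[OF M e] unfolding doubles_def by blast
  then have "\<not> {{x, y}, {x', y'}} \<subseteq> M" using M unfolding avoiders_def avoids_def bad_def by blast
  then show False using e f by simp
qed

text \<open>Two pairs over the same edge of sites would join the same two cells, that is, form a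
  double edge.\<close>

lemma avoiders_bad_configuration:
  assumes M: "M \<in> avoiders bad {}" and cell: "\<And>x. cell x = \<tau> (\<sigma> x)"
  shows "M \<in> configurations P \<sigma> ((`) \<sigma> ` M)"
proof -
  have MM: "M \<in> matchings" using M unfolding avoiders_def by auto
  have "inj_on ((`) \<sigma>) M"
  proof (rule inj_onI)
    fix e f assume ef: "e \<in> M" "f \<in> M" and eq: "\<sigma> ` e = \<sigma> ` f"
    obtain x y where e: "e = {x, y}" using matching_edges[OF MM ef(1)] by (rule edge_cases)
    obtain a b where f: "f = {a, b}" using matching_edges[OF MM ef(2)] by (rule edge_cases)
    from eq have "{\<sigma> x, \<sigma> y} = {\<sigma> a, \<sigma> b}" unfolding e f by simp
    then consider "\<sigma> x = \<sigma> a" "\<sigma> y = \<sigma> b" | "\<sigma> x = \<sigma> b" "\<sigma> y = \<sigma> a"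
      by (auto simp: doubleton_eq_iff)
    then show "e = f"
    proof cases
      case 1
      then show ?thesis using avoiders_bad_inj[OF M, of x y a b] ef cell unfolding e f by simp
    next
      case 2
      then show ?thesis using avoiders_bad_inj[OF M, of x y b a] ef cell unfolding e f
        by (simp add: insert_commute)
    qed
  qed
  then have "bij_betw ((`) \<sigma>) M ((`) \<sigma> ` M)" by (rule inj_on_imp_bij_betw)
  then show ?thesis
    using MM card_edge unfolding configurations_def matchings_def by auto
qed

text \<open>\<open>nodouble\<close> compares edges after projection to cells, not sites; for
  digraphs this is what excludes antiparallel arcs besides repeated ones.\<close>

lemma configuration_avoiders_bad:
  assumes M: "M \<in> configurations P \<sigma> G" and cell: "\<And>x. cell x = \<tau> (\<sigma> x)"
    and allowed: "\<And>x y. x \<noteq> y \<Longrightarrow> {\<sigma> x, \<sigma> y} \<in> G \<Longrightarrow> undirected \<or> col x \<noteq> col y"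
    and noloop: "\<And>s t. {s, t} \<in> G \<Longrightarrow> \<tau> s \<noteq> \<tau> t"
    and nodouble: "\<And>g h. g \<in> G \<Longrightarrow> h \<in> G \<Longrightarrow> \<tau> ` g = \<tau> ` h \<Longrightarrow> g = h"
  shows "M \<in> avoiders bad {}"
proof -
  from M have e2: "\<And>e. e \<in> M \<Longrightarrow> card e = 2" and dj: "disjoint M" and UM: "\<Union>M = P"
    and bij: "bij_betw ((`) \<sigma>) M G" unfolding configurations_def by auto
  have inG: "\<sigma> ` e \<in> G" if "e \<in> M" for e using bij that unfolding bij_betw_def by auto
  have "M \<subseteq> edges"
  proof
    fix e assume e: "e \<in> M"
    obtain x y where xy: "e = {x, y}" "x \<noteq> y" using e2[OF e] by (auto simp: card_2_iff)
    then have "undirected \<or> col x \<noteq> col y" using allowed[of x y] inG[OF e] by simp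
    moreover have "x \<in> P" "y \<in> P" using UM e xy by auto
    ultimately show "e \<in> edges" using xy unfolding edges_def allowed_def by blast
  qed
  then have MM: "M \<in> matchings" using dj UM unfolding matchings_def by auto
  have "\<not> T \<subseteq> M" if "T \<in> bad" for T
  proof
    assume TM: "T \<subseteq> M"
    show False
    proof (cases "T \<in> loops")
      case True
      then obtain x y where xy: "T = {{x, y}}" "cell x = cell y" by (rule loop_cases)
      then have "{\<sigma> x, \<sigma> y} \<in> G" using inG[of "{x, y}"] TM by simp
      then show False using noloop xy(2) cell by auto
    next
      case False
      then have Td: "T \<in> doubles" using that unfolding bad_def by auto
      then obtain x y x' y' where T: "T = {{x, y}, {x', y'}}" "cell x = cell x'" "cell y = cell y'"
        by (rule double_cases)
      have m: "{x, y} \<in> M" "{x', y'} \<in> M" using T TM by auto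
      have "\<tau> ` (\<sigma> ` {x, y}) = \<tau> ` (\<sigma> ` {x', y'})" using T cell by simp
      then have "\<sigma> ` {x, y} = \<sigma> ` {x', y'}" using nodouble inG m by blast
      then have "{x, y} = {x', y'}" using bij m unfolding bij_betw_def by (blast dest: inj_onD)
      then show False using card_double[OF Td] T(1) by simp
    qed
  qed
  then show ?thesis using MM unfolding avoiders_def avoids_def by auto
qed

text \<open>The avoiders are partitioned by their projections, and each class has the same size by
  \<open>card_configurations\<close>, since all members of \<open>\<G>\<close> have the same
  degrees.\<close>

lemma card_avoiders_bad:
  assumes cell: "\<And>x. cell x = \<tau> (\<sigma> x)" and fin: "finite \<G>"
    and into: "\<And>M. M \<in> avoiders bad {} \<Longrightarrow> (`) \<sigma> ` M \<in> \<G>"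
    and onto: "\<And>G M. G \<in> \<G> \<Longrightarrow> M \<in> configurations P \<sigma> G \<Longrightarrow> M \<in> avoiders bad {}"
    and two: "\<And>G g. G \<in> \<G> \<Longrightarrow> g \<in> G \<Longrightarrow> card g = 2"
    and finG: "\<And>G. G \<in> \<G> \<Longrightarrow> finite G"
    and deg: "\<And>G s. G \<in> \<G> \<Longrightarrow> card {x \<in> P. \<sigma> x = s} = card {g \<in> G. s \<in> g}"
    and S: "finite S" "\<sigma> ` P \<subseteq> S"
  shows "card (avoiders bad {}) = card \<G> * (\<Prod>s\<in>S. fact (card {x \<in> P. \<sigma> x = s}))"
proof -
  have "avoiders bad {} = (\<Union>G\<in>\<G>. configurations P \<sigma> G)"
    using avoiders_bad_configuration[where \<tau> = \<tau> and \<sigma> = \<sigma>, OF _ cell] into onto by blast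
  then have "card (avoiders bad {}) = card (\<Union>G\<in>\<G>. configurations P \<sigma> G)" by simp
  also have "\<dots> = (\<Sum>G\<in>\<G>. card (configurations P \<sigma> G))"
  proof (rule card_UN_disjoint[OF fin])
    show "\<forall>G\<in>\<G>. finite (configurations P \<sigma> G)" using configurations_finite finite_points by auto
    show "\<forall>G\<in>\<G>. \<forall>H\<in>\<G>. G \<noteq> H \<longrightarrow> configurations P \<sigma> G \<inter> configurations P \<sigma> H = {}"
      unfolding configurations_def bij_betw_def by blast
  qed
  also have "\<dots> = (\<Sum>G\<in>\<G>. \<Prod>s\<in>S. fact (card {x \<in> P. \<sigma> x = s}))"
    using two finG deg S finite_points by (intro sum.cong card_configurations) auto
  finally show ?thesis by simp
qed

end

section \<open>The expected number of loops and double edges\<close>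

lemma card_uniform_fibres:
  assumes "finite A" "\<And>a. a \<in> A \<Longrightarrow> card {x \<in> A. f x = f a} = k"
  shows "card A = k * card (f ` A)"
proof -
  have "card A = (\<Sum>x\<in>A. 1)" by simp
  also have "\<dots> = (\<Sum>b\<in>f ` A. \<Sum>x\<in>{x \<in> A. f x = b}. 1)"
    by (rule sum.image_gen[OF assms(1)])
  also have "\<dots> = (\<Sum>b\<in>f ` A. k)" using assms(2) by (intro sum.cong) auto
  finally show ?thesis by simp
qed

context celled_matching_model
begin

definition mates :: "('p \<times> 'p) set" where
  "mates = {(x, y). x \<in> P \<and> y \<in> P \<and> x \<noteq> y \<and> cell x = cell y}"

definition loop_pairs :: "('p \<times> 'p) set" where
  "loop_pairs = {(x, y) \<in> mates. undirected \<or> col x \<noteq> col y}"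

text \<open>Ordered double edges without the requirement that the two cells differ. Dropping it lets
  the count factor into sums over vertices; the surplus only affects the error term.\<close>

definition double_tuples :: "(('p \<times> 'p) \<times> ('p \<times> 'p)) set" where
  "double_tuples = {((x, x'), (y, y')). (x, x') \<in> mates \<and> (y, y') \<in> mates \<and>
     (undirected \<or> col x \<noteq> col y \<and> col x' \<noteq> col y')}"

lemma finite_mates: "finite mates"
  by (rule finite_subset[of _ "P \<times> P"]) (auto simp: mates_def finite_points)

lemma finite_double_tuples: "finite double_tuples"
  by (rule finite_subset[of _ "mates \<times> mates"]) (auto simp: double_tuples_def finite_mates)

lemma card_loop_pairs: "card loop_pairs = 2 * card loops"
proof -
  let ?f = "\<lambda>(x, y). {{x, y}}"
  have "loops = ?f ` loop_pairs"
    unfolding loops_def loop_pairs_def mates_def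
    by (auto simp: doubleton_in_edges allowed_def image_iff)
  moreover have "card loop_pairs = 2 * card (?f ` loop_pairs)"
  proof (rule card_uniform_fibres)
    show "finite loop_pairs" using finite_mates by (rule rev_finite_subset) (auto simp: loop_pairs_def)
    fix a assume a: "a \<in> loop_pairs"
    then obtain x y where xy: "a = (x, y)" "x \<noteq> y" unfolding loop_pairs_def mates_def by auto
    have "{z \<in> loop_pairs. ?f z = ?f a} = {(x, y), (y, x)}"
      using a xy unfolding loop_pairs_def mates_def by (auto simp: doubleton_eq_iff)
    then show "card {z \<in> loop_pairs. ?f z = ?f a} = 2" using xy by simp
  qed
  ultimately show ?thesis by simp
qed

text \<open>A double edge has four descriptions: its two pairs can be exchanged, and so can its two
  cells.\<close>

lemma card_separated_tuples:
  "card {((x, x'), (y, y')) \<in> double_tuples. cell x \<noteq> cell y} = 4 * card doubles"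
proof -
  let ?A = "{((x, x'), (y, y')) \<in> double_tuples. cell x \<noteq> cell y}"
  let ?f = "\<lambda>((x, x'), (y, y')). {{x, y}, {x', y'}}"
  have im: "doubles = ?f ` ?A"
  proof (intro equalityI subsetI)
    fix T assume "T \<in> doubles"
    then obtain x y x' y' where T: "T = {{x, y}, {x', y'}}" "{x, y} \<in> edges" "{x', y'} \<in> edges"
      "x \<noteq> x'" "y \<noteq> y'" "cell x = cell x'" "cell y = cell y'" "cell x \<noteq> cell y"
      by (rule double_cases)
    then have "((x, x'), (y, y')) \<in> ?A"
      unfolding double_tuples_def mates_def by (auto simp: doubleton_in_edges allowed_def)
    then show "T \<in> ?f ` ?A" using T(1) by (intro image_eqI[of _ _ "((x, x'), (y, y'))"]) simp_all
  next
    fix T assume "T \<in> ?f ` ?A"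
    then obtain x x' y y' where T: "T = {{x, y}, {x', y'}}" and A: "((x, x'), (y, y')) \<in> ?A" by auto
    from A have "{x, y} \<in> edges" "{x', y'} \<in> edges" "x \<noteq> x'" "y \<noteq> y'" "cell x = cell x'"
      "cell y = cell y'" "cell x \<noteq> cell y"
      unfolding double_tuples_def mates_def by (auto simp: doubleton_in_edges allowed_def)
    then show "T \<in> doubles" unfolding doubles_def using T by blast
  qed
  moreover have "card ?A = 4 * card (?f ` ?A)"
  proof (rule card_uniform_fibres)
    show "finite ?A" using finite_double_tuples by (rule rev_finite_subset) auto
    fix a assume a: "a \<in> ?A"
    then obtain x x' y y' where xy: "a = ((x, x'), (y, y'))" by auto
    have n: "x \<noteq> x'" "y \<noteq> y'" "x \<noteq> y" "x' \<noteq> y'" "x \<noteq> y'" "x' \<noteq> y"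
      using a xy unfolding double_tuples_def mates_def by auto
    let ?R = "{((x, x'), (y, y')), ((x', x), (y', y)), ((y, y'), (x, x')), ((y', y), (x', x))}"
    have "{z \<in> ?A. ?f z = ?f a} = ?R"
    proof (intro equalityI subsetI)
      fix z assume z: "z \<in> {z \<in> ?A. ?f z = ?f a}"
      then obtain u u' v v' where uv: "z = ((u, u'), (v, v'))" by auto
      have cells: "cell u = cell u'" "cell v = cell v'" "cell u \<noteq> cell v"
        "cell x = cell x'" "cell y = cell y'" "cell x \<noteq> cell y"
      proof -
        have "z \<in> ?A" using CollectD[OF z] by (rule conjunct1)
        then have "((u, u'), (v, v')) \<in> ?A" unfolding uv .
        then show "cell u = cell u'" "cell v = cell v'" "cell u \<noteq> cell v"
          by (auto simp: double_tuples_def mates_def)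
        show "cell x = cell x'" "cell y = cell y'" "cell x \<noteq> cell y"
          using a unfolding xy by (auto simp: double_tuples_def mates_def)
      qed
      have "?f z = ?f a" using CollectD[OF z] by (rule conjunct2)
      then have eq: "{{u, v}, {u', v'}} = {{x, y}, {x', y'}}" unfolding uv xy by simp
      \<comment> \<open>Since the two cells differ, both pairs must be read in the same direction; a
        mixed reading would put cell mates into different cells.\<close>
      then have "{u, v} = {x, y} \<and> {u', v'} = {x', y'} \<or> {u, v} = {x', y'} \<and> {u', v'} = {x, y}"
        by (simp add: doubleton_eq_iff)
      then show "z \<in> ?R"
      proof (elim disjE conjE)
        assume "{u, v} = {x, y}" "{u', v'} = {x', y'}"
        then show ?thesis unfolding uv using cells by (auto simp: doubleton_eq_iff)
      next
        assume "{u, v} = {x', y'}" "{u', v'} = {x, y}"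
        then show ?thesis unfolding uv using cells by (auto simp: doubleton_eq_iff)
      qed
    next
      fix z assume "z \<in> ?R"
      moreover have "?R \<subseteq> ?A"
        using a xy unfolding double_tuples_def mates_def by auto
      moreover have "?f w = ?f a" if "w \<in> ?R" for w
      proof -
        have "{{x, y}, {x', y'}} = {{x', y'}, {x, y}}" "{y, x} = {x, y}" "{y', x'} = {x', y'}"
          by (rule insert_commute)+
        with that show ?thesis unfolding xy by (elim insertE) simp_all
      qed
      ultimately show "z \<in> {z \<in> ?A. ?f z = ?f a}" by blast
    qed
    moreover have "card ?R = 4" using n by simp
    ultimately show "card {z \<in> ?A. ?f z = ?f a} = 4" by simp
  qed
  ultimately show ?thesis by simp
qed

text \<open>The surplus tuples have all four points in one cell: at most \<open>2 * N\<close>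
  choices for the first and \<open>r\<close> for each of the others.\<close>

lemma card_double_tuples_bounds:
  "4 * card doubles \<le> card double_tuples"
  "card double_tuples \<le> 4 * card doubles + 2 * N * r ^ 3"
proof -
  let ?A = "{((x, x'), (y, y')) \<in> double_tuples. cell x \<noteq> cell y}"
  let ?B = "{((x, x'), (y, y')) \<in> double_tuples. cell x = cell y}"
  show "4 * card doubles \<le> card double_tuples"
    unfolding card_separated_tuples[symmetric] using finite_double_tuples by (intro card_mono) auto
  let ?c = "\<lambda>x. {y \<in> P. cell y = cell x}"
  let ?D = "SIGMA x:P. ?c x \<times> ?c x \<times> ?c x"
  have finD: "finite ?D" using finite_points by (intro finite_SigmaI) auto
  have "card ?D = (\<Sum>x\<in>P. card (?c x \<times> ?c x \<times> ?c x))"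
    using finite_points by (intro card_SigmaI) auto
  also have "\<dots> \<le> (\<Sum>x\<in>P. r * (r * r))"
    unfolding card_cartesian_product using cell_le by (intro sum_mono mult_le_mono) auto
  also have "\<dots> = 2 * N * r ^ 3" using card_points by (simp add: power3_eq_cube mult.assoc)
  finally have cD: "card ?D \<le> 2 * N * r ^ 3" .
  have "?B \<subseteq> (\<lambda>(x, x', y, y'). ((x, x'), (y, y'))) ` ?D"
  proof
    fix z assume z: "z \<in> ?B"
    then obtain x x' y y' where xy: "z = ((x, x'), (y, y'))" by auto
    have "(x, x', y, y') \<in> ?D" using z xy unfolding double_tuples_def mates_def by auto
    then show "z \<in> (\<lambda>(x, x', y, y'). ((x, x'), (y, y'))) ` ?D"
      using xy by (intro image_eqI[of _ _ "(x, x', y, y')"]) simp_all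
  qed
  then have "card ?B \<le> card ((\<lambda>(x, x', y, y'). ((x, x'), (y, y'))) ` ?D)"
    using finD by (intro card_mono) auto
  also have "\<dots> \<le> card ?D" using finD by (rule card_image_le)
  finally have cB: "card ?B \<le> 2 * N * r ^ 3" using cD by simp
  have "double_tuples = ?A \<union> ?B" by auto
  then have "card double_tuples = card (?A \<union> ?B)" by simp
  also have "\<dots> \<le> card ?A + card ?B" by (rule card_Un_le)
  finally have "card double_tuples \<le> card ?A + card ?B" .
  then show "card double_tuples \<le> 4 * card doubles + 2 * N * r ^ 3"
    unfolding card_separated_tuples using cB by linarith
qed

lemma card_double_tuples_undirected:
  assumes undirected
  shows "card loop_pairs = card mates" "card double_tuples = (card mates)\<^sup>2"
proof -
  show "card loop_pairs = card mates" using assms unfolding loop_pairs_def by simp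
  have "double_tuples = mates \<times> mates" using assms unfolding double_tuples_def by auto
  then show "card double_tuples = (card mates)\<^sup>2"
    by (simp add: card_cartesian_product power2_eq_square)
qed

definition coloured_mates :: "bool \<Rightarrow> bool \<Rightarrow> ('p \<times> 'p) set" where
  "coloured_mates a b = {(x, y) \<in> mates. col x = a \<and> col y = b}"

text \<open>The colours of \<open>x\<close> and \<open>x'\<close> force the opposite colours on
  \<open>y\<close> and \<open>y'\<close>. The four colour patterns give two equal products of each
  kind: equal colours are parallel arcs, mixed colours antiparallel ones.\<close>

lemma card_double_tuples_directed:
  assumes "\<not> undirected"
  shows "card loop_pairs = card (coloured_mates True False) + card (coloured_mates False True)"
    "card double_tuples =
       2 * (card (coloured_mates True True) * card (coloured_mates False False)) +
       2 * (card (coloured_mates True False) * card (coloured_mates False True))"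
proof -
  have fin: "finite (coloured_mates a b)" for a b
    by (rule finite_subset[OF _ finite_mates]) (auto simp: coloured_mates_def)
  have "loop_pairs = coloured_mates True False \<union> coloured_mates False True"
    using assms unfolding loop_pairs_def coloured_mates_def by auto
  moreover have dj: "coloured_mates a b \<inter> coloured_mates a' b' = {}" if "(a, b) \<noteq> (a', b')" for a b a' b'
    using that unfolding coloured_mates_def by auto
  ultimately show "card loop_pairs = card (coloured_mates True False) + card (coloured_mates False True)"
    using fin by (simp add: card_Un_disjoint)
  let ?c = coloured_mates
  have "double_tuples = (\<Union>(a, b)\<in>UNIV. ?c a b \<times> ?c (\<not> a) (\<not> b))"
    using assms unfolding double_tuples_def coloured_mates_def by auto
  also have "card \<dots> = (\<Sum>(a, b)\<in>UNIV. card (?c a b \<times> ?c (\<not> a) (\<not> b)))"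
    unfolding case_prod_beta
  proof (rule card_UN_disjoint)
    show "\<forall>i\<in>UNIV. finite (?c (fst i) (snd i) \<times> ?c (\<not> fst i) (\<not> snd i))" using fin by auto
    show "\<forall>i\<in>UNIV. \<forall>j\<in>UNIV. i \<noteq> j \<longrightarrow> (?c (fst i) (snd i) \<times> ?c (\<not> fst i) (\<not> snd i)) \<inter>
        (?c (fst j) (snd j) \<times> ?c (\<not> fst j) (\<not> snd j)) = {}"
      using dj by (metis Sigma_empty1 Times_Int_Times prod.collapse)
  qed simp
  also have "(UNIV :: (bool \<times> bool) set) = {(True, True), (True, False), (False, True), (False, False)}"
    by auto
  finally show "card double_tuples = 2 * (card (?c True True) * card (?c False False)) +
       2 * (card (?c True False) * card (?c False True))"
    by (simp add: card_cartesian_product)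
qed

section \<open>Leading term of the expected number of forbidden configurations\<close>

lemma pr_1: "pr 1 = 1 / (real mult * (real N - 1) + 1)"
  using N_ge by (simp add: pr_def of_nat_diff)

lemma pr_2: "pr 2 = pr 1 / (real mult * (real N - 2) + 1)"
  using pr_Suc[of 1] N_ge by (simp add: numeral_2_eq_2 of_nat_diff)

text \<open>The exact values are 1/(2N - 1) and 1/((2N - 1)(2N - 3)) in the complete graph, 1/N and
  1/(N(N - 1)) in the bipartite one.\<close>

lemma pr_approx:
  defines "u \<equiv> 1 / (real mult * real N)"
  shows "u \<le> pr 1" "pr 1 \<le> u + 2 / (real N)\<^sup>2" "u\<^sup>2 \<le> pr 2" "pr 2 \<le> u\<^sup>2 + 8 / real N ^ 3"
    "0 \<le> u" "u \<le> 1 / real N"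
proof -
  define n where "n = real N"
  have n: "n \<ge> 1000" using N_ge unfolding n_def by simp
  have n2: "n * n \<ge> 1000 * n" using n by (intro mult_right_mono) auto
  have "(u \<le> pr 1 \<and> pr 1 \<le> u + 2 / n\<^sup>2) \<and> (u\<^sup>2 \<le> pr 2 \<and> pr 2 \<le> u\<^sup>2 + 8 / n ^ 3) \<and> 0 \<le> u \<and> u \<le> 1 / n"
  proof (cases undirected)
    case True
    then have m: "real mult = 2" unfolding mult_def by simp
    have p1: "pr 1 = 1 / (2 * n - 1)" unfolding pr_1 m n_def by (simp add: algebra_simps)
    have p2: "pr 2 = 1 / ((2 * n - 1) * (2 * n - 3))"
      unfolding pr_2 p1 m n_def by (simp add: algebra_simps)
    have u: "u = 1 / (2 * n)" unfolding u_def m n_def by simp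
    have d1: "1 / (2 * n - 1) - 1 / (2 * n) = 1 / (2 * n * (2 * n - 1))"
      using n by (simp add: field_simps)
    have d2: "1 / ((2 * n - 1) * (2 * n - 3)) - (1 / (2 * n))\<^sup>2 =
        (8 * n - 3) / (4 * n\<^sup>2 * ((2 * n - 1) * (2 * n - 3)))"
      using n by (simp add: divide_simps power2_eq_square) (simp add: algebra_simps)
    have b1: "1 / (2 * n * (2 * n - 1)) \<le> 1 / (n * n / 2)"
    proof (rule divide_left_mono)
      have "2 * n * (2 * n - 1) = 4 * (n * n) - 2 * n" by (simp add: algebra_simps)
      then show "n * n / 2 \<le> 2 * n * (2 * n - 1)" using n2 n by linarith
    qed (use n in \<open>auto intro!: mult_pos_pos\<close>)
    have "n * n \<le> (2 * n - 1) * (2 * n - 3)"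
    proof -
      have "(2 * n - 1) * (2 * n - 3) = 4 * (n * n) - 8 * n + 3" by (simp add: algebra_simps)
      then show ?thesis using n2 n by linarith
    qed
    then have "4 * n\<^sup>2 * (n * n) \<le> 4 * n\<^sup>2 * ((2 * n - 1) * (2 * n - 3))"
      by (intro mult_left_mono) auto
    then have b2: "(8 * n - 3) / (4 * n\<^sup>2 * ((2 * n - 1) * (2 * n - 3))) \<le> (8 * n) / (4 * n\<^sup>2 * (n * n))"
      using n by (intro frac_le) auto
    have e2: "(8 * n) / (4 * n\<^sup>2 * (n * n)) = 2 / n ^ 3"
      using n by (simp add: field_simps power2_eq_square power3_eq_cube)
    have "0 \<le> 1 / (2 * n * (2 * n - 1))" "0 \<le> (8 * n - 3) / (4 * n\<^sup>2 * ((2 * n - 1) * (2 * n - 3)))"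
      using n by (auto intro!: divide_nonneg_nonneg mult_nonneg_nonneg)
    moreover have "1 / (n * n / 2) = 2 / n\<^sup>2" by (simp add: power2_eq_square)
    moreover have "2 / n ^ 3 \<le> 8 / n ^ 3" using n by (intro divide_right_mono) auto
    moreover have "0 \<le> 1 / (2 * n)" "1 / (2 * n) \<le> 1 / n"
      using n by (auto intro!: divide_left_mono)
    ultimately show ?thesis unfolding p1 p2 u
      using d1 d2 b1 b2 e2 by (intro conjI) linarith+
  next
    case False
    then have m: "real mult = 1" unfolding mult_def by simp
    have p1: "pr 1 = 1 / n" unfolding pr_1 m n_def by (simp add: algebra_simps)
    have p2: "pr 2 = 1 / (n * (n - 1))"
      unfolding pr_2 p1 m n_def by (simp add: algebra_simps)
    have u: "u = 1 / n" unfolding u_def m n_def by simp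
    have d2: "1 / (n * (n - 1)) - (1 / n)\<^sup>2 = 1 / (n\<^sup>2 * (n - 1))"
      using n by (simp add: divide_simps power2_eq_square)
    have "1 / (n\<^sup>2 * (n - 1)) \<le> 1 / (n\<^sup>2 * (n / 8))"
      using n by (intro divide_left_mono mult_left_mono) (auto intro!: mult_pos_pos)
    moreover have "1 / (n\<^sup>2 * (n / 8)) = 8 / n ^ 3" by (simp add: power2_eq_square power3_eq_cube)
    moreover have "0 \<le> 1 / (n\<^sup>2 * (n - 1))" using n by (auto intro!: divide_nonneg_nonneg)
    moreover have "0 \<le> 1 / n" "0 \<le> 2 / n\<^sup>2" using n by auto
    ultimately show ?thesis unfolding p1 p2 u using d2 by (intro conjI) linarith+
  qed
  then show "u \<le> pr 1" "pr 1 \<le> u + 2 / (real N)\<^sup>2" "u\<^sup>2 \<le> pr 2" "pr 2 \<le> u\<^sup>2 + 8 / real N ^ 3"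
    "0 \<le> u" "u \<le> 1 / real N" unfolding n_def by auto
qed

text \<open>There are three errors, each O(r^3/N): \<open>pr 1\<close> against \<open>u\<close> on
  at most \<open>2 * N * r\<close> loops (4 r/N), \<open>pr 2\<close> against \<open>u^2\<close> on
  at most \<open>(2 * N * r)^2\<close> double edges (32 r^2/N), and the surplus tuples
  (r^3/(2N)).\<close>

lemma Lambda_approx:
  defines "u \<equiv> 1 / (real mult * real N)"
  shows "\<bar>Lambda - (real (card loop_pairs) / 2 * u + real (card double_tuples) / 4 * u\<^sup>2)\<bar>
           \<le> 37 * real r ^ 3 / real N"
proof -
  note pa = pr_approx[folded u_def]
  define n where "n = real N"
  define L where "L = real (card loops)"
  define W where "W = real (card doubles)"
  define W4 where "W4 = real (card double_tuples)"
  define R where "R = real r"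
  have n: "n \<ge> 1000" using N_ge unfolding n_def by simp
  have R: "R \<ge> 1" using r_pos unfolding R_def by simp
  have R12: "R \<le> R ^ 3" "R\<^sup>2 \<le> R ^ 3"
    using power_increasing[of 1 3 R] power_increasing[of 2 3 R] R by auto
  have pL: "real (card loop_pairs) / 2 = L" unfolding L_def card_loop_pairs by simp
  have L: "0 \<le> L" "L \<le> 2 * n * R"
    using of_nat_mono[OF card_loops_le, where 'a = real] unfolding L_def n_def R_def by simp_all
  have W: "0 \<le> W" "W \<le> (2 * n * R) * (2 * n * R)"
    using of_nat_mono[OF card_doubles_le, where 'a = real] unfolding W_def n_def R_def by simp_all
  have W4: "4 * W \<le> W4" "W4 \<le> 4 * W + 2 * n * R ^ 3"
    using of_nat_mono[OF card_double_tuples_bounds(1), where 'a = real]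
      of_nat_mono[OF card_double_tuples_bounds(2), where 'a = real]
    unfolding W_def W4_def n_def R_def by simp_all
  have d1: "0 \<le> pr 1 - u" "pr 1 - u \<le> 2 / n\<^sup>2" and d2: "0 \<le> pr 2 - u\<^sup>2" "pr 2 - u\<^sup>2 \<le> 8 / n ^ 3"
    using pa(1-4) unfolding n_def by linarith+
  have t1: "0 \<le> L * (pr 1 - u)" "L * (pr 1 - u) \<le> (2 * n * R) * (2 / n\<^sup>2)"
    using L(1) d1(1) mult_mono[OF L(2) d1(2)] n R by simp_all
  have t2: "0 \<le> W * (pr 2 - u\<^sup>2)" "W * (pr 2 - u\<^sup>2) \<le> ((2 * n * R) * (2 * n * R)) * (8 / n ^ 3)"
    using W(1) d2(1) mult_mono[OF W(2) d2(2)] n R by simp_all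
  have u2: "u\<^sup>2 \<le> (1 / n)\<^sup>2" using pa(5,6) unfolding n_def by (intro power_mono) auto
  have t3: "0 \<le> (W4 / 4 - W) * u\<^sup>2" "(W4 / 4 - W) * u\<^sup>2 \<le> (n * R ^ 3 / 2) * (1 / n)\<^sup>2"
  proof -
    have d: "0 \<le> W4 / 4 - W" "W4 / 4 - W \<le> n * R ^ 3 / 2" using W4 by linarith+
    show "0 \<le> (W4 / 4 - W) * u\<^sup>2" using d(1) by simp
    show "(W4 / 4 - W) * u\<^sup>2 \<le> (n * R ^ 3 / 2) * (1 / n)\<^sup>2"
      using d u2 n R by (intro mult_mono) auto
  qed
  have e1: "(2 * n * R) * (2 / n\<^sup>2) = 4 * (R / n)"
    using n by (simp add: field_simps power2_eq_square)
  have e2: "((2 * n * R) * (2 * n * R)) * (8 / n ^ 3) = 32 * (R\<^sup>2 / n)"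
    using n by (simp add: field_simps power2_eq_square power3_eq_cube)
  have e3: "(n * R ^ 3 / 2) * (1 / n)\<^sup>2 = (R ^ 3 / n) / 2"
    using n by (simp add: field_simps power2_eq_square)
  have "R / n \<le> R ^ 3 / n" "R\<^sup>2 / n \<le> R ^ 3 / n" "0 \<le> R ^ 3 / n"
    using R12 n R by (auto intro!: divide_right_mono)
  moreover have "Lambda - (L * u + W4 / 4 * u\<^sup>2) =
      L * (pr 1 - u) + W * (pr 2 - u\<^sup>2) - (W4 / 4 - W) * u\<^sup>2"
    unfolding Lambda_def L_def[symmetric] W_def[symmetric] by (simp add: algebra_simps)
  moreover have "\<bar>a + b - c\<bar> \<le> 37 * q"
    if "0 \<le> a" "a \<le> 4 * x" "0 \<le> b" "b \<le> 32 * y" "0 \<le> c" "c \<le> q / 2" "x \<le> q" "y \<le> q" "0 \<le> q"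
    for a b c x y q :: real
    using that by linarith
  ultimately have "\<bar>Lambda - (L * u + W4 / 4 * u\<^sup>2)\<bar> \<le> 37 * (R ^ 3 / n)"
    using t1 t2 t3 unfolding e1 e2 e3 by presburger
  then show ?thesis unfolding pL W4_def R_def n_def by simp
qed

end

section \<open>Graphs and digraphs with given degrees\<close>

text \<open>Any bijection between the two halves is a perfect matching.\<close>

lemma (in matching_model) matchings_nonempty:
  assumes XY: "X \<union> Y = P" "X \<inter> Y = {}" "card X = card Y"
    and al: "\<And>x y. x \<in> X \<Longrightarrow> y \<in> Y \<Longrightarrow> undirected \<or> col x \<noteq> col y"
  shows "matchings \<noteq> {}"
proof -
  have fin: "finite X" "finite Y" using XY finite_points by auto
  obtain h where h: "bij_betw h X Y" using finite_same_card_bij[OF fin XY(3)] by auto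
  have hY: "h x \<in> Y" if "x \<in> X" for x using h that unfolding bij_betw_def by auto
  let ?M = "(\<lambda>x. {x, h x}) ` X"
  have "?M \<subseteq> edges"
  proof
    fix e assume "e \<in> ?M"
    then obtain x where x: "x \<in> X" "e = {x, h x}" by auto
    moreover have "x \<noteq> h x" using hY[OF x(1)] x(1) XY(2) by auto
    ultimately show "e \<in> edges"
      using hY[OF x(1)] al[of x "h x"] XY(1) by (auto simp: doubleton_in_edges allowed_def)
  qed
  moreover have "disjoint ?M"
  proof -
    have "{x, h x} \<inter> {y, h y} = {}" if "x \<in> X" "y \<in> X" "{x, h x} \<noteq> {y, h y}" for x y
    proof -
      have "x \<noteq> y" using that by auto
      moreover from this have "h x \<noteq> h y" using h that unfolding bij_betw_def by (auto dest: inj_onD)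
      ultimately show ?thesis using hY that(1,2) XY(2) by auto
    qed
    then show ?thesis unfolding disjoint_def by (simp add: ball_simps)
  qed
  moreover have "\<Union>?M = P"
  proof -
    have "\<Union>?M = X \<union> h ` X" by auto
    then show ?thesis using h XY(1) unfolding bij_betw_def by simp
  qed
  ultimately show ?thesis unfolding matchings_def by blast
qed

lemma card_off_diagonal:
  assumes "finite A"
  shows "card {(x, y). x \<in> A \<and> y \<in> A \<and> x \<noteq> y} = card A * (card A - 1)"
proof -
  have "{(x, y). x \<in> A \<and> y \<in> A \<and> x \<noteq> y} = (SIGMA x:A. A - {x})" by auto
  then have "card {(x, y). x \<in> A \<and> y \<in> A \<and> x \<noteq> y} = (\<Sum>x\<in>A. card (A - {x}))"
    using assms by simp
  also have "\<dots> = (\<Sum>x\<in>A. card A - 1)" using assms by (intro sum.cong) auto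
  finally show ?thesis by simp
qed

context celled_matching_model
begin

lemma card_mates:
  assumes S: "finite S" "cell ` P \<subseteq> S"
  shows "card mates = (\<Sum>v\<in>S. card {x \<in> P. cell x = v} * (card {x \<in> P. cell x = v} - 1))"
proof -
  let ?F = "\<lambda>v. {x \<in> P. cell x = v}"
  have "mates = (\<Union>v\<in>S. {(x, y). x \<in> ?F v \<and> y \<in> ?F v \<and> x \<noteq> y})"
    using S(2) unfolding mates_def by auto
  then have "card mates = card (\<Union>v\<in>S. {(x, y). x \<in> ?F v \<and> y \<in> ?F v \<and> x \<noteq> y})" by simp
  also have "\<dots> = (\<Sum>v\<in>S. card {(x, y). x \<in> ?F v \<and> y \<in> ?F v \<and> x \<noteq> y})"
  proof (rule card_UN_disjoint[OF S(1)])
    show "\<forall>v\<in>S. finite {(x, y). x \<in> ?F v \<and> y \<in> ?F v \<and> x \<noteq> y}"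
    proof
      fix v
      show "finite {(x, y). x \<in> ?F v \<and> y \<in> ?F v \<and> x \<noteq> y}"
        by (rule finite_subset[of _ "P \<times> P"]) (auto simp: finite_points)
    qed
  qed auto
  also have "\<dots> = (\<Sum>v\<in>S. card (?F v) * (card (?F v) - 1))"
    using finite_cell by (intro sum.cong card_off_diagonal) auto
  finally show ?thesis .
qed

lemma card_coloured_mates:
  assumes S: "finite S" "cell ` P \<subseteq> S"
  defines "F \<equiv> \<lambda>v c. {x \<in> P. cell x = v \<and> col x = c}"
  shows "card (coloured_mates a b) =
    (\<Sum>v\<in>S. if a = b then card (F v a) * (card (F v a) - 1) else card (F v a) * card (F v b))"
proof -
  let ?A = "\<lambda>v. {(x, y). x \<in> F v a \<and> y \<in> F v b \<and> x \<noteq> y}"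
  have fin: "finite (F v c)" for v c unfolding F_def using finite_points by simp
  have "coloured_mates a b = (\<Union>v\<in>S. ?A v)"
    using S(2) unfolding mates_def coloured_mates_def F_def by auto
  then have "card (coloured_mates a b) = card (\<Union>v\<in>S. ?A v)" by simp
  also have "\<dots> = (\<Sum>v\<in>S. card (?A v))"
  proof (rule card_UN_disjoint[OF S(1)])
    show "\<forall>v\<in>S. finite (?A v)"
    proof
      fix v
      show "finite (?A v)"
        by (rule finite_subset[of _ "P \<times> P"]) (auto simp: finite_points F_def)
    qed
  qed (auto simp: F_def)
  also have "\<dots> = (\<Sum>v\<in>S. if a = b then card (F v a) * (card (F v a) - 1)
      else card (F v a) * card (F v b))"
  proof (rule sum.cong[OF refl])
    fix v
    show "card (?A v) =
      (if a = b then card (F v a) * (card (F v a) - 1) else card (F v a) * card (F v b))"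
    proof (cases "a = b")
      case True
      then show ?thesis using card_off_diagonal[OF fin[of v a]] by simp
    next
      case False
      then have "?A v = F v a \<times> F v b" unfolding F_def by auto
      then show ?thesis using False by (simp add: card_cartesian_product)
    qed
  qed
  finally show ?thesis .
qed

lemma simple_matchings_asymptotics:
  assumes "matchings \<noteq> {}"
  defines "u \<equiv> 1 / (real mult * real N)"
  shows "\<exists>\<epsilon>. \<bar>\<epsilon>\<bar> \<le> 5000 * real r ^ 4 / real N \<and>
    real (card (avoiders bad {})) = (\<Prod>j<N. real (mult * j + 1)) *
      exp (- (real (card loop_pairs) / 2 * u + real (card double_tuples) / 4 * u\<^sup>2) + \<epsilon>)"
proof -
  let ?L = "real (card loop_pairs) / 2 * u + real (card double_tuples) / 4 * u\<^sup>2"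
  obtain \<epsilon> where e: "\<bar>\<epsilon>\<bar> \<le> 4640 * real r ^ 4 / real N"
    "real (card (avoiders bad {})) = real (card matchings) * exp (- Lambda + \<epsilon>)"
    using simple_matchings_estimate[OF assms(1)] by blast
  have "real r ^ 3 \<le> real r ^ 4" using r_pos by (intro power_increasing) auto
  then have "37 * real r ^ 3 / real N \<le> 37 * real r ^ 4 / real N" by (intro divide_right_mono) auto
  moreover have "\<bar>Lambda - ?L\<bar> \<le> 37 * real r ^ 3 / real N" using Lambda_approx unfolding u_def .
  moreover have "4640 * real r ^ 4 / real N + 37 * real r ^ 4 / real N \<le> 5000 * real r ^ 4 / real N"
    by (simp add: divide_right_mono flip: add_divide_distrib)
  ultimately have "\<bar>\<epsilon> - (Lambda - ?L)\<bar> \<le> 5000 * real r ^ 4 / real N"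
    using e(1) by linarith
  moreover have "- Lambda + \<epsilon> = - ?L + (\<epsilon> - (Lambda - ?L))" by simp
  moreover have "real (card matchings) = (\<Prod>j<N. real (mult * j + 1))"
    using card_matchings[OF assms(1)] by simp
  ultimately show ?thesis using e(2) by (intro exI[of _ "\<epsilon> - (Lambda - ?L)"]) (simp only:)
qed

end

lemma finite_graphs_with_degrees: "finite (graphs_with_degrees n d)"
  by (rule finite_subset[of _ "Pow (nsets {1..n} 2)"])
    (auto simp: graphs_with_degrees_def finite_imp_finite_nsets)

text \<open>A point is a vertex with an index below its degree; sites and cells are both the
  vertices. Double tuples are pairs of \<open>mates\<close>, whence the square of
  \<open>A\<close>.\<close>

lemma card_graphs_asymptotics:
  assumes deg: "(\<Sum>v=1..n. d v) = 2 * N" and r: "\<And>v. v \<in> {1..n} \<Longrightarrow> d v \<le> r" "r \<ge> 1"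
    and N: "N \<ge> 1000 * r\<^sup>2"
  defines "A \<equiv> real (\<Sum>v=1..n. d v * (d v - 1))"
  shows "\<exists>\<epsilon>. \<bar>\<epsilon>\<bar> \<le> 5000 * real r ^ 4 / real N \<and>
    real (card (graphs_with_degrees n d)) * (\<Prod>v=1..n. fact (d v)) =
      (\<Prod>j<N. real (2 * j + 1)) *
      exp (- (A / 2 * (1 / (2 * real N)) + A\<^sup>2 / 4 * (1 / (2 * real N))\<^sup>2) + \<epsilon>)"
proof -
  define P where "P = (SIGMA v:{1..n}. {..<d v})"
  have mem: "x \<in> P \<Longrightarrow> fst x \<in> {1..n}" for x unfolding P_def by auto
  have fib: "{y \<in> P. fst y = v} = (if v \<in> {1..n} then {v} \<times> {..<d v} else {})" for v
    unfolding P_def by auto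
  have cfib: "card {y \<in> P. fst y = v} = (if v \<in> {1..n} then d v else 0)" for v
    unfolding fib by (simp add: card_cartesian_product)
  have finP: "finite P" unfolding P_def by auto
  have cardP: "card P = 2 * N" unfolding P_def using deg by (simp add: card_SigmaI)
  interpret celled_matching_model P True "\<lambda>_. True" fst N r
  proof
    show "card {y \<in> P. fst y = v} \<le> r" for v using r cfib[of v] by auto
  qed (use r N finP cardP in auto)
  have m2: "mult = 2" by (simp add: mult_def)
  have ne: "matchings \<noteq> {}"
  proof -
    have "N \<le> card P" using cardP by simp
    then obtain X where X: "X \<subseteq> P" "card X = N" by (rule obtain_subset_with_card_n)
    show ?thesis
    proof (rule matchings_nonempty[of X "P - X"])
      show "card X = card (P - X)"
        using X card_points finite_points by (subst card_Diff_subset) (auto intro: finite_subset)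
    qed (use X in auto)
  qed
  have two: "card g = 2" if "G \<in> graphs_with_degrees n d" "g \<in> G" for G g
    using that unfolding graphs_with_degrees_def nsets_def by auto
  have "card (avoiders bad {}) = card (graphs_with_degrees n d) *
      (\<Prod>s\<in>{1..n}. fact (card {x \<in> P. fst x = s}))"
  proof (rule card_avoiders_bad[where \<tau> = "\<lambda>v. v"])
    fix M assume M: "M \<in> avoiders bad {}"
    have MM: "M \<in> matchings" using M unfolding avoiders_def by auto
    have conf: "M \<in> configurations P fst ((`) fst ` M)"
      by (rule avoiders_bad_configuration[OF M, of "\<lambda>v. v"]) simp
    have sub: "(`) fst ` M \<subseteq> nsets {1..n} 2"
    proof
      fix g assume "g \<in> (`) fst ` M"
      then obtain e where e: "e \<in> M" "g = fst ` e" by auto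
      obtain x y where xy: "e = {x, y}" "x \<in> P" "y \<in> P"
        using matching_edges[OF MM e(1)] by (rule edge_cases)
      then have "fst x \<noteq> fst y" using avoiders_bad_cells[OF M] e(1) by blast
      then show "g \<in> nsets {1..n} 2"
        using mem[OF xy(2)] mem[OF xy(3)] xy(1) e(2) by (auto simp: nsets_def)
    qed
    then have "card {g \<in> (`) fst ` M. v \<in> g} = d v" if "v \<in> {1..n}" for v
    proof -
      have "card g = 2" if "g \<in> (`) fst ` M" for g using sub that unfolding nsets_def by blast
      then show ?thesis
        using configurations_degree[OF conf finite_points, of v] unfolding cfib using that by simp
    qed
    then show "(`) fst ` M \<in> graphs_with_degrees n d"
      using sub unfolding graphs_with_degrees_def vertex_degree_def by auto
  next
    fix G M assume G: "G \<in> graphs_with_degrees n d" and M: "M \<in> configurations P fst G"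
    show "M \<in> avoiders bad {}"
    proof (rule configuration_avoiders_bad[OF M, where \<tau> = "\<lambda>v. v"])
      fix s t assume "{s, t} \<in> G"
      then show "s \<noteq> t" using two[OF G, of "{s, t}"] by auto
    qed auto
  next
    fix G assume G: "G \<in> graphs_with_degrees n d"
    show "finite G" using G finite_imp_finite_nsets[of "{1..n}" 2] finite_subset
      unfolding graphs_with_degrees_def by auto
    fix s
    show "card {x \<in> P. fst x = s} = card {g \<in> G. s \<in> g}"
    proof (cases "s \<in> {1..n}")
      case True
      then show ?thesis using G cfib[of s] unfolding graphs_with_degrees_def vertex_degree_def by auto
    next
      case False
      moreover have "g \<subseteq> {1..n}" if "g \<in> G" for g
        using G that unfolding graphs_with_degrees_def nsets_def by blast
      ultimately have "{g \<in> G. s \<in> g} = {}" by blast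
      then show ?thesis using False cfib[of s] by (simp only: card.empty if_False)
    qed
  qed (use two finite_graphs_with_degrees mem in auto)
  also have "(\<Prod>s\<in>{1..n}. fact (card {x \<in> P. fst x = s})) = (\<Prod>v=1..n. fact (d v) :: nat)"
    using cfib by (intro prod.cong) auto
  finally have card_eq: "real (card (avoiders bad {})) =
      real (card (graphs_with_degrees n d)) * (\<Prod>v=1..n. fact (d v))" by simp
  have "card mates = (\<Sum>v\<in>{1..n}. card {x \<in> P. fst x = v} * (card {x \<in> P. fst x = v} - 1))"
    by (rule card_mates) (use mem in auto)
  also have "\<dots> = (\<Sum>v=1..n. d v * (d v - 1))" using cfib by (intro sum.cong) auto
  finally have cm: "real (card mates) = A" unfolding A_def by simp
  show ?thesis
    using simple_matchings_asymptotics[OF ne] card_double_tuples_undirected cm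
    unfolding card_eq m2 by simp
qed

text \<open>These are the orientations of simple graphs: an arc and its reverse would lie over the
  same edge.\<close>

definition digraphs_with_degrees :: "nat \<Rightarrow> (nat \<Rightarrow> nat) \<Rightarrow> (nat \<Rightarrow> nat) \<Rightarrow> (nat \<times> nat) set set" where
  "digraphs_with_degrees n a b = {A. A \<subseteq> {1..n} \<times> {1..n} \<and>
     (\<forall>u v. (u, v) \<in> A \<longrightarrow> u \<noteq> v \<and> (v, u) \<notin> A) \<and>
     (\<forall>v\<in>{1..n}. in_degree A v = a v \<and> out_degree A v = b v)}"

lemma finite_digraphs_with_degrees: "finite (digraphs_with_degrees n a b)"
  by (rule finite_subset[of _ "Pow ({1..n} \<times> {1..n})"]) (auto simp: digraphs_with_degrees_def)

text \<open>The out-points of \<open>v\<close> lie over the site \<open>(v, True)\<close>, its in-points over \<open>(v, False)\<close>.\<close>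

definition split_graph :: "(nat \<times> nat) set \<Rightarrow> (nat \<times> bool) set set" where
  "split_graph A = (\<lambda>(u, v). {(u, True), (v, False)}) ` A"

lemma split_edge_eq:
  "{(u, True), (v, False)} = {(u', True), (v', False)} \<longleftrightarrow> u = u' \<and> v = v'"
  by (auto simp: doubleton_eq_iff)

lemma split_graph_iff: "{(u, True), (v, False)} \<in> split_graph A \<longleftrightarrow> (u, v) \<in> A"
  unfolding split_graph_def by (auto simp: split_edge_eq image_iff)

lemma inj_split_graph: "inj split_graph"
  by (rule injI) (metis split_graph_iff subrelI subset_antisym)

lemma split_graph_degree:
  "card {g \<in> split_graph A. (v, True) \<in> g} = out_degree A v"
  "card {g \<in> split_graph A. (v, False) \<in> g} = in_degree A v"
proof -
  have "{g \<in> split_graph A. (v, True) \<in> g} = (\<lambda>w. {(v, True), (w, False)}) ` {w. (v, w) \<in> A}"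
    unfolding split_graph_def by auto
  then show "card {g \<in> split_graph A. (v, True) \<in> g} = out_degree A v"
    unfolding out_degree_def by (simp add: card_image inj_on_def split_edge_eq)
  have "{g \<in> split_graph A. (v, False) \<in> g} = (\<lambda>u. {(u, True), (v, False)}) ` {u. (u, v) \<in> A}"
    unfolding split_graph_def by auto
  then show "card {g \<in> split_graph A. (v, False) \<in> g} = in_degree A v"
    unfolding in_degree_def by (simp add: card_image inj_on_def split_edge_eq)
qed

text \<open>The site of a point is its vertex with a direction, the direction is its colour, and the
  cell is the vertex alone. This makes antiparallel arcs double edges, and it is the total degree
  \<open>a v + b v\<close> that \<open>r\<close> has to bound. In the exponent, \<open>C\<close>
  counts the possible loops, \<open>A * B\<close> the parallel and \<open>C\<^sup>2\<close> the
  antiparallel tuples, up to constant factors.\<close>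

lemma card_digraphs_asymptotics:
  assumes deg: "(\<Sum>v=1..n. a v) = N" "(\<Sum>v=1..n. b v) = N"
    and r: "\<And>v. v \<in> {1..n} \<Longrightarrow> a v + b v \<le> r" "r \<ge> 1"
    and N: "N \<ge> 1000 * r\<^sup>2"
  defines "A \<equiv> real (\<Sum>v=1..n. a v * (a v - 1))" and "B \<equiv> real (\<Sum>v=1..n. b v * (b v - 1))"
    and "C \<equiv> real (\<Sum>v=1..n. a v * b v)"
  shows "\<exists>\<epsilon>. \<bar>\<epsilon>\<bar> \<le> 5000 * real r ^ 4 / real N \<and>
    real (card (digraphs_with_degrees n a b)) * (\<Prod>v=1..n. fact (a v) * fact (b v)) =
      fact N * exp (- (C / real N + (A * B + C\<^sup>2) / 2 / (real N)\<^sup>2) + \<epsilon>)"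
proof -
  define m where "m s = (if snd s then b (fst s) else a (fst s))" for s :: "nat \<times> bool"
  let ?S = "{1..n} \<times> (UNIV :: bool set)"
  define P where "P = (SIGMA s:?S. {..<m s})"
  let ?cell = "\<lambda>x :: (nat \<times> bool) \<times> nat. fst (fst x)"
  let ?col = "\<lambda>x :: (nat \<times> bool) \<times> nat. snd (fst x)"
  have fib: "{y \<in> P. fst y = s} = (if fst s \<in> {1..n} then {s} \<times> {..<m s} else {})" for s
    unfolding P_def by (cases s) auto
  have mem: "x \<in> P \<Longrightarrow> ?cell x \<in> {1..n}" for x unfolding P_def by auto
  have cfib: "card {y \<in> P. fst y = s} = (if fst s \<in> {1..n} then m s else 0)" for s
    unfolding fib by (simp add: card_cartesian_product)
  have finP: "finite P" unfolding P_def by auto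
  have m_simps: "m (v, True) = b v" "m (v, False) = a v" for v by (simp_all add: m_def)
  have cell_split: "card {y \<in> P. ?cell y = v} =
      card {y \<in> P. fst y = (v, True)} + card {y \<in> P. fst y = (v, False)}" for v
  proof -
    have "{y \<in> P. ?cell y = v} = {y \<in> P. fst y = (v, True)} \<union> {y \<in> P. fst y = (v, False)}"
      by auto
    also have "card \<dots> = card {y \<in> P. fst y = (v, True)} + card {y \<in> P. fst y = (v, False)}"
      by (rule card_Un_disjoint) (use finP in auto)
    finally show ?thesis .
  qed
  have cardP: "card P = 2 * N"
  proof -
    have "card P = (\<Sum>s\<in>?S. m s)" unfolding P_def by (simp add: card_SigmaI)
    also have "\<dots> = (\<Sum>v\<in>{1..n}. \<Sum>c\<in>UNIV. m (v, c))" by (simp add: sum.cartesian_product)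
    also have "\<dots> = (\<Sum>v=1..n. a v) + (\<Sum>v=1..n. b v)" by (simp add: UNIV_bool sum.distrib m_simps)
    finally show ?thesis using deg by simp
  qed
  interpret celled_matching_model P False ?col ?cell N r
  proof
    show "card {y \<in> P. ?cell y = v} \<le> r" for v
      unfolding cell_split cfib using r(1)[of v] by (auto simp: add.commute m_simps)
  qed (use r N finP cardP in auto)
  have m1: "mult = 1" by (simp add: mult_def)
  have colour: "card {x \<in> P. ?col x = c} = N" for c
  proof -
    have "{x \<in> P. ?col x = c} = (\<Union>v\<in>{1..n}. {y \<in> P. fst y = (v, c)})"
      using mem by auto
    also have "card \<dots> = (\<Sum>v=1..n. card {y \<in> P. fst y = (v, c)})"
      using finP by (intro card_UN_disjoint) auto
    also have "\<dots> = N" unfolding cfib using deg by (cases c) (simp_all add: m_simps)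
    finally show ?thesis .
  qed
  have ne: "matchings \<noteq> {}"
    by (rule matchings_nonempty[of "{x \<in> P. ?col x = True}" "{x \<in> P. ?col x = False}"])
      (use colour[of True] colour[of False] in auto)
  let ?\<G> = "split_graph ` digraphs_with_degrees n a b"
  have "card (avoiders bad {}) = card ?\<G> * (\<Prod>s\<in>?S. fact (card {x \<in> P. fst x = s}))"
  proof (rule card_avoiders_bad[where \<tau> = fst])
    fix M assume M: "M \<in> avoiders bad {}"
    have MM: "M \<in> matchings" using M unfolding avoiders_def by auto
    let ?G = "(`) fst ` M"
    have conf: "M \<in> configurations P fst ?G"
      by (rule avoiders_bad_configuration[OF M, of fst]) simp
    have edge: "\<exists>x y. e = {x, y} \<and> x \<in> P \<and> y \<in> P \<and> ?col x \<and> \<not> ?col y \<and> ?cell x \<noteq> ?cell y"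
      if e: "e \<in> M" for e
    proof -
      obtain x y where xy: "e = {x, y}" "x \<in> P" "y \<in> P" "allowed x y"
        using matching_edges[OF MM e] by (rule edge_cases)
      have "?cell x \<noteq> ?cell y" using avoiders_bad_cells[OF M] e xy(1) by auto
      moreover have "?col x \<noteq> ?col y" using xy(4) unfolding allowed_def by auto
      ultimately have "?col x \<and> \<not> ?col y \<and> ?cell x \<noteq> ?cell y \<or>
          ?col y \<and> \<not> ?col x \<and> ?cell y \<noteq> ?cell x" by argo
      moreover have "e = {y, x}" using xy(1) by (simp add: insert_commute)
      ultimately show ?thesis using xy(1-3) by blast
    qed
    define D where "D = {(u, v). {(u, True), (v, False)} \<in> ?G}"
    have ex: "\<exists>x y. {x, y} \<in> M \<and> x \<in> P \<and> y \<in> P \<and> fst x = (u, True) \<and> fst y = (v, False) \<and> u \<noteq> v"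
      if uv: "(u, v) \<in> D" for u v
    proof -
      from uv obtain e where e: "e \<in> M" "fst ` e = {(u, True), (v, False)}" unfolding D_def by auto
      obtain x y where xy: "e = {x, y}" "x \<in> P" "y \<in> P" "?col x" "\<not> ?col y" "?cell x \<noteq> ?cell y"
        using edge[OF e(1)] by blast
      have "{fst x, fst y} = {(u, True), (v, False)}" using e(2) xy(1) by simp
      then have "fst x = (u, True) \<and> fst y = (v, False)"
        using xy(4,5) by (auto simp: doubleton_eq_iff)
      moreover from this have "u \<noteq> v" using xy(6) by simp
      moreover have "{x, y} \<in> M" using xy(1) e(1) by simp
      ultimately show ?thesis using xy(2,3) by blast
    qed
    have G: "?G = split_graph D"
    proof (intro equalityI subsetI)
      fix g assume g: "g \<in> ?G"
      then obtain e where e: "e \<in> M" "g = fst ` e" by auto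
      obtain x y where xy: "e = {x, y}" "?col x" "\<not> ?col y" using edge[OF e(1)] by blast
      obtain u k v l where "x = ((u, True), k)" "y = ((v, False), l)"
        using xy(2,3) by (metis prod.collapse)
      then have g': "g = {(u, True), (v, False)}" using e(2) xy(1) by simp
      then have "(u, v) \<in> D" using g unfolding D_def by simp
      then show "g \<in> split_graph D" using g' split_graph_iff by simp
    next
      fix g assume "g \<in> split_graph D"
      then show "g \<in> ?G" unfolding split_graph_def D_def by auto
    qed
    have two: "card g = 2" if "g \<in> ?G" for g
      using that unfolding G split_graph_def by (auto simp: card_insert_if)
    have "D \<in> digraphs_with_degrees n a b"
      unfolding digraphs_with_degrees_def
    proof (intro CollectI conjI allI impI ballI)
      show "D \<subseteq> {1..n} \<times> {1..n}"
      proof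
        fix w assume w: "w \<in> D"
        obtain u v where uv: "w = (u, v)" by (cases w)
        obtain x y where "x \<in> P" "y \<in> P" "fst x = (u, True)" "fst y = (v, False)"
          using ex[OF w[unfolded uv]] by blast
        then show "w \<in> {1..n} \<times> {1..n}" unfolding uv using mem[of x] mem[of y] by simp
      qed
    next
      fix u v assume uv: "(u, v) \<in> D"
      show "u \<noteq> v" using ex[OF uv] by blast
      show "(v, u) \<notin> D"
      proof
        assume vu: "(v, u) \<in> D"
        obtain x y where xy: "{x, y} \<in> M" "fst x = (u, True)" "fst y = (v, False)" "u \<noteq> v"
          using ex[OF uv] by blast
        obtain x' y' where xy': "{x', y'} \<in> M" "fst x' = (v, True)" "fst y' = (u, False)"
          using ex[OF vu] by blast
        \<comment> \<open>Read backwards, the second pair joins the same two cells in the same order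
          as the first, so avoidance of double edges identifies them.\<close>
        have "{y', x'} \<in> M" using xy'(1) by (simp add: insert_commute)
        then have "{x, y} = {y', x'}" using avoiders_bad_inj[OF M xy(1)] xy xy' by simp
        then have "x = y' \<or> x = x'" by auto
        then show False using xy xy' by auto
      qed
    next
      fix v assume v: "v \<in> {1..n}"
      show "in_degree D v = a v" "out_degree D v = b v"
        using configurations_degree[OF conf finite_points two, of "(v, False)"]
          configurations_degree[OF conf finite_points two, of "(v, True)"]
          cfib[of "(v, False)"] cfib[of "(v, True)"] v
        unfolding G split_graph_degree by (simp_all add: m_simps)
    qed
    then show "?G \<in> ?\<G>" unfolding G by (rule imageI)
  next
    fix G M assume "G \<in> ?\<G>" and M: "M \<in> configurations P fst G"
    then obtain D where D: "D \<in> digraphs_with_degrees n a b" "G = split_graph D" by auto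
    note M' = M[unfolded D(2)]
    show "M \<in> avoiders bad {}"
    proof (rule configuration_avoiders_bad[OF M', where \<tau> = fst])
      fix x y :: "(nat \<times> bool) \<times> nat" assume "{fst x, fst y} \<in> split_graph D"
      then show "False \<or> ?col x \<noteq> ?col y" unfolding split_graph_def by (auto simp: doubleton_eq_iff)
    next
      fix s t :: "nat \<times> bool" assume "{s, t} \<in> split_graph D"
      then obtain u v where uv: "(u, v) \<in> D" "{s, t} = {(u, True), (v, False)}"
        unfolding split_graph_def by auto
      have "u \<noteq> v" using D(1) uv(1) unfolding digraphs_with_degrees_def by blast
      then show "fst s \<noteq> fst t" using uv(2) by (auto simp: doubleton_eq_iff)
    next
      fix g h assume g: "g \<in> split_graph D" and h: "h \<in> split_graph D" and eq: "fst ` g = fst ` h"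
      obtain u v u' v' where uv: "g = {(u, True), (v, False)}" "(u, v) \<in> D"
        "h = {(u', True), (v', False)}" "(u', v') \<in> D"
        using g h unfolding split_graph_def by auto
      have "{u, v} = {u', v'}" using eq uv by simp
      moreover have "(v, u) \<notin> D" using D(1) uv(2) unfolding digraphs_with_degrees_def by blast
      ultimately show "g = h" using uv by (auto simp: doubleton_eq_iff)
    qed simp
  next
    fix G g assume "G \<in> ?\<G>" "g \<in> G"
    then show "card g = 2" unfolding split_graph_def by (auto simp: card_insert_if)
  next
    fix G assume "G \<in> ?\<G>"
    then obtain D where D: "D \<in> digraphs_with_degrees n a b" "G = split_graph D" by auto
    have sub: "D \<subseteq> {1..n} \<times> {1..n}" using D(1) unfolding digraphs_with_degrees_def by auto
    then have "finite D" using finite_subset by blast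
    then show "finite G" unfolding D(2) split_graph_def by simp
    fix s :: "nat \<times> bool"
    obtain v c where s: "s = (v, c)" by (cases s)
    show "card {x \<in> P. fst x = s} = card {g \<in> G. s \<in> g}"
    proof (cases "v \<in> {1..n}")
      case True
      then show ?thesis using D cfib[of s] split_graph_degree[of D v] s
        unfolding digraphs_with_degrees_def by (cases c) (auto simp: m_simps)
    next
      case False
      have "out_degree D v = 0" "in_degree D v = 0"
      proof -
        have "{w. (v, w) \<in> D} = {}" "{u. (u, v) \<in> D} = {}" using False sub by auto
        then show "out_degree D v = 0" "in_degree D v = 0"
          unfolding out_degree_def in_degree_def by simp_all
      qed
      then show ?thesis using False D(2) cfib[of s] split_graph_degree[of D v] s by (cases c) auto
    qed
  next
    show "fst ` P \<subseteq> ?S" using mem by force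
  qed (use finite_digraphs_with_degrees in auto)
  also have "card ?\<G> = card (digraphs_with_degrees n a b)"
    using inj_split_graph by (intro card_image) (auto intro: inj_on_subset)
  also have "(\<Prod>s\<in>?S. fact (card {x \<in> P. fst x = s})) = (\<Prod>s\<in>?S. fact (m s) :: nat)"
    unfolding cfib by (intro prod.cong) auto
  also have "\<dots> = (\<Prod>v\<in>{1..n}. \<Prod>c\<in>UNIV. fact (m (v, c)))" by (simp add: prod.cartesian_product)
  also have "\<dots> = (\<Prod>v=1..n. fact (a v) * fact (b v))" by (simp add: UNIV_bool m_simps)
  finally have card_eq: "real (card (avoiders bad {})) =
      real (card (digraphs_with_degrees n a b)) * (\<Prod>v=1..n. fact (a v) * fact (b v))" by simp
  have F: "card {x \<in> P. ?cell x = v \<and> ?col x = c} = (if v \<in> {1..n} then m (v, c) else 0)" for v c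
  proof -
    have "{x \<in> P. ?cell x = v \<and> ?col x = c} = {x \<in> P. fst x = (v, c)}" by auto
    then show ?thesis using cfib[of "(v, c)"] by simp
  qed
  have cm: "card (coloured_mates c c') = (\<Sum>v\<in>{1..n}.
      if c = c' then m (v, c) * (m (v, c) - 1) else m (v, c) * m (v, c'))" for c c'
    by (subst card_coloured_mates[of "{1..n}"]) (use mem in \<open>auto simp: F intro!: sum.cong\<close>)
  have cms: "real (card (coloured_mates True True)) = B" "real (card (coloured_mates False False)) = A"
    "real (card (coloured_mates True False)) = C" "real (card (coloured_mates False True)) = C"
    unfolding cm A_def B_def C_def by (simp_all add: mult.commute m_simps)
  have pf: "(\<Prod>j<N. real (1 * j + 1)) = fact N"
    by (simp add: fact_prod_Suc of_nat_prod lessThan_atLeast0)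
  have "real (card loop_pairs) = 2 * C" "real (card double_tuples) = 2 * (A * B + C\<^sup>2)"
    using card_double_tuples_directed by (simp_all add: cms power2_eq_square algebra_simps)
  then have "real (card loop_pairs) / 2 * (1 / real N) + real (card double_tuples) / 4 * (1 / real N)\<^sup>2 =
     C / real N + (A * B + C\<^sup>2) / 2 / (real N)\<^sup>2"
    using N_ge by (simp add: power_divide field_simps)
  then show ?thesis
    using simple_matchings_asymptotics[OF ne] unfolding card_eq m1 pf by simp
qed

section \<open>The expected number of orientations\<close>

lemma orientation_graph_arcs:
  assumes E: "E \<in> graphs_with_degrees n d" and A: "orientation E A"
  shows "A \<subseteq> {1..n} \<times> {1..n}" "(u, v) \<in> A \<Longrightarrow> u \<noteq> v" "(u, v) \<in> A \<Longrightarrow> (v, u) \<notin> A"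
proof -
  have bij: "inj_on (\<lambda>(u, v). {u, v}) A" "(\<lambda>(u, v). {u, v}) ` A = E"
    using A unfolding orientation_def bij_betw_def by auto
  have *: "{u, v} \<subseteq> {1..n} \<and> card {u, v} = 2" if "(u, v) \<in> A" for u v
  proof -
    have "{u, v} \<in> E" using that bij(2) by force
    then show ?thesis using E unfolding graphs_with_degrees_def nsets_def by blast
  qed
  show "A \<subseteq> {1..n} \<times> {1..n}" using * by force
  show ne: "u \<noteq> v" if "(u, v) \<in> A" for u v
    using *[OF that] by auto
  show "(v, u) \<notin> A" if "(u, v) \<in> A"
  proof
    assume "(v, u) \<in> A"
    moreover have "(\<lambda>(u, v). {u, v}) (u, v) = (\<lambda>(u, v). {u, v}) (v, u)" by auto
    ultimately have "(u, v) = (v, u)" using inj_onD[OF bij(1)] that by blast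
    then show False using ne[OF that] by simp
  qed
qed

lemma vertex_degree_orientation:
  assumes A: "orientation E A" and fin: "finite A" and ne: "\<And>u v. (u, v) \<in> A \<Longrightarrow> u \<noteq> v"
  shows "vertex_degree E v = in_degree A v + out_degree A v"
proof -
  let ?f = "\<lambda>(u, v). {u, v}"
  let ?O = "{w. (v, w) \<in> A}" and ?I = "{u. (u, v) \<in> A}"
  have bij: "inj_on ?f A" "?f ` A = E"
    using A unfolding orientation_def bij_betw_def by auto
  have sub: "?I \<times> {v} \<union> {v} \<times> ?O \<subseteq> A" by auto
  then have fin': "finite (?I \<times> {v} \<union> {v} \<times> ?O)" using fin finite_subset by blast
  have "{e \<in> E. v \<in> e} = ?f ` (?I \<times> {v} \<union> {v} \<times> ?O)"
    using bij(2) by (auto simp: image_iff)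
  then have "vertex_degree E v = card (?I \<times> {v} \<union> {v} \<times> ?O)"
    unfolding vertex_degree_def using bij(1) sub
    by (simp add: card_image inj_on_subset)
  also have "\<dots> = card (?I \<times> {v}) + card ({v} \<times> ?O)"
    using fin' ne by (intro card_Un_disjoint) auto
  finally show ?thesis unfolding in_degree_def out_degree_def by (simp add: card_cartesian_product)
qed

text \<open>An arc set determines its underlying graph, so the orientations of different graphs are
  disjoint families whose union is the set of all digraphs with these degrees.\<close>

lemma sum_card_orientations:
  assumes ab: "\<And>v. v \<in> {1..n} \<Longrightarrow> ins v = real (a v)" "\<And>v. v \<in> {1..n} \<Longrightarrow> outs v = real (b v)"
    "\<And>v. v \<in> {1..n} \<Longrightarrow> a v + b v = d v"
  shows "(\<Sum>E\<in>graphs_with_degrees n d. card (orientations_with_degrees n ins outs E)) =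
           card (digraphs_with_degrees n a b)"
proof -
  let ?G = "graphs_with_degrees n d" and ?O = "orientations_with_degrees n ins outs"
  let ?f = "\<lambda>(u :: nat, v). {u, v}"
  have un: "digraphs_with_degrees n a b = (\<Union>E\<in>?G. ?O E)"
  proof (intro equalityI subsetI)
    fix A assume A: "A \<in> digraphs_with_degrees n a b"
    then have sub: "A \<subseteq> {1..n} \<times> {1..n}" and ne: "\<And>u v. (u, v) \<in> A \<Longrightarrow> u \<noteq> v \<and> (v, u) \<notin> A"
      and deg: "\<And>v. v \<in> {1..n} \<Longrightarrow> in_degree A v = a v \<and> out_degree A v = b v"
      unfolding digraphs_with_degrees_def by auto
    have fin: "finite A" using sub finite_subset by blast
    have "inj_on ?f A"
    proof (rule inj_onI, clarsimp)
      fix u v u' v' assume "(u, v) \<in> A" "(u', v') \<in> A" "{u, v} = {u', v'}"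
      then show "u = u' \<and> v = v'" using ne[of u v] by (auto simp: doubleton_eq_iff)
    qed
    then have ori: "orientation (?f ` A) A" unfolding orientation_def by (rule inj_on_imp_bij_betw)
    have "?f ` A \<subseteq> nsets {1..n} 2"
    proof
      fix e assume "e \<in> ?f ` A"
      then obtain u v where uv: "(u, v) \<in> A" "e = {u, v}" by auto
      moreover have "u \<in> {1..n}" "v \<in> {1..n}" "u \<noteq> v" using uv(1) sub ne[OF uv(1)] by blast+
      ultimately show "e \<in> nsets {1..n} 2" by (simp add: nsets_def)
    qed
    moreover have "vertex_degree (?f ` A) v = d v" if "v \<in> {1..n}" for v
      using vertex_degree_orientation[OF ori fin] ne deg[OF that] ab(3)[OF that] by auto
    ultimately have "?f ` A \<in> ?G" unfolding graphs_with_degrees_def by auto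
    moreover have "A \<in> ?O (?f ` A)"
      using ori deg ab(1,2) unfolding orientations_with_degrees_def by auto
    ultimately show "A \<in> (\<Union>E\<in>?G. ?O E)" by blast
  next
    fix A assume "A \<in> (\<Union>E\<in>?G. ?O E)"
    then obtain E where E: "E \<in> ?G" "A \<in> ?O E" by auto
    then have ori: "orientation E A" unfolding orientations_with_degrees_def by auto
    have "in_degree A v = a v \<and> out_degree A v = b v" if "v \<in> {1..n}" for v
    proof -
      have "real (in_degree A v) = ins v \<and> real (out_degree A v) = outs v"
        using E(2) that unfolding orientations_with_degrees_def by blast
      then show ?thesis using ab(1,2)[OF that] by simp
    qed
    then show "A \<in> digraphs_with_degrees n a b"
      using orientation_graph_arcs[OF E(1) ori] unfolding digraphs_with_degrees_def by blast
  qed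
  have fin: "finite (?O E)" if "E \<in> ?G" for E
    using that by (intro finite_subset[OF _ finite_digraphs_with_degrees[of n a b, unfolded un]]) blast
  have "card (\<Union>E\<in>?G. ?O E) = (\<Sum>E\<in>?G. card (?O E))"
  proof (rule card_UN_disjoint)
    show "\<forall>E\<in>?G. \<forall>F\<in>?G. E \<noteq> F \<longrightarrow> ?O E \<inter> ?O F = {}"
      unfolding orientations_with_degrees_def orientation_def bij_betw_def by blast
  qed (use fin finite_graphs_with_degrees in auto)
  then show ?thesis unfolding un by simp
qed

lemma expected_orientations_eq:
  assumes "graphical n d"
    and "\<And>v. v \<in> {1..n} \<Longrightarrow> real (d v) / 2 - \<delta> v = real (a v)"
    and "\<And>v. v \<in> {1..n} \<Longrightarrow> real (d v) / 2 + \<delta> v = real (b v)"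
  shows "expected_orientations n d \<delta> =
    real (card (digraphs_with_degrees n a b)) / real (card (graphs_with_degrees n d))"
proof -
  have ab: "a v + b v = d v" if "v \<in> {1..n}" for v
  proof -
    have "real (a v + b v) = real (d v)" using assms(2,3)[OF that] by simp
    then show ?thesis by (simp only: of_nat_eq_iff)
  qed
  let ?O = "orientations_with_degrees n (\<lambda>v. real (d v) / 2 - \<delta> v) (\<lambda>v. real (d v) / 2 + \<delta> v)"
  have "expected_orientations n d \<delta> =
      (\<Sum>E\<in>graphs_with_degrees n d. real (card (?O E))) / real (card (graphs_with_degrees n d))"
    unfolding expected_orientations_def random_graph_def
    using assms(1) finite_graphs_with_degrees unfolding graphical_def
    by (intro integral_pmf_of_set) auto
  also have "(\<Sum>E\<in>graphs_with_degrees n d. real (card (?O E))) =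
      real (\<Sum>E\<in>graphs_with_degrees n d. card (?O E))" by simp
  also have "(\<Sum>E\<in>graphs_with_degrees n d. card (?O E)) = card (digraphs_with_degrees n a b)"
    using assms(2,3) ab by (intro sum_card_orientations) auto
  finally show ?thesis .
qed

text \<open>In-degree and out-degree sum to \<open>d v\<close>, so they are equal exactly if both
  are half of it.\<close>

lemma expected_eulerian_orientations_eq:
  assumes "graphical n d" and even: "\<And>v. v \<in> {1..n} \<Longrightarrow> even (d v)"
  shows "expected_eulerian_orientations n d = expected_orientations n d (\<lambda>_. 0)"
proof -
  have eq: "eulerian_orientations n E =
      orientations_with_degrees n (\<lambda>v. real (d v) / 2 - 0) (\<lambda>v. real (d v) / 2 + 0) E"
    if E: "E \<in> graphs_with_degrees n d" for E
  proof -
    have "in_degree A v = out_degree A v \<longleftrightarrow>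
        real (in_degree A v) = real (d v) / 2 - 0 \<and> real (out_degree A v) = real (d v) / 2 + 0"
      if A: "orientation E A" and v: "v \<in> {1..n}" for A v
    proof -
      note arcs = orientation_graph_arcs[OF E A]
      have "finite A" using arcs(1) finite_subset by blast
      then have "vertex_degree E v = in_degree A v + out_degree A v"
        using vertex_degree_orientation[OF A] arcs(2) by blast
      moreover have "vertex_degree E v = d v" using E v unfolding graphs_with_degrees_def by auto
      ultimately have "real (d v) = real (in_degree A v) + real (out_degree A v)" by simp
      moreover have "i = out \<longleftrightarrow> i = D / 2 - 0 \<and> out = D / 2 + 0" if "D = i + out" for i out D :: real
        using that by auto
      ultimately have "real (in_degree A v) = real (out_degree A v) \<longleftrightarrow>
          real (in_degree A v) = real (d v) / 2 - 0 \<and> real (out_degree A v) = real (d v) / 2 + 0"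
        by blast
      then show ?thesis by (simp only: of_nat_eq_iff)
    qed
    then show ?thesis unfolding eulerian_orientations_def orientations_with_degrees_def by blast
  qed
  let ?G = "graphs_with_degrees n d"
  have G: "?G \<noteq> {}" "finite ?G"
    using assms(1) finite_graphs_with_degrees unfolding graphical_def by auto
  show ?thesis
    unfolding expected_eulerian_orientations_def expected_orientations_def random_graph_def
      integral_pmf_of_set[OF G]
    by (intro arg_cong2[where f = "(/)"] sum.cong refl) (simp only: eq)
qed

text \<open>The double factorial (2N - 1)!!, the number of perfect matchings of 2N points.\<close>

lemma prod_odd_eq: "(\<Prod>j<N. real (2 * j + 1)) = fact (2 * N) / (2 ^ N * fact N)"
proof (induction N)
  case (Suc N)
  have "fact (2 * Suc N) = (2 * real N + 2) * ((2 * real N + 1) * fact (2 * N))"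
    by (simp add: algebra_simps)
  moreover have "fact (Suc N) = (real N + 1) * fact N" by simp
  moreover have "x / (p * f) * m = (2 * k + 2) * (m * x) / (2 * p * ((k + 1) * f))"
    if "k \<ge> 0" "p > 0" "f > 0" for x p f m k :: real
    using that by (simp add: divide_simps)
  from this[of "real N" "2 ^ N" "fact N" "fact (2 * N)" "2 * real N + 1"]
  have "fact (2 * N) / (2 ^ N * fact N) * (2 * real N + 1) =
      (2 * real N + 2) * ((2 * real N + 1) * fact (2 * N)) / (2 * 2 ^ N * ((real N + 1) * fact N))"
    by simp
  moreover have "(\<Prod>j<Suc N. real (2 * j + 1)) = (\<Prod>j<N. real (2 * j + 1)) * (2 * real N + 1)"
    by simp
  ultimately show ?case unfolding Suc.IH by (simp only: power_Suc)
qed simp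

text \<open>Truncated subtraction is harmless: for \<open>f v = 0\<close> both sides have the
  summand 0.\<close>

lemma sum_mult_pred:
  "real (\<Sum>v\<in>A. f v * (f v - 1)) = (\<Sum>v\<in>A. (real (f v))\<^sup>2) - real (\<Sum>v\<in>A. f v)"
proof -
  have "real (k * (k - 1)) = (real k)\<^sup>2 - real k" for k
    by (cases k) (simp_all add: power2_eq_square algebra_simps)
  then show ?thesis by (simp only: of_nat_sum sum_subtractf)
qed

text \<open>\<open>S\<close> stands for the sum of the squared degrees.\<close>

lemma exponent_identity:
  fixes S V \<Delta> M :: real
  assumes "M > 0"
  shows "(S - 2 * M) / 2 * (1 / (2 * M)) + (S - 2 * M)\<^sup>2 / 4 * (1 / (2 * M))\<^sup>2 -
     ((S / 4 - \<Delta>) / M + ((S / 4 - V + \<Delta> - M) * (S / 4 + V + \<Delta> - M) + (S / 4 - \<Delta>)\<^sup>2) / 2 / M\<^sup>2) =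
     - 3 / 4 + 4 * \<Delta> / (2 * M) - 4 * \<Delta>\<^sup>2 / (2 * M)\<^sup>2 + 2 * V\<^sup>2 / (2 * M)\<^sup>2"
  using assms by (simp add: divide_simps power2_eq_square) (simp add: algebra_simps)

text \<open>Divides the two asymptotic counts. The numbers of perfect matchings, N! and (2N)!/(2^N
  N!), give the power of 2 over the central binomial coefficient; the numbers of configurations over
  a digraph and over a graph give the binomial coefficients at the vertices.\<close>

lemma expected_orientations_estimate:
  assumes gr: "graphical n d"
    and nat: "\<And>v. v \<in> {1..n} \<Longrightarrow> real (d v) / 2 - \<delta> v \<in> \<nat> \<and> real (d v) / 2 + \<delta> v \<in> \<nat>"
    and sum0: "(\<Sum>v=1..n. \<delta> v) = 0"
    and D: "D = degree_sum n d" "D > 0"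
    and small: "2000 * real (d_max n d) ^ 4 \<le> real D"
  shows "\<exists>\<epsilon>. \<bar>\<epsilon>\<bar> \<le> 20000 * (real (d_max n d) ^ 4 / real D) \<and>
    expected_orientations n d \<delta> =
      2 ^ (D div 2) / real (D choose (D div 2)) *
      (\<Prod>v=1..n. real (d v choose nat \<lfloor>real (d v) / 2 + \<delta> v\<rfloor>)) *
      exp (- 3 / 4 + 4 * Delta2 n \<delta> / real D - 4 * (Delta2 n \<delta>)\<^sup>2 / (real D)\<^sup>2
           + 2 * (V_sum n d \<delta>)\<^sup>2 / (real D)\<^sup>2 + \<epsilon>)"
proof -
  define a where "a v = nat \<lfloor>real (d v) / 2 - \<delta> v\<rfloor>" for v
  define b where "b v = nat \<lfloor>real (d v) / 2 + \<delta> v\<rfloor>" for v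
  define N where "N = (\<Sum>v=1..n. a v)"
  define r where "r = d_max n d"
  have a: "real (a v) = real (d v) / 2 - \<delta> v" and b: "real (b v) = real (d v) / 2 + \<delta> v"
    if "v \<in> {1..n}" for v
    using nat[OF that] unfolding a_def b_def by (auto elim!: Nats_cases)
  have ab: "a v + b v = d v" if "v \<in> {1..n}" for v
  proof -
    have "real (a v + b v) = real (d v)" using a[OF that] b[OF that] by simp
    then show ?thesis by (simp only: of_nat_eq_iff)
  qed
  have "real (\<Sum>v=1..n. b v) = real (\<Sum>v=1..n. a v)"
    using sum0 by (simp add: a b sum.distrib sum_subtractf)
  then have sumb: "(\<Sum>v=1..n. b v) = N" unfolding N_def by (simp only: of_nat_eq_iff)
  have "D = (\<Sum>v=1..n. a v + b v)" unfolding D(1) degree_sum_def using ab by (intro sum.cong) auto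
  then have DN: "D = 2 * N" using sumb unfolding N_def by (simp add: sum.distrib)
  have N0: "real N > 0" using D(2) DN by simp
  have n0: "{1..n} \<noteq> {}" using D unfolding degree_sum_def by (metis gr0_conv_Suc nat.simps(3) sum.empty)
  have dr: "d v \<le> r" if "v \<in> {1..n}" for v
    unfolding r_def d_max_def using that by (intro Max_ge) auto
  have r1: "r \<ge> 1"
  proof (rule ccontr)
    assume "\<not> r \<ge> 1"
    then have "d v = 0" if "v \<in> {1..n}" for v using dr[OF that] by simp
    then show False using D unfolding degree_sum_def by simp
  qed
  have "real r ^ 2 \<le> real r ^ 4" using r1 by (intro power_increasing) auto
  \<comment> \<open>As \<open>D = 2 * N\<close>, \<open>small\<close> says that \<open>N\<close> is
    at least \<open>1000 * r^4\<close>.\<close>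
  then have "real (1000 * r\<^sup>2) \<le> real N" using small unfolding r_def[symmetric] DN by simp
  then have Nr: "1000 * r\<^sup>2 \<le> N" by (simp only: of_nat_le_iff)
  have deg: "(\<Sum>v=1..n. d v) = 2 * N" using D(1) DN unfolding degree_sum_def by simp
  define S where "S = (\<Sum>v=1..n. (real (d v))\<^sup>2)"
  let ?\<Delta> = "Delta2 n \<delta>" and ?V = "V_sum n d \<delta>"
  have sums: "real (\<Sum>v=1..n. d v) = 2 * real N" "real (\<Sum>v=1..n. a v) = real N"
    "real (\<Sum>v=1..n. b v) = real N"
    using deg sumb N_def by simp_all
  have A: "real (\<Sum>v=1..n. d v * (d v - 1)) = S - 2 * real N"
    unfolding sum_mult_pred sums(1) S_def ..
  have "real (\<Sum>v=1..n. a v * (a v - 1)) = (\<Sum>v=1..n. (real (a v))\<^sup>2) - real N"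
    unfolding sum_mult_pred sums(2) ..
  also have "(\<Sum>v=1..n. (real (a v))\<^sup>2) =
      (\<Sum>v=1..n. (real (d v))\<^sup>2 / 4 - \<delta> v * real (d v) + (\<delta> v)\<^sup>2)"
    by (rule sum.cong[OF refl]) (simp only: a, simp add: power2_eq_square field_simps)
  also have "\<dots> = S / 4 - ?V + ?\<Delta>"
    by (simp add: sum.distrib sum_subtractf S_def V_sum_def Delta2_def sum_divide_distrib)
  finally have A': "real (\<Sum>v=1..n. a v * (a v - 1)) = S / 4 - ?V + ?\<Delta> - real N" .
  have "real (\<Sum>v=1..n. b v * (b v - 1)) = (\<Sum>v=1..n. (real (b v))\<^sup>2) - real N"
    unfolding sum_mult_pred sums(3) ..
  also have "(\<Sum>v=1..n. (real (b v))\<^sup>2) =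
      (\<Sum>v=1..n. (real (d v))\<^sup>2 / 4 + \<delta> v * real (d v) + (\<delta> v)\<^sup>2)"
    by (rule sum.cong[OF refl]) (simp only: b, simp add: power2_eq_square field_simps)
  also have "\<dots> = S / 4 + ?V + ?\<Delta>"
    by (simp add: sum.distrib S_def V_sum_def Delta2_def sum_divide_distrib)
  finally have B': "real (\<Sum>v=1..n. b v * (b v - 1)) = S / 4 + ?V + ?\<Delta> - real N" .
  have "real (\<Sum>v=1..n. a v * b v) = (\<Sum>v=1..n. (real (d v))\<^sup>2 / 4 - (\<delta> v)\<^sup>2)"
    unfolding of_nat_sum of_nat_mult
    by (rule sum.cong[OF refl]) (simp only: a b, simp add: power2_eq_square field_simps)
  also have "\<dots> = S / 4 - ?\<Delta>"
    by (simp add: sum_subtractf S_def Delta2_def sum_divide_distrib)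
  finally have C': "real (\<Sum>v=1..n. a v * b v) = S / 4 - ?\<Delta>" .
  let ?Lu = "(S - 2 * real N) / 2 * (1 / (2 * real N)) + (S - 2 * real N)\<^sup>2 / 4 * (1 / (2 * real N))\<^sup>2"
  let ?Ld = "(S / 4 - ?\<Delta>) / real N + ((S / 4 - ?V + ?\<Delta> - real N) * (S / 4 + ?V + ?\<Delta> - real N) +
     (S / 4 - ?\<Delta>)\<^sup>2) / 2 / (real N)\<^sup>2"
  let ?G = "real (card (graphs_with_degrees n d))" and ?H = "real (card (digraphs_with_degrees n a b))"
  let ?Fd = "\<Prod>v=1..n. fact (d v) :: real" and ?Fab = "\<Prod>v=1..n. fact (a v) * fact (b v) :: real"
  obtain \<epsilon>1 where e1: "\<bar>\<epsilon>1\<bar> \<le> 5000 * real r ^ 4 / real N"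
    "?G * ?Fd = (\<Prod>j<N. real (2 * j + 1)) * exp (- ?Lu + \<epsilon>1)"
    using card_graphs_asymptotics[OF deg dr r1 Nr] unfolding A by blast
  have abr: "a v + b v \<le> r" if "v \<in> {1..n}" for v using ab[OF that] dr[OF that] by simp
  obtain \<epsilon>2 where e2: "\<bar>\<epsilon>2\<bar> \<le> 5000 * real r ^ 4 / real N"
    "?H * ?Fab = fact N * exp (- ?Ld + \<epsilon>2)"
    using card_digraphs_asymptotics[OF N_def[symmetric] sumb abr r1 Nr] unfolding A' B' C' by blast
  have F0: "?Fd > 0" "?Fab > 0" by (auto intro!: prod_pos)
  have "?G = (\<Prod>j<N. real (2 * j + 1)) * exp (- ?Lu + \<epsilon>1) / ?Fd"
    using e1(2) F0 by (simp add: field_simps)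
  also have "\<dots> = fact (2 * N) / (2 ^ N * fact N) * exp (- ?Lu + \<epsilon>1) / ?Fd"
    unfolding prod_odd_eq ..
  finally have G: "?G = fact (2 * N) / (2 ^ N * fact N) * exp (- ?Lu + \<epsilon>1) / ?Fd" .
  have H: "?H = fact N * exp (- ?Ld + \<epsilon>2) / ?Fab"
    using e2(2) F0 by (simp add: field_simps)
  have "expected_orientations n d \<delta> = ?H / ?G"
    using gr a b by (intro expected_orientations_eq) auto
  also have "\<dots> = (2 ^ N * (fact N * fact N / fact (2 * N))) * (?Fd / ?Fab) *
      (exp (- ?Ld + \<epsilon>2) / exp (- ?Lu + \<epsilon>1))"
    unfolding G H using F0 by (simp add: field_simps)
  also have "fact N * fact N / fact (2 * N) = 1 / real (D choose (D div 2))"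
    unfolding DN by (simp add: binomial_fact)
  also have "?Fd / ?Fab = (\<Prod>v=1..n. real (d v choose b v))"
    unfolding prod_dividef[symmetric]
  proof (rule prod.cong[OF refl])
    fix v assume v: "v \<in> {1..n}"
    have "d v - b v = a v" "b v \<le> d v" using ab[OF v] by auto
    then show "fact (d v) / (fact (a v) * fact (b v)) = real (d v choose b v)"
      by (simp add: binomial_fact mult.commute)
  qed
  also have "exp (- ?Ld + \<epsilon>2) / exp (- ?Lu + \<epsilon>1) = exp ((?Lu - ?Ld) + (\<epsilon>2 - \<epsilon>1))"
    unfolding exp_diff[symmetric] by (simp add: algebra_simps)
  \<comment> \<open>Here the sum \<open>S\<close> of squared degrees cancels.\<close>
  also have "?Lu - ?Ld = - 3 / 4 + 4 * ?\<Delta> / real D - 4 * ?\<Delta>\<^sup>2 / (real D)\<^sup>2 + 2 * ?V\<^sup>2 / (real D)\<^sup>2"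
    using exponent_identity[OF N0, of S ?\<Delta> ?V] unfolding DN by simp
  finally have "expected_orientations n d \<delta> =
      2 ^ (D div 2) / real (D choose (D div 2)) *
      (\<Prod>v=1..n. real (d v choose nat \<lfloor>real (d v) / 2 + \<delta> v\<rfloor>)) *
      exp (- 3 / 4 + 4 * ?\<Delta> / real D - 4 * ?\<Delta>\<^sup>2 / (real D)\<^sup>2 + 2 * ?V\<^sup>2 / (real D)\<^sup>2 + (\<epsilon>2 - \<epsilon>1))"
    unfolding b_def DN by simp
  moreover have "\<bar>\<epsilon>2 - \<epsilon>1\<bar> \<le> 20000 * (real (d_max n d) ^ 4 / real D)"
  proof -
    have "\<bar>\<epsilon>2 - \<epsilon>1\<bar> \<le> 5000 * real r ^ 4 / real N + 5000 * real r ^ 4 / real N"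
      using e1(1) e2(1) by linarith
    \<comment> \<open>Two errors of 5000 over \<open>N\<close>, with \<open>N\<close> equal to
      D/2.\<close>
    also have "\<dots> = 20000 * (real r ^ 4 / real D)" using N0 unfolding DN by (simp add: field_simps)
    finally show ?thesis unfolding r_def .
  qed
  ultimately show ?thesis by blast
qed

text \<open>Turns an estimate for each single instance into an error function by choice; that
  \<open>c\<close> is the same for all indices is what makes the function
  O(\<open>h\<close>).\<close>

lemma error_term_exists:
  fixes X :: "'i \<Rightarrow> real"
  assumes "\<forall>\<^sub>F i in F. \<exists>\<epsilon>. \<bar>\<epsilon>\<bar> \<le> c * h i \<and> X i = M i * exp (L i + \<epsilon>)" and "\<And>i. h i \<ge> 0"
  shows "\<exists>err. err \<in> O[F](h) \<and> (\<forall>\<^sub>F i in F. X i = M i * exp (L i + err i))"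
proof -
  define err where "err i = (SOME \<epsilon>. \<bar>\<epsilon>\<bar> \<le> c * h i \<and> X i = M i * exp (L i + \<epsilon>))" for i
  have ev: "\<forall>\<^sub>F i in F. \<bar>err i\<bar> \<le> c * h i \<and> X i = M i * exp (L i + err i)"
    using assms(1) by eventually_elim (unfold err_def, rule someI_ex)
  then have "\<forall>\<^sub>F i in F. norm (err i) \<le> c * norm (h i)"
    using assms(2) by (auto elim!: eventually_mono)
  then have "err \<in> O[F](h)" by (rule bigoI)
  then show ?thesis using ev by (auto elim: eventually_mono)
qed

theorem theorem5p5:
  fixes F :: "'i filter"
    and n :: "'i \<Rightarrow> nat"
    and d :: "'i \<Rightarrow> nat \<Rightarrow> nat"
  assumes graphical: "\<And>i. graphical (n i) (d i)"
    and D_to_infinity: "filterlim (\<lambda>i. degree_sum (n i) (d i)) at_top F"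
    and d_max_small:
      "(\<lambda>i. real (d_max (n i) (d i)) ^ 4) \<in> o[F](\<lambda>i. real (degree_sum (n i) (d i)))"
  shows
    "(\<forall>\<delta> :: 'i \<Rightarrow> nat \<Rightarrow> real.
        (\<forall>i. \<forall>v\<in>{1..n i}. real (d i v) / 2 - \<delta> i v \<in> \<nat> \<and> real (d i v) / 2 + \<delta> i v \<in> \<nat>) \<longrightarrow>
        (\<forall>i. (\<Sum>v=1..n i. \<delta> i v) = 0) \<longrightarrow>
        (\<exists>err :: 'i \<Rightarrow> real.
           err \<in> O[F](\<lambda>i. real (d_max (n i) (d i)) ^ 4 / real (degree_sum (n i) (d i))) \<and>
           (\<forall>\<^sub>F i in F.
              let D = degree_sum (n i) (d i);
                  \<Delta>\<^sub>2 = Delta2 (n i) (\<delta> i);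
                  V = V_sum (n i) (d i) (\<delta> i)
              in expected_orientations (n i) (d i) (\<delta> i) =
                   2 ^ (D div 2) / real (D choose (D div 2)) *
                   (\<Prod>v=1..n i. real (d i v choose nat \<lfloor>real (d i v) / 2 + \<delta> i v\<rfloor>)) *
                   exp (- 3 / 4 + 4 * \<Delta>\<^sub>2 / real D - 4 * \<Delta>\<^sub>2\<^sup>2 / (real D)\<^sup>2
                        + 2 * V\<^sup>2 / (real D)\<^sup>2 + err i)))) \<and>
     ((\<forall>i. \<forall>v\<in>{1..n i}. even (d i v)) \<longrightarrow>
        (\<exists>err :: 'i \<Rightarrow> real.
           err \<in> O[F](\<lambda>i. real (d_max (n i) (d i)) ^ 4 / real (degree_sum (n i) (d i))) \<and>
           (\<forall>\<^sub>F i in F.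
              let D = degree_sum (n i) (d i)
              in expected_eulerian_orientations (n i) (d i) =
                   2 ^ (D div 2) / real (D choose (D div 2)) *
                   (\<Prod>v=1..n i. real (d i v choose (d i v div 2))) *
                   exp (- 3 / 4 + err i))))"
proof -
  let ?D = "\<lambda>i. degree_sum (n i) (d i)"
  let ?h = "\<lambda>i. real (d_max (n i) (d i)) ^ 4 / real (?D i)"
  have large: "\<forall>\<^sub>F i in F. ?D i > 0 \<and> 2000 * real (d_max (n i) (d i)) ^ 4 \<le> real (?D i)"
  proof -
    have "\<forall>\<^sub>F i in F. ?D i \<ge> 1" using D_to_infinity by (simp add: filterlim_at_top)
    \<comment> \<open>The constant 1/2000 in the little-o condition is the one that
      \<open>expected_orientations_estimate\<close> asks for.\<close>
    moreover have "\<forall>\<^sub>F i in F. norm (real (d_max (n i) (d i)) ^ 4) \<le> 1 / 2000 * norm (real (?D i))"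
      using landau_o.smallD[OF d_max_small, of "1 / 2000"] by simp
    ultimately show ?thesis by eventually_elim auto
  qed
  have general: "\<exists>err. err \<in> O[F](?h) \<and> (\<forall>\<^sub>F i in F. expected_orientations (n i) (d i) (\<delta> i) =
      2 ^ (?D i div 2) / real (?D i choose (?D i div 2)) *
      (\<Prod>v=1..n i. real (d i v choose nat \<lfloor>real (d i v) / 2 + \<delta> i v\<rfloor>)) *
      exp (- 3 / 4 + 4 * Delta2 (n i) (\<delta> i) / real (?D i) - 4 * (Delta2 (n i) (\<delta> i))\<^sup>2 / (real (?D i))\<^sup>2
        + 2 * (V_sum (n i) (d i) (\<delta> i))\<^sup>2 / (real (?D i))\<^sup>2 + err i))"
    if "\<forall>i. \<forall>v\<in>{1..n i}. real (d i v) / 2 - \<delta> i v \<in> \<nat> \<and> real (d i v) / 2 + \<delta> i v \<in> \<nat>"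
      "\<forall>i. (\<Sum>v=1..n i. \<delta> i v) = 0" for \<delta> :: "'i \<Rightarrow> nat \<Rightarrow> real"
  proof (rule error_term_exists)
    show "\<forall>\<^sub>F i in F. \<exists>\<epsilon>. \<bar>\<epsilon>\<bar> \<le> 20000 * ?h i \<and> expected_orientations (n i) (d i) (\<delta> i) =
      2 ^ (?D i div 2) / real (?D i choose (?D i div 2)) *
      (\<Prod>v=1..n i. real (d i v choose nat \<lfloor>real (d i v) / 2 + \<delta> i v\<rfloor>)) *
      exp (- 3 / 4 + 4 * Delta2 (n i) (\<delta> i) / real (?D i) - 4 * (Delta2 (n i) (\<delta> i))\<^sup>2 / (real (?D i))\<^sup>2
        + 2 * (V_sum (n i) (d i) (\<delta> i))\<^sup>2 / (real (?D i))\<^sup>2 + \<epsilon>)"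
      using large
    proof eventually_elim
      case (elim i)
      then show ?case
        using that by (intro expected_orientations_estimate[OF graphical _ _ refl]) auto
    qed
  qed simp
  show ?thesis
  proof (intro conjI allI impI)
    fix \<delta> :: "'i \<Rightarrow> nat \<Rightarrow> real"
    assume "\<forall>i. \<forall>v\<in>{1..n i}. real (d i v) / 2 - \<delta> i v \<in> \<nat> \<and> real (d i v) / 2 + \<delta> i v \<in> \<nat>"
      "\<forall>i. (\<Sum>v=1..n i. \<delta> i v) = 0"
    from general[OF this] show "\<exists>err. err \<in> O[F](?h) \<and>
           (\<forall>\<^sub>F i in F.
              let D = degree_sum (n i) (d i);
                  \<Delta>\<^sub>2 = Delta2 (n i) (\<delta> i);
                  V = V_sum (n i) (d i) (\<delta> i)
              in expected_orientations (n i) (d i) (\<delta> i) =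
                   2 ^ (D div 2) / real (D choose (D div 2)) *
                   (\<Prod>v=1..n i. real (d i v choose nat \<lfloor>real (d i v) / 2 + \<delta> i v\<rfloor>)) *
                   exp (- 3 / 4 + 4 * \<Delta>\<^sub>2 / real D - 4 * \<Delta>\<^sub>2\<^sup>2 / (real D)\<^sup>2
                        + 2 * V\<^sup>2 / (real D)\<^sup>2 + err i))"
      unfolding Let_def .
  next
    assume even: "\<forall>i. \<forall>v\<in>{1..n i}. even (d i v)"
    \<comment> \<open>For even degrees the choice of zero for every \<open>\<delta> i v\<close> is
      admissible, and then \<open>Delta2\<close> and \<open>V_sum\<close> vanish.\<close>
    have half: "real (d i v) / 2 = real (d i v div 2)" if "v \<in> {1..n i}" for i v
      using even that by (simp add: real_of_nat_div)
    have "\<forall>i. \<forall>v\<in>{1..n i}. real (d i v) / 2 - 0 \<in> \<nat> \<and> real (d i v) / 2 + 0 \<in> \<nat>"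
      using half by simp
    from general[of "\<lambda>_ _. 0", OF this] obtain err where err: "err \<in> O[F](?h)"
      "\<forall>\<^sub>F i in F. expected_orientations (n i) (d i) (\<lambda>_. 0) =
      2 ^ (?D i div 2) / real (?D i choose (?D i div 2)) *
      (\<Prod>v=1..n i. real (d i v choose nat \<lfloor>real (d i v) / 2 + 0\<rfloor>)) * exp (- 3 / 4 + err i)"
      by (auto simp: Delta2_def V_sum_def)
    have prod: "(\<Prod>v=1..n i. real (d i v choose nat \<lfloor>real (d i v) / 2 + 0\<rfloor>)) =
        (\<Prod>v=1..n i. real (d i v choose (d i v div 2)))" for i
      using half[of _ i] by (intro prod.cong) auto
    have "expected_eulerian_orientations (n i) (d i) = expected_orientations (n i) (d i) (\<lambda>_. 0)" for i
      using graphical even by (intro expected_eulerian_orientations_eq) auto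
    then show "\<exists>err. err \<in> O[F](?h) \<and>
           (\<forall>\<^sub>F i in F.
              let D = degree_sum (n i) (d i)
              in expected_eulerian_orientations (n i) (d i) =
                   2 ^ (D div 2) / real (D choose (D div 2)) *
                   (\<Prod>v=1..n i. real (d i v choose (d i v div 2))) *
                   exp (- 3 / 4 + err i))"
      using err unfolding Let_def prod by auto
  qed
qed

end
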